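(* Let $0<\delta\le\frac12$ and $\rho=1-(1-2\delta)^{1/2}$. Let $\Phi:\mathcal H\to\mathbb R$ be such that $\exp(-\Phi)$ is $\gamma$-integrable. Assume that there are $R>0$, $\alpha_l>-\infty$ and a function $r:\mathbb R^+\to\mathbb R^+$ with $r(s)\le\frac{\rho}{2}s$ for all $s\ge R$ such that for all $x\in\mathcal H\setminus B_R(0)$ $$\inf_{z\in B_{r(\|x\|)}((1-\rho)x)}\exp\bigl(-\Phi(z)+\Phi(x)\bigr)>\exp(\alpha_l).$$ Let $V$ and $d$ be given by one of the following settings: (a) $\Phi$ is globally Lipschitz; either $r(s)=rs^a$ with constants $r>0$, $a\in(\frac12,1)$ and $V(x)=\|x\|^i$ ($i\in\mathbb N$) or $V(x)=\exp(v\|x\|)$ ($v>0$), or $r(s)=r$ with a constant $r>0$ and $V(x)=\|x\|^i$ ($i\in\mathbb N$); and $d(x,y)=1\wedge\frac{\|x-y\|}{\epsilon}$ with $\epsilon>0$ sufficiently small; (b) for every $\kappa>0$ there is $M_\kappa$ such that $\sup_{x\ne y\in B_s(0)}\frac{|\Phi(x)-\Phi(y)|}{\|x-y\|}\le M_\kappa e^{\kappa s}$ for all $s>0$; $r(s)=rs^a$ with constants $r>0$, $a\in(\frac12,1)$; $V(x)=\|x\|^i$ ($i\in\mathbb N$) or $V(x)=\exp(v\|x\|)$ ($v>0$); and $d(x,y)=1\wedge\inf_{T,\psi\in\mathsf A(T,x,y)}\frac1\epsilon\int_0^T\exp(\eta\|\psi(t)\|)\,dt$ with $\eta>0$ sufficiently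 small and $\epsilon>0$ sufficiently small (depending on $\eta$). Let $\tilde d(x,y)=\sqrt{d(x,y)(1+V(x)+V(y))}$. Suppose that $\operatorname{supp}\mu=\mathcal H$ and that $h:\mathcal H\to\mathbb R$ is Lipschitz with respect to $\tilde d$, i.e. $|h(x)-h(y)|\le L\,\tilde d(x,y)$ for all $x,y$. Then for arbitrary $X^0\in\mathcal H$, the pCN Markov chain $(X^n)_{n\in\mathbb N}$ with kernel $\mathcal P$ started at $X^0$ satisfies $$\Bigl|\frac1n\sum_{i=1}^nh(X^i)-\mathbb E_\mu h\Bigr|\to0\quad\text{almost surely as } n\to\infty.$$
   Context: $(\mathcal H,\langle\cdot,\cdot\rangle)$ is a separable Hilbert space with norm $\|\cdot\|$, $B_s(x)$ is the ball of radius $s$ centred at $x$, $\gamma$ is a centred Gaussian measure on $\mathcal H$, and $\mu(dx)=M\exp(-\Phi(x))\gamma(dx)$ with $M$ the normalising constant. The pCN kernel $\mathcal P$ on $\mathcal H$ is the transition kernel of the following Markov chain: from $X^n$, draw $\xi\sim\gamma$ independently, set $p=(1-2\delta)^{1/2}X^n+\sqrt{2\delta}\,\xi=(1-\rho)X^n+\sqrt{2\delta}\,\xi$, and let $X^{n+1}=p$ with probability $\alpha(X^n,p)$ and $X^{n+1}=X^n$ otherwise, where $\alpha(x,y)=1\wedge\exp(\Phi(x)-\Phi(y))$. Path space: $\mathsf A(T,x,y)=\{\psi\in C^1([0,T],\mathcal H):\psi(0)=x,\ \psi(T)=y,\ \|\dot\psi\|=1\}$, $T\ge0$. "Sufficiently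 small" for $\epsilon$ (and $\eta$) means: small enough that for some $\tilde n\in\mathbb N$ one has $\tilde d(\nu_1\mathcal P^{\tilde n},\nu_2\mathcal P^{\tilde n})\le\frac12\tilde d(\nu_1,\nu_2)$ for all probability measures $\nu_1,\nu_2$ on $\mathcal H$, where $\tilde d(\nu_1,\nu_2)=\inf_\pi\int\tilde d(x,y)\,\pi(dx,dy)$ over all couplings $\pi$ of $\nu_1,\nu_2$. *)

theory Defs
  imports "HOL-Probability.Probability"
begin

section \<open>Gaussian measures and the target measure\<close>

text \<open>By the Riesz representation theorem the continuous linear functionals are the maps
  \<open>x \<mapsto> x \<bullet> u\<close>. The Dirac measure at 0 is the degenerate normal law with variance 0.\<close>

definition centred_gaussian :: "'a::{real_inner, polish_space} measure \<Rightarrow> bool" where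
  "centred_gaussian \<gamma> \<longleftrightarrow> prob_space \<gamma> \<and> sets \<gamma> = sets borel \<and>
     (\<forall>u. distr \<gamma> borel (\<lambda>x. x \<bullet> u) = return borel 0 \<or>
          (\<exists>\<sigma>>0. distr \<gamma> borel (\<lambda>x. x \<bullet> u) = density lborel (normal_density 0 \<sigma>)))"

definition target_measure :: "('a::{real_inner, polish_space} \<Rightarrow> real) \<Rightarrow> 'a measure \<Rightarrow> 'a measure" where
  "target_measure \<Phi> \<gamma> = density \<gamma> (\<lambda>x. exp (- \<Phi> x) / (\<integral>y. exp (- \<Phi> y) \<partial>\<gamma>))"

definition measure_support :: "'a::topological_space measure \<Rightarrow> 'a set" where
  "measure_support M = {x. \<forall>U. open U \<longrightarrow> x \<in> U \<longrightarrow> 0 < emeasure M U}"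

section \<open>The pCN kernel\<close>

definition acceptance :: "('a \<Rightarrow> real) \<Rightarrow> 'a \<Rightarrow> 'a \<Rightarrow> real" where
  "acceptance \<Phi> x y = min 1 (exp (\<Phi> x - \<Phi> y))"

text \<open>The law of one step from \<open>x\<close>: the accept/reject decision is made by an independent variable
  \<open>u\<close>, uniform on \<open>[0,1]\<close>, so that the proposal is accepted with probability
  \<open>acceptance \<Phi> x p\<close>.\<close>

definition pcn_kernel ::
  "real \<Rightarrow> ('a::{real_inner, polish_space} \<Rightarrow> real) \<Rightarrow> 'a measure \<Rightarrow> 'a \<Rightarrow> 'a measure" where
  "pcn_kernel \<delta> \<Phi> \<gamma> x =
     distr (\<gamma> \<Otimes>\<^sub>M uniform_measure lborel {0..1::real}) borel
       (\<lambda>(\<xi>, u). let p = sqrt (1 - 2 * \<delta>) *\<^sub>R x + sqrt (2 * \<delta>) *\<^sub>R \<xi>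
                 in if u \<le> acceptance \<Phi> x p then p else x)"

section \<open>Markov chains\<close>

text \<open>\<open>\<nu> \<P>\<^sup>n\<close>\<close>

definition kernel_iter :: "('a \<Rightarrow> 'a measure) \<Rightarrow> nat \<Rightarrow> 'a measure \<Rightarrow> 'a measure" where
  "kernel_iter K n \<nu> = ((\<lambda>\<nu>. bind \<nu> K) ^^ n) \<nu>"

definition natural_filtration ::
  "'m measure \<Rightarrow> (nat \<Rightarrow> 'm \<Rightarrow> 'a::topological_space) \<Rightarrow> nat \<Rightarrow> 'm measure" where
  "natural_filtration M X n =
     sigma (space M) {X i -` A \<inter> space M | i A. i \<le> n \<and> A \<in> sets borel}"

definition markov_chain ::
  "'m measure \<Rightarrow> ('a::topological_space \<Rightarrow> 'a measure) \<Rightarrow> 'a \<Rightarrow> (nat \<Rightarrow> 'm \<Rightarrow> 'a) \<Rightarrow> bool" where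
  "markov_chain M K x0 X \<longleftrightarrow> prob_space M \<and>
     (\<forall>n. X n \<in> borel_measurable M) \<and>
     (AE \<omega> in M. X 0 \<omega> = x0) \<and>
     (\<forall>n. \<forall>A\<in>sets borel. AE \<omega> in M.
        real_cond_exp M (natural_filtration M X n) (\<lambda>\<omega>'. indicator A (X (Suc n) \<omega>')) \<omega>
          = measure (K (X n \<omega>)) A)"

section \<open>Transport distances\<close>

definition couplings ::
  "'a::topological_space measure \<Rightarrow> 'a measure \<Rightarrow> ('a \<times> 'a) measure set" where
  "couplings \<nu>1 \<nu>2 = {\<pi>. sets \<pi> = sets (borel \<Otimes>\<^sub>M borel) \<and>
     distr \<pi> borel fst = \<nu>1 \<and> distr \<pi> borel snd = \<nu>2}"

text \<open>Valued in the extended nonnegative reals, since the cost need not be integrable.\<close>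

definition transport_dist ::
  "('a::topological_space \<Rightarrow> 'a \<Rightarrow> real) \<Rightarrow> 'a measure \<Rightarrow> 'a measure \<Rightarrow> ennreal" where
  "transport_dist c \<nu>1 \<nu>2 = (INF \<pi>\<in>couplings \<nu>1 \<nu>2. \<integral>\<^sup>+(x, y). ennreal (c x y) \<partial>\<pi>)"

definition eventually_halving ::
  "('a::topological_space \<Rightarrow> 'a \<Rightarrow> real) \<Rightarrow> ('a \<Rightarrow> 'a measure) \<Rightarrow> bool" where
  "eventually_halving c K \<longleftrightarrow> (\<exists>n. \<forall>\<nu>1 \<nu>2.
     prob_space \<nu>1 \<and> sets \<nu>1 = sets borel \<and> prob_space \<nu>2 \<and> sets \<nu>2 = sets borel \<longrightarrow>
     transport_dist c (kernel_iter K n \<nu>1) (kernel_iter K n \<nu>2) \<le> transport_dist c \<nu>1 \<nu>2 / 2)"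

section \<open>The distances on the state space\<close>

definition trunc_dist :: "real \<Rightarrow> 'a::real_normed_vector \<Rightarrow> 'a \<Rightarrow> real" where
  "trunc_dist \<epsilon> x y = min 1 (norm (x - y) / \<epsilon>)"

text \<open>The path space \<open>\<A>(T,x,y)\<close>; only the values of \<open>\<psi>\<close> on \<open>[0,T]\<close> matter.\<close>

definition unit_speed_paths ::
  "real \<Rightarrow> 'a::real_normed_vector \<Rightarrow> 'a \<Rightarrow> (real \<Rightarrow> 'a) set" where
  "unit_speed_paths T x y = {\<psi>. \<psi> 0 = x \<and> \<psi> T = y \<and>
     (\<exists>\<psi>'. continuous_on {0..T} \<psi>' \<and>
        (\<forall>t\<in>{0..T}. (\<psi> has_vector_derivative \<psi>' t) (at t within {0..T}) \<and> norm (\<psi>' t) = 1))}"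

definition path_dist :: "real \<Rightarrow> real \<Rightarrow> 'a::real_normed_vector \<Rightarrow> 'a \<Rightarrow> real" where
  "path_dist \<epsilon> \<eta> x y = min 1
     (INF (T, \<psi>)\<in>{(T, \<psi>). 0 \<le> T \<and> \<psi> \<in> unit_speed_paths T x y}.
        1 / \<epsilon> * integral {0..T} (\<lambda>t. exp (\<eta> * norm (\<psi> t))))"

definition weighted_dist ::
  "('a \<Rightarrow> 'a \<Rightarrow> real) \<Rightarrow> ('a \<Rightarrow> real) \<Rightarrow> 'a \<Rightarrow> 'a \<Rightarrow> real" where
  "weighted_dist d V x y = sqrt (d x y * (1 + V x + V y))"

section \<open>The two settings\<close>

definition polynomial_weight :: "('a::real_normed_vector \<Rightarrow> real) \<Rightarrow> bool" where
  "polynomial_weight V \<longleftrightarrow> (\<exists>i::nat. V = (\<lambda>x. norm x ^ i))"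

definition exponential_weight :: "('a::real_normed_vector \<Rightarrow> real) \<Rightarrow> bool" where
  "exponential_weight V \<longleftrightarrow> (\<exists>v>0. V = (\<lambda>x. exp (v * norm x)))"

definition power_radius :: "(real \<Rightarrow> real) \<Rightarrow> bool" where
  "power_radius r \<longleftrightarrow> (\<exists>c>0. \<exists>a. 1/2 < a \<and> a < 1 \<and> (\<forall>s>0. r s = c * s powr a))"

definition constant_radius :: "(real \<Rightarrow> real) \<Rightarrow> bool" where
  "constant_radius r \<longleftrightarrow> (\<exists>c>0. \<forall>s>0. r s = c)"

definition exp_growth_locally_lipschitz :: "('a::real_normed_vector \<Rightarrow> real) \<Rightarrow> bool" where
  "exp_growth_locally_lipschitz \<Phi> \<longleftrightarrow> (\<forall>\<kappa>>0. \<exists>M. \<forall>s>0. \<forall>x\<in>ball 0 s. \<forall>y\<in>ball 0 s. x \<noteq> y \<longrightarrow>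
     \<bar>\<Phi> x - \<Phi> y\<bar> / norm (x - y) \<le> M * exp (\<kappa> * s))"

definition setting_a ::
  "('a::real_normed_vector \<Rightarrow> real) \<Rightarrow> (real \<Rightarrow> real) \<Rightarrow> ('a \<Rightarrow> real) \<Rightarrow> ('a \<Rightarrow> 'a \<Rightarrow> real) \<Rightarrow> real \<Rightarrow> bool" where
  "setting_a \<Phi> r V d \<epsilon> \<longleftrightarrow> (\<exists>L. L-lipschitz_on UNIV \<Phi>) \<and>
     (power_radius r \<and> (polynomial_weight V \<or> exponential_weight V) \<or>
      constant_radius r \<and> polynomial_weight V) \<and>
     0 < \<epsilon> \<and> d = trunc_dist \<epsilon>"

definition setting_b ::
  "('a::real_normed_vector \<Rightarrow> real) \<Rightarrow> (real \<Rightarrow> real) \<Rightarrow> ('a \<Rightarrow> real) \<Rightarrow> ('a \<Rightarrow> 'a \<Rightarrow> real) \<Rightarrow> real \<Rightarrow> real \<Rightarrow> bool" where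
  "setting_b \<Phi> r V d \<epsilon> \<eta> \<longleftrightarrow> exp_growth_locally_lipschitz \<Phi> \<and>
     power_radius r \<and> (polynomial_weight V \<or> exponential_weight V) \<and>
     0 < \<eta> \<and> 0 < \<epsilon> \<and> d = path_dist \<epsilon> \<eta>"

end

theory Submission
  imports Defs "HOL-Library.Discrete_Functions"
begin

text \<open>The law of large numbers is obtained from second moments, which makes every starting point
accessible at once. Write \<open>\<mu>\<close> for the target, \<open>V\<close> for the weight and \<open>f = h - \<mu>(h)\<close>.

A Lipschitz function \<open>h\<close> grows at most like \<open>sqrt (1 + V)\<close>, since \<open>d \<le> 1\<close>. Two facts about the chain
are needed. The first is a Lyapunov condition \<open>\<P> V \<le> l V + b\<close> with \<open>l < 1\<close> (\<open>drift_condition\<close>): far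
from the origin a proposal whose noise is small lands in the ball on which the acceptance
probability is bounded below and on which the norm has shrunk by a factor, the Gaussian measure
charges that set of noises because the target, which has full support, is absolutely continuous with
respect to it, and large noises cost only an additive constant since the norm has exponential moments under a
Gaussian measure (Fernique's theorem, \<open>gaussian_norm_exp_moment\<close>). The second is the invariance of
\<open>\<mu>\<close> (\<open>target_invariant\<close>), that is, detailed balance for the Metropolis step with a proposal that is
reversible for \<open>\<gamma>\<close>. Fernique's theorem and the reversibility of the proposal are two instances of
the invariance of \<open>\<gamma> \<otimes> \<gamma>\<close> under the reflections that mix the two coordinates
(\<open>gaussian_pair_reflection_invariant\<close>). That invariance is read off the one-dimensional
marginals, because a finite measure on a separable inner product space is determined by its
characteristic functional (\<open>measure_eqI_characteristic_functional\<close>).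

The Lyapunov condition gives \<open>\<mu>(V) < \<infinity>\<close> and bounds \<open>E V(X\<^sub>n)\<close> uniformly in \<open>n\<close>. Both sides of
the halving hypothesis can therefore be started from measures at finite transport distance, namely
\<open>\<delta>\<^sub>x \<P>\<^sup>j\<close> and \<open>\<mu>\<close>. Iterating it and using \<open>\<mu> \<P> = \<mu>\<close> yields
\<open>|\<P>\<^sup>n h (x) - \<mu>(h)| \<le> \<beta>\<^sub>n sqrt (1 + V x)\<close> with a summable sequence \<open>\<beta>\<close> (\<open>expectation_decay\<close>). By
the Markov property the covariance of \<open>f(X\<^sub>i)\<close> and \<open>f(X\<^sub>i\<^sub>+\<^sub>n)\<close> is at most a constant times
\<open>\<beta>\<^sub>n\<close> (\<open>chain_covariance\<close>), so the second moment of \<open>f(X\<^sub>1) + \<dots> + f(X\<^sub>n)\<close> is of order \<open>n\<close>. Along the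
squares the averages then converge almost surely by a Borel-Cantelli argument, and the gaps between
consecutive squares are controlled by the same second moments (\<open>strong_law_of_linear_variance\<close>).\<close>

section \<open>Finite measures on inner product spaces and their characteristic functionals\<close>

lemma borel_measurable_inner_left [measurable]: "(\<lambda>x::'a::real_inner. x \<bullet> u) \<in> borel_measurable borel"
  by (intro borel_measurable_continuous_onI continuous_intros)

text \<open>Normalising the weight \<open>g\<close> to a density and pushing forward under \<open>x \<mapsto> x \<bullet> u\<close> reduces the claim to
the uniqueness theorem for characteristic functions on the line. The phase \<open>\<phi>\<close> encodes real and
imaginary part at once: \<open>\<phi> = 0\<close> gives the cosine and \<open>\<phi> = - pi/2\<close> the sine.\<close>

lemma halfspace_measure_eq_of_weighted_char_eq:
  fixes M N :: "'a::real_inner measure" and g :: "'a \<Rightarrow> real"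
  assumes sM: "sets M = sets borel" and sN: "sets N = sets borel"
    and iM: "integrable M g" and iN: "integrable N g"
    and g0: "\<And>x. 0 \<le> g x"
    and eq: "\<And>t \<phi>. (\<integral>x. g x * cos (t * (x \<bullet> u) + \<phi>) \<partial>M) = (\<integral>x. g x * cos (t * (x \<bullet> u) + \<phi>) \<partial>N)"
  shows "(\<integral>x. g x * indicator {x. x \<bullet> u \<le> b} x \<partial>M) = (\<integral>x. g x * indicator {x. x \<bullet> u \<le> b} x \<partial>N)"
proof -
  define Z where "Z = (\<integral>x. g x \<partial>M)"
  have ZN: "Z = (\<integral>x. g x \<partial>N)"
    using eq[of 0 0] by (simp add: Z_def)
  have Z0: "0 \<le> Z"
    unfolding Z_def by (rule integral_nonneg_AE) (simp add: g0)
  have hb[measurable]: "{x::'a. x \<bullet> u \<le> b} \<in> sets borel"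
    by measurable
  show ?thesis
  proof (cases "Z = 0")
    case True
    have "AE x in M. g x = 0"
      using integral_nonneg_eq_0_iff_AE[OF iM] g0 True Z_def by auto
    then have "(\<integral>x. g x * indicator {x. x \<bullet> u \<le> b} x \<partial>M) = 0"
      by (intro integral_eq_zero_AE) (auto elim: eventually_mono)
    moreover have "AE x in N. g x = 0"
      using integral_nonneg_eq_0_iff_AE[OF iN] g0 True ZN by auto
    then have "(\<integral>x. g x * indicator {x. x \<bullet> u \<le> b} x \<partial>N) = 0"
      by (intro integral_eq_zero_AE) (auto elim: eventually_mono)
    ultimately show ?thesis by simp
  next
    case False
    with Z0 have Zp: "Z > 0" by simp
    define D where "D = (\<lambda>M::'a measure. distr (density M (\<lambda>x. ennreal (g x / Z))) borel (\<lambda>x. x \<bullet> u))"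
    have key: "real_distribution (D K) \<and>
        (\<forall>t. char (D K) t = Complex ((\<integral>x. g x * cos (t * (x \<bullet> u) + 0) \<partial>K) / Z)
               ((\<integral>x. g x * cos (t * (x \<bullet> u) + (- pi/2)) \<partial>K) / Z)) \<and>
        measure (D K) {..b} = (\<integral>x. g x * indicator {x. x \<bullet> u \<le> b} x \<partial>K) / Z"
      if sK[measurable_cong]: "sets K = sets borel" and iK: "integrable K g" and ZK: "Z = (\<integral>x. g x \<partial>K)" for K
    proof -
      have gm[measurable]: "g \<in> borel_measurable K" using iK by auto
      let ?D = "density K (\<lambda>x. ennreal (g x / Z))"
      have "emeasure ?D (space ?D) = (\<integral>\<^sup>+x. ennreal (g x / Z) \<partial>K)"
        by (subst emeasure_density) (auto intro!: nn_integral_cong)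
      also have "\<dots> = ennreal (\<integral>x. g x / Z \<partial>K)"
        using g0 Zp iK by (intro nn_integral_eq_integral) auto
      also have "\<dots> = 1" using Zp ZK by simp
      finally interpret PD: prob_space ?D by (rule prob_spaceI)
      have m1: "(\<lambda>x. x \<bullet> u) \<in> borel_measurable ?D"
        by measurable
      have rd: "real_distribution (D K)"
        unfolding D_def real_distribution_def real_distribution_axioms_def
        using PD.prob_space_distr[OF m1] by simp
      have ch: "char (D K) t = Complex ((\<integral>x. g x * cos (t * (x \<bullet> u) + 0) \<partial>K) / Z)
               ((\<integral>x. g x * cos (t * (x \<bullet> u) + (- pi/2)) \<partial>K) / Z)" for t
      proof -
        have "char (D K) t = (\<integral>x. iexp (t * (x \<bullet> u)) \<partial>?D)"
          unfolding char_def D_def by (subst integral_distr) auto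
        also have "\<dots> = (\<integral>x. (g x / Z) *\<^sub>R iexp (t * (x \<bullet> u)) \<partial>K)"
          using g0 Zp by (intro integral_density) auto
        finally have c: "char (D K) t = (\<integral>x. (g x / Z) *\<^sub>R iexp (t * (x \<bullet> u)) \<partial>K)" .
        have ii: "integrable K (\<lambda>x. (g x / Z) *\<^sub>R iexp (t * (x \<bullet> u)))"
        proof (rule Bochner_Integration.integrable_bound)
          show "integrable K (\<lambda>x. g x / Z)" using iK by auto
          show "AE x in K. norm ((g x / Z) *\<^sub>R iexp (t * (x \<bullet> u))) \<le> norm (g x / Z)"
            by (auto intro!: AE_I2)
        qed measurable
        have "Re (char (D K) t) = (\<integral>x. (g x * cos (t * (x \<bullet> u) + 0)) / Z \<partial>K)"
          unfolding c by (subst integral_Re[OF ii, symmetric]) (auto intro!: Bochner_Integration.integral_cong simp: Re_exp)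
        moreover have "Im (char (D K) t) = (\<integral>x. (g x * cos (t * (x \<bullet> u) + (- pi/2))) / Z \<partial>K)"
          unfolding c
          by (subst integral_Im[OF ii, symmetric]) (auto intro!: Bochner_Integration.integral_cong simp: Im_exp cos_diff)
        ultimately show ?thesis by (simp add: complex_eq_iff)
      qed
      have "measure (D K) {..b} = (\<integral>x. indicator {..b} x \<partial>(D K))"
        by (simp add: D_def)
      also have "\<dots> = (\<integral>x. indicator {..b} (x \<bullet> u) \<partial>?D)"
        unfolding D_def by (subst integral_distr) auto
      also have "\<dots> = (\<integral>x. (g x / Z) *\<^sub>R indicator {..b} (x \<bullet> u) \<partial>K)"
        using g0 Zp by (intro integral_density) auto
      also have "\<dots> = (\<integral>x. (g x * indicator {x. x \<bullet> u \<le> b} x) / Z \<partial>K)"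
        by (intro Bochner_Integration.integral_cong) (auto simp: indicator_def)
      finally show ?thesis using rd ch by simp
    qed
    have "char (D M) t = char (D N) t" for t
      using key[OF sM iM Z_def] key[OF sN iN ZN] eq[of t 0] eq[of t "- pi/2"] by simp
    then have "char (D M) = char (D N)" by blast
    then have "D M = D N"
      using key[OF sM iM Z_def] key[OF sN iN ZN] by (intro Levy_uniqueness) auto
    then show ?thesis
      using key[OF sM iM Z_def] key[OF sN iN ZN] Zp by simp
  qed
qed

text \<open>Finite intersections of half-spaces, indexed by lists, form a generator of the Borel sets that is
stable under intersection, because concatenating lists intersects the sets.\<close>

definition halfspace_inter :: "('a::real_inner \<times> real) list \<Rightarrow> 'a set" where
  "halfspace_inter l = {x. \<forall>(u, b)\<in>set l. x \<bullet> u \<le> b}"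

lemma halfspace_inter_Cons:
  "halfspace_inter ((u, b) # l) = {x. x \<bullet> u \<le> b} \<inter> halfspace_inter l"
  by (auto simp: halfspace_inter_def)

lemma halfspace_inter_sets [measurable]: "halfspace_inter l \<in> sets borel"
proof (induction l)
  case Nil then show ?case by (simp add: halfspace_inter_def)
next
  case (Cons p l)
  have "{x. x \<bullet> fst p \<le> snd p} \<in> sets borel" by measurable
  then show ?case using Cons halfspace_inter_Cons[of "fst p" "snd p" l] by auto
qed

text \<open>The half-spaces are added one at a time. Carrying along the factor \<open>cos (x \<bullet> w + \<theta>)\<close> with arbitrary
\<open>w\<close> and \<open>\<theta>\<close> keeps the statement strong enough for the induction: multiplying two such factors gives
a sum of factors of the same form.\<close>

lemma halfspace_inter_cos_integral_eq:
  fixes M N :: "'a::real_inner measure"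
  assumes fM: "finite_measure M" and fN: "finite_measure N"
    and sM[measurable_cong]: "sets M = sets borel" and sN[measurable_cong]: "sets N = sets borel"
    and eq: "\<And>w \<theta>. (\<integral>x. cos (x \<bullet> w + \<theta>) \<partial>M) = (\<integral>x. cos (x \<bullet> w + \<theta>) \<partial>N)"
  shows "(\<integral>x. indicator (halfspace_inter l) x * cos (x \<bullet> w + \<theta>) \<partial>M)
       = (\<integral>x. indicator (halfspace_inter l) x * cos (x \<bullet> w + \<theta>) \<partial>N)"
proof (induction l arbitrary: w \<theta>)
  case Nil
  then show ?case using eq by (simp add: halfspace_inter_def)
next
  case (Cons p l)
  obtain u b where p: "p = (u, b)" by (cases p)
  let ?H = "halfspace_inter l"
  let ?I = "indicator {x. x \<bullet> u \<le> b} :: 'a \<Rightarrow> real"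
  have int: "integrable K (\<lambda>x. f x)"
    if "finite_measure K" "sets K = sets borel" "f \<in> borel_measurable borel" "\<And>x. \<bar>f x\<bar> \<le> 2"
    for K and f :: "'a \<Rightarrow> real"
  proof -
    interpret finite_measure K by fact
    have "f \<in> borel_measurable K" using that(2,3) by (simp cong: measurable_cong_sets)
    then show ?thesis using that(4)
      by (intro integrable_const_bound[where B = 2]) auto
  qed
  have [measurable]: "{x::'a. x \<bullet> u \<le> b} \<in> sets borel" by measurable
  have b1: "\<bar>indicator A x * cos y\<bar> \<le> 1" for A and x :: 'a and y :: real
    by (auto simp: indicator_def)
  have b2: "\<bar>indicator A x * cos y * indicator B x\<bar> \<le> 1" for A B and x :: 'a and y :: real
    by (auto simp: indicator_def)
  have intc: "integrable K (\<lambda>x. indicator ?H x * cos (x \<bullet> w + \<theta>))"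
    and intd: "integrable K (\<lambda>x. indicator ?H x * cos (x \<bullet> w + \<theta>) * ?I x)"
    if "K = M \<or> K = N" for K w \<theta>
    using that fM fN sM sN order_trans[OF b1, of 2] order_trans[OF b2, of 2] by (auto intro!: int)
  \<comment> \<open>The cosine alone is not a nonnegative weight; adding 1 makes it one, and the case w = 0, theta = 0
    removes the added term afterwards.\<close>
  have step: "(\<integral>x. (indicator ?H x * (1 + cos (x \<bullet> w + \<theta>))) * ?I x \<partial>M)
       = (\<integral>x. (indicator ?H x * (1 + cos (x \<bullet> w + \<theta>))) * ?I x \<partial>N)" for w \<theta>
  proof (rule halfspace_measure_eq_of_weighted_char_eq[OF sM sN])
    have e: "indicator ?H x * (1 + cos (x \<bullet> w + \<theta>)) =
        indicator ?H x * cos (x \<bullet> 0 + 0) + indicator ?H x * cos (x \<bullet> w + \<theta>)" for x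
      by (simp add: algebra_simps)
    show "integrable M (\<lambda>x. indicator ?H x * (1 + cos (x \<bullet> w + \<theta>)))"
      unfolding e by (intro Bochner_Integration.integrable_add intc) auto
    show "integrable N (\<lambda>x. indicator ?H x * (1 + cos (x \<bullet> w + \<theta>)))"
      unfolding e by (intro Bochner_Integration.integrable_add intc) auto
    show "0 \<le> indicator ?H x * (1 + cos (x \<bullet> w + \<theta>))" for x
    proof -
      have "0 \<le> 1 + cos (x \<bullet> w + \<theta>)"
        using cos_ge_minus_one[of "x \<bullet> w + \<theta>"] by linarith
      then show ?thesis by (simp add: indicator_def)
    qed
    fix t \<phi> :: real
    have "indicator ?H x * (1 + cos (x \<bullet> w + \<theta>)) * cos (t * (x \<bullet> u) + \<phi>)
      = indicator ?H x * cos (x \<bullet> (t *\<^sub>R u) + \<phi>)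
        + (1/2) * (indicator ?H x * cos (x \<bullet> (w - t *\<^sub>R u) + (\<theta> - \<phi>)))
        + (1/2) * (indicator ?H x * cos (x \<bullet> (w + t *\<^sub>R u) + (\<theta> + \<phi>)))" for x
    proof -
      have h: "cos (x \<bullet> w + \<theta>) * cos (t * (x \<bullet> u) + \<phi>) =
         (cos (x \<bullet> (w - t *\<^sub>R u) + (\<theta> - \<phi>)) + cos (x \<bullet> (w + t *\<^sub>R u) + (\<theta> + \<phi>))) / 2"
        by (subst cos_times_cos) (simp add: inner_diff_right inner_add_right algebra_simps)
      have alg: "i * (1 + a) * c = i * c' + 1/2 * (i * d) + 1/2 * (i * e)"
        if "a * c = (d + e) / 2" "c = c'" for i a c c' d e :: real
      proof -
        have "i * (1 + a) * c = i * c + i * (a * c)" by (simp add: algebra_simps)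
        then show ?thesis unfolding that(1) unfolding that(2) by (simp add: field_simps)
      qed
      have h': "cos (t * (x \<bullet> u) + \<phi>) = cos (x \<bullet> (t *\<^sub>R u) + \<phi>)" by simp
      show ?thesis by (rule alg[OF h h'])
    qed
    then have E: "(\<lambda>x. indicator ?H x * (1 + cos (x \<bullet> w + \<theta>)) * cos (t * (x \<bullet> u) + \<phi>))
      = (\<lambda>x. indicator ?H x * cos (x \<bullet> (t *\<^sub>R u) + \<phi>)
        + (1/2) * (indicator ?H x * cos (x \<bullet> (w - t *\<^sub>R u) + (\<theta> - \<phi>)))
        + (1/2) * (indicator ?H x * cos (x \<bullet> (w + t *\<^sub>R u) + (\<theta> + \<phi>))))" by blast
    show "(\<integral>x. indicator ?H x * (1 + cos (x \<bullet> w + \<theta>)) * cos (t * (x \<bullet> u) + \<phi>) \<partial>M)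
       = (\<integral>x. indicator ?H x * (1 + cos (x \<bullet> w + \<theta>)) * cos (t * (x \<bullet> u) + \<phi>) \<partial>N)"
      unfolding E using Cons.IH
      by (simp del: inner_scaleR_right
          add: Bochner_Integration.integral_add Bochner_Integration.integrable_add intc)
  qed
  have split: "(\<integral>x. (indicator ?H x * (1 + cos (x \<bullet> w + \<theta>))) * ?I x \<partial>K)
     = (\<integral>x. indicator ?H x * cos (x \<bullet> 0 + 0) * ?I x \<partial>K) + (\<integral>x. indicator ?H x * cos (x \<bullet> w + \<theta>) * ?I x \<partial>K)"
    if "K = M \<or> K = N" for K w \<theta>
  proof -
    have "(indicator ?H x * (1 + cos (x \<bullet> w + \<theta>))) * ?I x
        = indicator ?H x * cos (x \<bullet> 0 + 0) * ?I x + indicator ?H x * cos (x \<bullet> w + \<theta>) * ?I x" for x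
      by (simp add: algebra_simps)
    then have "(\<integral>x. (indicator ?H x * (1 + cos (x \<bullet> w + \<theta>))) * ?I x \<partial>K) =
      (\<integral>x. indicator ?H x * cos (x \<bullet> 0 + 0) * ?I x + indicator ?H x * cos (x \<bullet> w + \<theta>) * ?I x \<partial>K)"
      by presburger
    also have "\<dots> = (\<integral>x. indicator ?H x * cos (x \<bullet> 0 + 0) * ?I x \<partial>K) + (\<integral>x. indicator ?H x * cos (x \<bullet> w + \<theta>) * ?I x \<partial>K)"
      by (rule Bochner_Integration.integral_add[OF intd[OF that] intd[OF that]])
    finally show ?thesis .
  qed
  have "(\<integral>x. indicator ?H x * cos (x \<bullet> 0 + 0) * ?I x \<partial>M) = (\<integral>x. indicator ?H x * cos (x \<bullet> 0 + 0) * ?I x \<partial>N)"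
    using step[of 0 0] split[of M 0 0, OF disjI1[OF refl]] split[of N 0 0, OF disjI2[OF refl]] by linarith
  then have "(\<integral>x. indicator ?H x * cos (x \<bullet> w + \<theta>) * ?I x \<partial>M) = (\<integral>x. indicator ?H x * cos (x \<bullet> w + \<theta>) * ?I x \<partial>N)"
    using step[of w \<theta>] split[of M w \<theta>, OF disjI1[OF refl]] split[of N w \<theta>, OF disjI2[OF refl]] by linarith
  then show ?case
    unfolding p halfspace_inter_Cons indicator_inter_arith by (simp add: ac_simps)
qed

text \<open>A closed ball is a countable intersection of half-spaces: by density it suffices to test
\<open>(x - c) \<bullet> u \<le> r * norm u\<close> for \<open>u\<close> in a countable dense set, and \<open>u = x - c\<close> would detect a point
outside the ball. Open sets are countable unions of closed balls.\<close>

lemma borel_eq_sigma_halfspaces: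
  "sets (borel :: 'a::{real_inner, second_countable_topology} measure) = sigma_sets UNIV (range halfspace_inter)"
    (is "_ = ?S")
proof -
  interpret S: sigma_algebra "UNIV :: 'a set" ?S by (rule sigma_algebra_sigma_sets) auto
  have half: "{x. x \<bullet> u \<le> b} \<in> ?S" for u :: 'a and b
    by (rule sigma_sets.Basic) (auto intro!: image_eqI[of _ _ "[(u, b)]"] simp: halfspace_inter_def)
  obtain D :: "'a set" where D: "countable D" "\<And>X. open X \<Longrightarrow> X \<noteq> {} \<Longrightarrow> \<exists>d\<in>D. d \<in> X"
    using countable_dense_exists by blast
  have cb: "cball c r \<in> ?S" if r: "0 \<le> r" for c :: 'a and r
  proof -
    have "cball c r = (\<Inter>u\<in>D. {x. x \<bullet> u \<le> c \<bullet> u + r * norm u})"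
    proof (intro set_eqI iffI)
      fix x assume "x \<in> cball c r"
      then have "norm (x - c) \<le> r" by (simp add: dist_norm norm_minus_commute)
      then have "(x - c) \<bullet> u \<le> r * norm u" for u
        using norm_cauchy_schwarz[of "x - c" u] mult_right_mono[of "norm (x - c)" r "norm u"]
        by (meson norm_ge_zero order_trans)
      then show "x \<in> (\<Inter>u\<in>D. {x. x \<bullet> u \<le> c \<bullet> u + r * norm u})"
        by (auto simp: inner_diff_left algebra_simps)
    next
      fix x assume x: "x \<in> (\<Inter>u\<in>D. {x. x \<bullet> u \<le> c \<bullet> u + r * norm u})"
      show "x \<in> cball c r"
      proof (rule ccontr)
        assume "x \<notin> cball c r"
        then have n: "norm (x - c) > r" by (simp add: dist_norm norm_minus_commute)
        let ?O = "{u. (x - c) \<bullet> u > r * norm u}"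
        have "open ?O" by (intro open_Collect_less continuous_intros)
        moreover have "x - c \<in> ?O"
        proof (rule CollectI)
          have "r * norm (x - c) < norm (x - c) * norm (x - c)"
            by (rule mult_strict_right_mono[OF n le_less_trans[OF r n]])
          also have "\<dots> = (x - c) \<bullet> (x - c)"
            by (simp only: dot_square_norm power2_eq_square)
          finally show "r * norm (x - c) < (x - c) \<bullet> (x - c)" .
        qed
        ultimately obtain u where u: "u \<in> D" "u \<in> ?O" using D(2)[of ?O] by blast
        have "x \<bullet> u \<le> c \<bullet> u + r * norm u" using x u(1) by blast
        moreover have "r * norm u < x \<bullet> u - c \<bullet> u" using u(2) by (simp only: mem_Collect_eq inner_diff_left)
        ultimately show False by linarith
      qed
    qed
    also have "\<dots> \<in> ?S"
    proof (cases "D = {}")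
      case True then show ?thesis using S.top by auto
    next
      case False
      then show ?thesis using D(1) half by (intro S.countable_INT') auto
    qed
    finally show ?thesis .
  qed
  have op: "X \<in> ?S" if X: "open X" for X :: "'a set"
  proof -
    define I where "I = {(d, n::nat). d \<in> D \<and> cball d (1 / real (Suc n)) \<subseteq> X}"
    have "X = (\<Union>(d, n)\<in>I. cball d (1 / real (Suc n)))"
    proof (intro set_eqI iffI)
      fix x assume "x \<in> X"
      then obtain e where e: "e > 0" "ball x e \<subseteq> X" using X open_contains_ball by blast
      obtain n where n: "1 / real (Suc n) < e / 2" using nat_approx_posE[of "e/2"] e by auto
      obtain d where d: "d \<in> D" "d \<in> ball x (1 / real (Suc n))"
        using D(2)[of "ball x (1 / real (Suc n))"] by auto
      have "cball d (1 / real (Suc n)) \<subseteq> ball x e"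
      proof
        fix y assume "y \<in> cball d (1 / real (Suc n))"
        then show "y \<in> ball x e"
          using d n dist_triangle[of x y d] by (simp add: dist_commute)
      qed
      then have "(d, n) \<in> I" using d(1) e(2) by (auto simp: I_def)
      moreover have "x \<in> cball d (1 / real (Suc n))"
        using less_imp_le d(2) by (simp add: dist_commute)
      ultimately show "x \<in> (\<Union>(d, n)\<in>I. cball d (1 / real (Suc n)))" by blast
    qed (auto simp: I_def)
    moreover have "countable I"
      by (rule countable_subset[of _ "D \<times> UNIV"]) (auto simp: I_def D(1))
    then have "(\<Union>(d, n)\<in>I. cball d (1 / real (Suc n))) \<in> ?S"
      using cb by (intro S.countable_UN') auto
    ultimately show ?thesis by simp
  qed
  show ?thesis
  proof
    show "sets borel \<subseteq> ?S"
      using S.sigma_sets_subset[of "{X. open X}"] op by (auto simp: borel_def sets_measure_of)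
    show "?S \<subseteq> sets borel"
      using sets.sigma_sets_subset[of "range halfspace_inter" "borel::'a measure"] halfspace_inter_sets
      by (auto simp: image_subset_iff)
  qed
qed

lemma measure_eqI_characteristic_functional:
  fixes M N :: "'a::{real_inner, second_countable_topology} measure"
  assumes fM: "finite_measure M" and fN: "finite_measure N"
    and sM: "sets M = sets borel" and sN: "sets N = sets borel"
    and eq: "\<And>w \<theta>. (\<integral>x. cos (x \<bullet> w + \<theta>) \<partial>M) = (\<integral>x. cos (x \<bullet> w + \<theta>) \<partial>N)"
  shows "M = N"
proof (rule measure_eqI_generator_eq[where E = "range halfspace_inter" and \<Omega> = UNIV and A = "\<lambda>_. UNIV"])
  interpret M: finite_measure M by fact
  interpret N: finite_measure N by fact
  have "halfspace_inter l \<inter> halfspace_inter l' = halfspace_inter (l @ l')" for l l' :: "('a \<times> real) list"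
    by (auto simp: halfspace_inter_def)
  then show "Int_stable (range halfspace_inter :: 'a set set)" by (auto simp: Int_stable_def)
  show "sets M = sigma_sets UNIV (range halfspace_inter)" "sets N = sigma_sets UNIV (range halfspace_inter)"
    using sM sN borel_eq_sigma_halfspaces by auto
  have spM: "space M = UNIV" "space N = UNIV"
    using sets_eq_imp_space_eq[OF sM] sets_eq_imp_space_eq[OF sN] by auto
  have "measure M (halfspace_inter l) = measure N (halfspace_inter l)" for l
    using halfspace_inter_cos_integral_eq[OF fM fN sM sN eq, of l 0 0] by (simp add: spM)
  then show "emeasure M X = emeasure N X" if "X \<in> range halfspace_inter" for X
    using that by (auto simp: M.emeasure_eq_measure N.emeasure_eq_measure)
  show "range (\<lambda>_::nat. UNIV) \<subseteq> range (halfspace_inter :: _ \<Rightarrow> 'a set)"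
    by (auto intro!: image_eqI[of _ _ "[]"] simp: halfspace_inter_def)
  show "emeasure M UNIV \<noteq> \<infinity>" using M.emeasure_finite[of UNIV] by simp
qed auto

section \<open>Reflection invariance and exponential moments of Gaussian measures\<close>

text \<open>The characteristic functional of a centred Gaussian measure, written with the variance
\<open>\<integral>(x \<bullet> u)\<^sup>2\<close> of the marginal so that the degenerate and the nondegenerate case agree. In this form its
dependence on \<open>u\<close> is through a quadratic form.\<close>

lemma centred_gaussian_cos_integral:
  fixes \<gamma> :: "'a::{real_inner, polish_space} measure"
  assumes g: "centred_gaussian \<gamma>"
  shows "integrable \<gamma> (\<lambda>x. (x \<bullet> u)\<^sup>2)"
    and "(\<integral>x. cos (x \<bullet> u + \<theta>) \<partial>\<gamma>) = exp (- (\<integral>x. (x \<bullet> u)\<^sup>2 \<partial>\<gamma>) / 2) * cos \<theta>"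
proof -
  have sg[measurable_cong]: "sets \<gamma> = sets borel" and "prob_space \<gamma>"
    using g by (auto simp: centred_gaussian_def)
  interpret prob_space \<gamma> by fact
  have "integrable \<gamma> (\<lambda>x. (x \<bullet> u)\<^sup>2) \<and>
    (\<integral>x. cos (x \<bullet> u + \<theta>) \<partial>\<gamma>) = exp (- (\<integral>x. (x \<bullet> u)\<^sup>2 \<partial>\<gamma>) / 2) * cos \<theta>"
  proof (cases "distr \<gamma> borel (\<lambda>x. x \<bullet> u) = return borel 0")
    case True
    have "AE y in distr \<gamma> borel (\<lambda>x. x \<bullet> u). y = 0"
      unfolding True by (subst AE_return) auto
    then have z: "AE x in \<gamma>. x \<bullet> u = 0"
      by (subst (asm) AE_distr_iff) auto
    have "integrable \<gamma> (\<lambda>x. (x \<bullet> u)\<^sup>2) \<longleftrightarrow> integrable \<gamma> (\<lambda>x. 0::real)"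
      using z by (intro integrable_cong_AE) auto
    moreover have "(\<integral>x. (x \<bullet> u)\<^sup>2 \<partial>\<gamma>) = (\<integral>x. 0 \<partial>\<gamma>)"
      using z by (intro integral_cong_AE) auto
    moreover have "(\<integral>x. cos (x \<bullet> u + \<theta>) \<partial>\<gamma>) = (\<integral>x. cos \<theta> \<partial>\<gamma>)"
      using z by (intro integral_cong_AE) auto
    ultimately show ?thesis by (simp add: prob_space)
  next
    case False
    then obtain \<sigma> where s: "\<sigma> > 0" "distr \<gamma> borel (\<lambda>x. x \<bullet> u) = density lborel (normal_density 0 \<sigma>)"
      using g by (auto simp: centred_gaussian_def)
    have "distributed \<gamma> lborel (\<lambda>x. x \<bullet> u) (normal_density 0 \<sigma>)"
      using s(2) by (auto simp: distributed_def cong: distr_cong)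
    then have "distributed \<gamma> lborel (\<lambda>x. (x \<bullet> u - 0) / \<sigma>) std_normal_density"
      by (subst (asm) normal_standard_normal_convert[OF s(1)])
    then have d: "distr \<gamma> borel (\<lambda>x. (x \<bullet> u) / \<sigma>) = std_normal_distribution"
      by (auto simp: distributed_def cong: distr_cong)
    have m: "(\<lambda>x. (x \<bullet> u) / \<sigma>) \<in> borel_measurable \<gamma>" by measurable
    have "has_bochner_integral std_normal_distribution (\<lambda>x. x ^ (2 * 1)) (fact (2 * 1) / (2 ^ 1 * fact 1))"
      using std_normal_moment_even[of 1]
      by (subst has_bochner_integral_density) (auto simp: mult.commute)
    then have h: "has_bochner_integral std_normal_distribution (\<lambda>x. x\<^sup>2) 1"
      by (simp add: fact_numeral power2_eq_square)
    have h2: "has_bochner_integral \<gamma> (\<lambda>x. ((x \<bullet> u) / \<sigma>)\<^sup>2) 1"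
      using h m unfolding d[symmetric] by (simp add: has_bochner_integral_iff integrable_distr_eq integral_distr)
    have h3: "has_bochner_integral \<gamma> (\<lambda>x. (x \<bullet> u)\<^sup>2) (\<sigma>\<^sup>2)"
      using has_bochner_integral_mult_right[OF h2, of "\<sigma>\<^sup>2"] s(1) by (simp add: power_divide)
    interpret S: real_distribution std_normal_distribution
      by (rule real_dist_normal_dist)
    have ii: "integrable std_normal_distribution (\<lambda>x. iexp (\<sigma> * x + \<theta>))"
      by (rule S.integrable_const_bound[where B = 1]) auto
    have "(\<integral>x. iexp (\<sigma> * x + \<theta>) \<partial>std_normal_distribution) = iexp \<theta> * char std_normal_distribution \<sigma>"
      unfolding char_def by (subst integral_mult_right_zero[symmetric])
        (auto intro!: Bochner_Integration.integral_cong simp: exp_add[symmetric] distrib_left add.commute)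
    also have "\<dots> = iexp \<theta> * complex_of_real (exp (- (\<sigma>\<^sup>2) / 2))"
      by (simp add: char_std_normal_distribution)
    finally have "(\<integral>x. cos (\<sigma> * x + \<theta>) \<partial>std_normal_distribution) = exp (- (\<sigma>\<^sup>2) / 2) * cos \<theta>"
      using integral_Re[OF ii] by (simp add: Re_exp mult.commute)
    also have "(\<integral>x. cos (\<sigma> * x + \<theta>) \<partial>std_normal_distribution) = (\<integral>x. cos (\<sigma> * ((x \<bullet> u) / \<sigma>) + \<theta>) \<partial>\<gamma>)"
      unfolding d[symmetric] by (subst integral_distr[OF m]) auto
    finally show ?thesis using h3 s(1) by (simp add: has_bochner_integral_iff)
  qed
  then show "integrable \<gamma> (\<lambda>x. (x \<bullet> u)\<^sup>2)"
    and "(\<integral>x. cos (x \<bullet> u + \<theta>) \<partial>\<gamma>) = exp (- (\<integral>x. (x \<bullet> u)\<^sup>2 \<partial>\<gamma>) / 2) * cos \<theta>" by auto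
qed

text \<open>The characteristic functional of \<open>\<gamma> \<otimes> \<gamma>\<close> at \<open>(a, b)\<close> depends on \<open>Q a + Q b\<close> only, where \<open>Q\<close> is the
quadratic form of variances, and \<open>Q\<close> satisfies
\<open>Q (c a + s b) + Q (s a - c b) = Q a + Q b\<close> when \<open>c\<^sup>2 + s\<^sup>2 = 1\<close>.\<close>

lemma gaussian_pair_reflection_invariant:
  fixes \<gamma> :: "'a::{real_inner, polish_space} measure"
  assumes g: "centred_gaussian \<gamma>" and cs: "c\<^sup>2 + s\<^sup>2 = 1"
  shows "distr (\<gamma> \<Otimes>\<^sub>M \<gamma>) (\<gamma> \<Otimes>\<^sub>M \<gamma>) (\<lambda>(x, y). (c *\<^sub>R x + s *\<^sub>R y, s *\<^sub>R x - c *\<^sub>R y)) = \<gamma> \<Otimes>\<^sub>M \<gamma>"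
    (is "?L = _")
proof -
  have sg[measurable_cong]: "sets \<gamma> = sets borel" and "prob_space \<gamma>"
    using g by (auto simp: centred_gaussian_def)
  interpret prob_space \<gamma> by fact
  interpret P: pair_prob_space \<gamma> \<gamma> ..
  have sp: "sets (\<gamma> \<Otimes>\<^sub>M \<gamma>) = sets (borel :: ('a \<times> 'a) measure)"
    unfolding borel_prod[symmetric] by (intro sets_pair_measure_cong sg)
  define Q where "Q = (\<lambda>u. \<integral>x. (x \<bullet> u)\<^sup>2 \<partial>\<gamma>)"
  have pair: "(\<integral>(x, y). cos (x \<bullet> a + y \<bullet> b + \<theta>) \<partial>(\<gamma> \<Otimes>\<^sub>M \<gamma>)) = exp (- (Q a + Q b) / 2) * cos \<theta>" for a b \<theta>
  proof -
    have i: "integrable (\<gamma> \<Otimes>\<^sub>M \<gamma>) (\<lambda>(x, y). cos (x \<bullet> a + y \<bullet> b + \<theta>))"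
      by (rule P.integrable_const_bound[where B = 1]) (auto split: prod.split)
    have "(\<integral>(x, y). cos (x \<bullet> a + y \<bullet> b + \<theta>) \<partial>(\<gamma> \<Otimes>\<^sub>M \<gamma>)) = (\<integral>x. \<integral>y. cos (x \<bullet> a + y \<bullet> b + \<theta>) \<partial>\<gamma> \<partial>\<gamma>)"
      using P.integral_fst[OF i] by simp
    also have "\<dots> = (\<integral>x. exp (- Q b / 2) * cos (x \<bullet> a + \<theta>) \<partial>\<gamma>)"
    proof (intro Bochner_Integration.integral_cong refl)
      show "(\<integral>y. cos (x \<bullet> a + y \<bullet> b + \<theta>) \<partial>\<gamma>) = exp (- Q b / 2) * cos (x \<bullet> a + \<theta>)" for x
        using centred_gaussian_cos_integral(2)[OF g, of b "x \<bullet> a + \<theta>"] by (simp add: Q_def ac_simps)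
    qed
    also have "\<dots> = exp (- Q b / 2) * (exp (- Q a / 2) * cos \<theta>)"
      using centred_gaussian_cos_integral(2)[OF g, of a \<theta>] by (simp add: Q_def)
    also have "\<dots> = exp (- (Q a + Q b) / 2) * cos \<theta>"
      by (simp add: exp_add[symmetric] field_simps)
    finally show ?thesis .
  qed
  have Qrot: "Q (c *\<^sub>R a + s *\<^sub>R b) + Q (s *\<^sub>R a - c *\<^sub>R b) = Q a + Q b" for a b
  proof -
    note i = centred_gaussian_cos_integral(1)[OF g]
    have "(x \<bullet> (c *\<^sub>R a + s *\<^sub>R b))\<^sup>2 + (x \<bullet> (s *\<^sub>R a - c *\<^sub>R b))\<^sup>2 = (c\<^sup>2 + s\<^sup>2) * ((x \<bullet> a)\<^sup>2 + (x \<bullet> b)\<^sup>2)" for x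
      by (simp add: inner_add_right inner_diff_right power2_eq_square algebra_simps)
    then have "(\<integral>x. (x \<bullet> (c *\<^sub>R a + s *\<^sub>R b))\<^sup>2 + (x \<bullet> (s *\<^sub>R a - c *\<^sub>R b))\<^sup>2 \<partial>\<gamma>) = (\<integral>x. (x \<bullet> a)\<^sup>2 + (x \<bullet> b)\<^sup>2 \<partial>\<gamma>)"
      using cs by simp
    then show ?thesis unfolding Q_def
      by (subst (asm) (1 2) Bochner_Integration.integral_add) (auto intro: i)
  qed
  have m: "(\<lambda>(x, y). (c *\<^sub>R x + s *\<^sub>R y, s *\<^sub>R x - c *\<^sub>R y)) \<in> (\<gamma> \<Otimes>\<^sub>M \<gamma>) \<rightarrow>\<^sub>M (\<gamma> \<Otimes>\<^sub>M \<gamma>)"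
    by measurable
  show ?thesis
  proof (rule measure_eqI_characteristic_functional)
    show "finite_measure ?L" using P.prob_space_distr[OF m] by (simp add: prob_space.finite_measure)
    fix w :: "'a \<times> 'a" and \<theta>
    obtain a b where w: "w = (a, b)" by (cases w)
    have "(\<integral>z. cos (z \<bullet> w + \<theta>) \<partial>?L) = (\<integral>z. cos ((case z of (x, y) \<Rightarrow> (c *\<^sub>R x + s *\<^sub>R y, s *\<^sub>R x - c *\<^sub>R y)) \<bullet> w + \<theta>) \<partial>(\<gamma> \<Otimes>\<^sub>M \<gamma>))"
      using m by (rule integral_distr) (simp add: sp cong: measurable_cong_sets)
    also have "\<dots> = (\<integral>(x, y). cos (x \<bullet> (c *\<^sub>R a + s *\<^sub>R b) + y \<bullet> (s *\<^sub>R a - c *\<^sub>R b) + \<theta>) \<partial>(\<gamma> \<Otimes>\<^sub>M \<gamma>))"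
      by (intro Bochner_Integration.integral_cong refl)
        (auto simp: w inner_add_right inner_add_left inner_diff_right inner_diff_left algebra_simps split: prod.split)
    also have "\<dots> = (\<integral>(x, y). cos (x \<bullet> a + y \<bullet> b + \<theta>) \<partial>(\<gamma> \<Otimes>\<^sub>M \<gamma>))"
      unfolding pair Qrot ..
    also have "\<dots> = (\<integral>z. cos (z \<bullet> w + \<theta>) \<partial>(\<gamma> \<Otimes>\<^sub>M \<gamma>))"
      by (intro Bochner_Integration.integral_cong refl) (auto simp: w split: prod.split)
    finally show "(\<integral>z. cos (z \<bullet> w + \<theta>) \<partial>?L) = (\<integral>z. cos (z \<bullet> w + \<theta>) \<partial>(\<gamma> \<Otimes>\<^sub>M \<gamma>))" .
  qed (simp_all add: sp P.finite_measure_axioms)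
qed

text \<open>Fernique's inequality. Under the reflection with \<open>c = s = 1 / sqrt 2\<close>, \<open>(x - y) / sqrt 2\<close> being small and
\<open>(x + y) / sqrt 2\<close> being large forces both \<open>x\<close> and \<open>y\<close> to be large, so one factor of the tail bound on the
left turns into a square on the right.\<close>

lemma gaussian_norm_tail_doubling:
  fixes \<gamma> :: "'a::{real_inner, polish_space} measure"
  assumes g: "centred_gaussian \<gamma>"
  shows "measure \<gamma> {x. norm x \<le> s} * measure \<gamma> {x. norm x > t} \<le> (measure \<gamma> {x. norm x > (t - s) / sqrt 2})\<^sup>2"
proof -
  have sg[measurable_cong]: "sets \<gamma> = sets borel" and "prob_space \<gamma>"
    using g by (auto simp: centred_gaussian_def)
  interpret prob_space \<gamma> by fact
  interpret P: pair_prob_space \<gamma> \<gamma> ..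
  let ?c = "1 / sqrt 2"
  let ?T = "\<lambda>(x::'a, y). (?c *\<^sub>R x + ?c *\<^sub>R y, ?c *\<^sub>R x - ?c *\<^sub>R y)"
  let ?A = "{x::'a. norm x > t} \<times> {x::'a. norm x \<le> s}"
  let ?B = "{x::'a. norm x > (t - s) / sqrt 2} \<times> {x::'a. norm x > (t - s) / sqrt 2}"
  have c: "?c\<^sup>2 + ?c\<^sup>2 = 1" by (simp add: power_divide)
  have m: "?T \<in> (\<gamma> \<Otimes>\<^sub>M \<gamma>) \<rightarrow>\<^sub>M (\<gamma> \<Otimes>\<^sub>M \<gamma>)" by measurable
  have S: "{x::'a. norm x > r} \<in> sets \<gamma>" "{x::'a. norm x \<le> r} \<in> sets \<gamma>" for r
    unfolding sg by measurable
  have prod: "measure (\<gamma> \<Otimes>\<^sub>M \<gamma>) (A \<times> B) = measure \<gamma> A * measure \<gamma> B" if "A \<in> sets \<gamma>" "B \<in> sets \<gamma>" for A B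
    using that by (simp add: measure_def emeasure_pair_measure_Times enn2real_mult)
  have "measure \<gamma> {x. norm x > t} * measure \<gamma> {x. norm x \<le> s} = measure (\<gamma> \<Otimes>\<^sub>M \<gamma>) ?A"
    using S by (simp add: prod)
  also have "\<dots> = measure (distr (\<gamma> \<Otimes>\<^sub>M \<gamma>) (\<gamma> \<Otimes>\<^sub>M \<gamma>) ?T) ?A"
    unfolding gaussian_pair_reflection_invariant[OF g c] ..
  also have "\<dots> = measure (\<gamma> \<Otimes>\<^sub>M \<gamma>) (?T -` ?A \<inter> space (\<gamma> \<Otimes>\<^sub>M \<gamma>))"
    using S by (intro measure_distr m) auto
  also have "\<dots> \<le> measure (\<gamma> \<Otimes>\<^sub>M \<gamma>) ?B"
  proof (rule P.finite_measure_mono)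
    show "?B \<in> sets (\<gamma> \<Otimes>\<^sub>M \<gamma>)" using S by auto
    show "?T -` ?A \<inter> space (\<gamma> \<Otimes>\<^sub>M \<gamma>) \<subseteq> ?B"
    proof
      fix z assume z: "z \<in> ?T -` ?A \<inter> space (\<gamma> \<Otimes>\<^sub>M \<gamma>)"
      obtain x y where xy: "z = (x, y)" by (cases z)
      have 1: "t < norm (?c *\<^sub>R x + ?c *\<^sub>R y)" and 2: "norm (?c *\<^sub>R x - ?c *\<^sub>R y) \<le> s"
        using z xy by auto
      have "norm (x + y) = sqrt 2 * norm (?c *\<^sub>R x + ?c *\<^sub>R y)"
        by (simp add: scaleR_right_distrib[symmetric])
      with 1 have 1: "sqrt 2 * t < norm (x + y)" by simp
      have "norm (x - y) = sqrt 2 * norm (?c *\<^sub>R x - ?c *\<^sub>R y)"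
        by (simp add: scaleR_right_diff_distrib[symmetric])
      with 2 have 2: "norm (x - y) \<le> sqrt 2 * s" by simp
      have e: "(t - s) / sqrt 2 = (sqrt 2 * t - sqrt 2 * s) / 2"
        by (simp add: field_simps)
      have e1: "2 *\<^sub>R y + (x - y) = x + y" and e2: "2 *\<^sub>R x - (x - y) = x + y"
        by (simp_all add: scaleR_2)
      have "norm (x + y) \<le> 2 * norm y + norm (x - y)" "norm (x + y) \<le> 2 * norm x + norm (x - y)"
        using norm_triangle_ineq[of "2 *\<^sub>R y" "x - y"] norm_triangle_ineq4[of "2 *\<^sub>R x" "x - y"]
        unfolding e1 e2 by simp_all
      then show "z \<in> ?B"
        unfolding e xy using 1 2 by simp
    qed
  qed
  also have "\<dots> = (measure \<gamma> {x. norm x > (t - s) / sqrt 2})\<^sup>2"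
    using S by (simp add: prod power2_eq_square)
  finally show ?thesis by (simp add: mult.commute)
qed

text \<open>Iterating the tail inequality along \<open>t\<^sub>0 = s\<close>, \<open>t\<^sub>n\<^sub>+\<^sub>1 = s + sqrt 2 * t\<^sub>n\<close> squares the tail in every step
while the radius grows only by the factor \<open>sqrt 2\<close>: the tail at radius \<open>t\<^sub>n\<close>, which is of order
\<open>sqrt 2 ^ n\<close>, is at most \<open>(1/3) ^ (2 ^ n)\<close>. Summing over the shells between consecutive radii gives the
exponential moment.\<close>

lemma gaussian_norm_exp_moment:
  fixes \<gamma> :: "'a::{real_inner, polish_space} measure"
  assumes g: "centred_gaussian \<gamma>" and v: "0 \<le> v"
  shows "(\<integral>\<^sup>+x. ennreal (exp (v * norm x)) \<partial>\<gamma>) < \<infinity>"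
proof -
  have sg[measurable_cong]: "sets \<gamma> = sets borel" and "prob_space \<gamma>"
    using g by (auto simp: centred_gaussian_def)
  interpret prob_space \<gamma> by fact
  have spb: "space \<gamma> = UNIV" using sets_eq_imp_space_eq[OF sg] by simp
  define G where "G = (\<lambda>r. measure \<gamma> {x. norm x > r})"
  have S[measurable]: "{x::'a. norm x > r} \<in> sets \<gamma>" "{x::'a. norm x \<le> r} \<in> sets \<gamma>" for r
    unfolding sg by measurable
  \<comment> \<open>A radius s with tail below 1/4 makes the ratio of tail to complement at most 1/3.\<close>
  have "(\<lambda>n. measure \<gamma> {x. norm x > real n}) \<longlonglongrightarrow> measure \<gamma> (\<Inter>n. {x. norm x > real n})"
    using S by (intro finite_Lim_measure_decseq) (auto simp: decseq_def)
  moreover have "(\<Inter>n. {x::'a. norm x > real n}) = {}"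
  proof (rule equals0I)
    fix x :: 'a assume x: "x \<in> (\<Inter>n. {x. norm x > real n})"
    obtain n where "norm x \<le> real n" using real_arch_simple by blast
    moreover have "real n < norm x" using x by blast
    ultimately show False by simp
  qed
  ultimately have "(\<lambda>n. G (real n)) \<longlonglongrightarrow> 0" by (simp add: G_def)
  then have "eventually (\<lambda>n. G (real n) < 1/4) sequentially"
    by (rule order_tendstoD) simp
  then have "eventually (\<lambda>n. G (real n) < 1/4 \<and> n > 0) sequentially"
    using eventually_gt_at_top[of 0] by (rule eventually_conj)
  then obtain k where k: "G (real k) < 1/4" "k > 0"
    using eventually_happens'[OF sequentially_bot] by blast
  define s where "s = real k"
  have s: "s > 0" "G s < 1/4" using k by (auto simp: s_def)
  define q where "q = measure \<gamma> {x. norm x \<le> s}"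
  have "{x::'a. norm x \<le> s} = space \<gamma> - {x. norm x > s}" by (auto simp: spb)
  then have q: "q = 1 - G s" unfolding q_def G_def using prob_compl[OF S(1)] by simp
  with s have q34: "q > 3/4" by simp
  define t where "t = rec_nat s (\<lambda>_ r. s + sqrt 2 * r)"
  have t0: "t 0 = s" and tS: "t (Suc n) = s + sqrt 2 * t n" for n by (simp_all add: t_def)
  have tail: "G (t n) \<le> q * (1/3) ^ (2 ^ n)" for n
  proof (induction n)
    case 0
    then show ?case using s q t0 by simp
  next
    case (Suc n)
    have "q * G (t (Suc n)) \<le> (G (t n))\<^sup>2"
      using gaussian_norm_tail_doubling[OF g, of s "t (Suc n)"] by (simp add: q_def G_def tS)
    also have "\<dots> \<le> (q * (1/3) ^ (2 ^ n))\<^sup>2"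
      by (rule power_mono[OF Suc.IH]) (simp add: G_def)
    also have "\<dots> = q * (q * (1/3) ^ (2 ^ Suc n))"
      by (simp only: power_Suc mult_2 power_add power2_eq_square mult_ac)
    finally show ?case using q34 by simp
  qed
  have t_ge: "real (Suc n) * s \<le> t n" for n
  proof (induction n)
    case (Suc n)
    then have "0 \<le> t n" using s by (meson less_eq_real_def mult_nonneg_nonneg of_nat_0_le_iff order_trans)
    then have "t n \<le> sqrt 2 * t n"
      using mult_right_mono[of 1 "sqrt 2" "t n"] by simp
    then show ?case using Suc by (simp add: tS algebra_simps)
  qed (simp add: t0)
  \<comment> \<open>The correction - 3 s absorbs the additive s in the recursion, because 4 \<le> 3 sqrt 2.\<close>
  have t_le: "t n \<le> 4 * s * sqrt 2 ^ n - 3 * s" for n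
  proof (induction n)
    case (Suc n)
    have "4/3 \<le> sqrt 2" by (rule real_le_rsqrt) (simp add: power2_eq_square)
    then have "4 * s \<le> 3 * s * sqrt 2" using s by (simp add: field_simps)
    moreover have "sqrt 2 * t n \<le> sqrt 2 * (4 * s * sqrt 2 ^ n - 3 * s)"
      using Suc by (intro mult_left_mono) auto
    ultimately show ?case by (simp add: tS algebra_simps)
  qed (simp add: t0)
  define A where "A = 4 * v * s * sqrt 2"
  have A0: "A \<ge> 0" using v s by (simp add: A_def)
  define f where "f = (\<lambda>n::nat. exp (A * sqrt 2 ^ n) * (1/3) ^ (2 ^ n))"
  obtain N where N: "A + 1 < sqrt 2 ^ N"
    using real_arch_pow[of "sqrt 2" "A + 1"] by auto
  have "A + 1 \<le> sqrt 2 ^ n" if "N \<le> n" for n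
  proof -
    have "sqrt 2 ^ N \<le> sqrt 2 ^ n" by (rule power_increasing[OF that]) simp
    with N show ?thesis by linarith
  qed
  then have "eventually (\<lambda>n. sqrt 2 ^ n \<ge> A + 1) sequentially"
    by (auto simp: eventually_sequentially)
  then have ev: "eventually (\<lambda>n. norm (f n) \<le> (1 / sqrt 2) ^ n) sequentially"
  proof (rule eventually_mono)
    fix n :: nat assume n: "sqrt 2 ^ n \<ge> A + 1"
    let ?y = "sqrt 2 ^ n :: real"
    have y2: "?y * ?y = 2 ^ n" by (simp add: power_mult_distrib[symmetric])
    \<comment> \<open>With y = sqrt 2 ^ n the term is at most exp (A y - y * y), since y * y = 2 ^ n, hence at most
      exp (- y) \<le> 1 / y once y \<ge> A + 1.\<close>
    have "exp 1 \<le> (3::real)" by (rule exp_le)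
    then have e: "1/3 \<le> exp (-1::real)" by (simp add: exp_minus field_simps)
    have y1: "1 \<le> ?y" by simp
    have "f n \<le> exp (A * ?y) * exp (-1) ^ (2 ^ n)"
      unfolding f_def by (intro mult_left_mono power_mono e) auto
    also have "\<dots> = exp (A * ?y - ?y * ?y)"
      by (simp add: exp_of_nat_mult[symmetric] exp_add[symmetric] y2)
    also have "\<dots> \<le> exp (- ?y)"
    proof -
      have "(A + 1) * ?y \<le> ?y * ?y" using n y1 by (intro mult_right_mono) auto
      then show ?thesis by (simp add: algebra_simps)
    qed
    also have "\<dots> = 1 / exp ?y" by (simp add: exp_minus field_simps)
    also have "\<dots> \<le> 1 / ?y"
    proof -
      have "?y \<le> exp ?y" using exp_ge_add_one_self[of ?y] by linarith
      then show ?thesis using y1 by (intro divide_left_mono) auto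
    qed
    finally show "norm (f n) \<le> (1 / sqrt 2) ^ n"
      by (simp add: f_def power_divide)
  qed
  have "summable (\<lambda>n. (1 / sqrt 2) ^ n :: real)"
    by (rule summable_geometric) simp
  then have sf: "summable f" using summable_comparison_test_ev[OF ev] by simp
  have term_le: "F n \<le> (\<Sum>n. F n)" for F :: "nat \<Rightarrow> ennreal" and n
    using sum_le_suminf[OF summableI, of "{n}" F] by simp
  have pt: "ennreal (exp (v * norm x)) \<le> ennreal (exp (v * s)) +
      (\<Sum>n. ennreal (exp (v * t (Suc n))) * indicator {x. norm x > t n} x)" for x :: 'a
  proof (cases "norm x \<le> s")
    case True
    then have "ennreal (exp (v * norm x)) \<le> ennreal (exp (v * s))"
      using v by (intro ennreal_leI) (simp add: mult_left_mono)
    then show ?thesis by (simp add: add_increasing2)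
  next
    case False
    obtain m where "norm x \<le> real m * s" using s reals_Archimedean3[of s] by (meson less_imp_le)
    then have ex: "norm x \<le> t m" using t_ge[of m] s by (simp add: algebra_simps)
    define m' where "m' = (LEAST m. norm x \<le> t m)"
    have m': "norm x \<le> t m'" unfolding m'_def by (rule LeastI[of _ m]) fact
    have "m' \<noteq> 0" using m' False t0 by (intro notI) simp
    then obtain n where n: "m' = Suc n" by (cases m') auto
    have "\<not> norm x \<le> t n" using not_less_Least[of n "\<lambda>m. norm x \<le> t m"] n by (simp add: m'_def)
    then have "ennreal (exp (v * norm x)) \<le> ennreal (exp (v * t (Suc n))) * indicator {x. norm x > t n} x"
      using m' n v by (auto intro!: ennreal_leI mult_left_mono)
    also have "\<dots> \<le> (\<Sum>n. ennreal (exp (v * t (Suc n))) * indicator {x. norm x > t n} x)"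
      by (rule term_le[of "\<lambda>n. ennreal (exp (v * t (Suc n))) * indicator {x. norm x > t n} x"])
    finally show ?thesis by (simp add: add_increasing)
  qed
  have "(\<integral>\<^sup>+x. ennreal (exp (v * norm x)) \<partial>\<gamma>) \<le> (\<integral>\<^sup>+x. ennreal (exp (v * s)) +
      (\<Sum>n. ennreal (exp (v * t (Suc n))) * indicator {x. norm x > t n} x) \<partial>\<gamma>)"
    by (intro nn_integral_mono pt)
  also have "\<dots> = ennreal (exp (v * s)) + (\<Sum>n. ennreal (exp (v * t (Suc n))) * emeasure \<gamma> {x. norm x > t n})"
    by (subst nn_integral_add) (auto simp: nn_integral_suminf nn_integral_cmult_indicator emeasure_space_1)
  also have "\<dots> \<le> ennreal (exp (v * s)) + (\<Sum>n. ennreal (f n))"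
  proof (intro add_left_mono suminf_le summableI)
    fix n
    have "v * t (Suc n) \<le> A * sqrt 2 ^ n"
    proof -
      have "t (Suc n) \<le> 4 * s * sqrt 2 ^ Suc n" using t_le[of "Suc n"] s by linarith
      then have "v * t (Suc n) \<le> v * (4 * s * sqrt 2 ^ Suc n)" using v by (rule mult_left_mono)
      then show ?thesis by (simp add: A_def ac_simps)
    qed
    then have "exp (v * t (Suc n)) * G (t n) \<le> exp (A * sqrt 2 ^ n) * (q * (1/3) ^ (2 ^ n))"
      by (intro mult_mono tail) (auto simp: G_def)
    also have "\<dots> \<le> f n"
      unfolding f_def using q by (intro mult_left_mono mult_left_le_one_le) (auto simp: G_def q_def)
    finally show "ennreal (exp (v * t (Suc n))) * emeasure \<gamma> {x. norm x > t n} \<le> ennreal (f n)"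
      by (simp add: emeasure_eq_measure G_def ennreal_mult[symmetric] ennreal_leI)
  qed
  also have "(\<Sum>n. ennreal (f n)) = ennreal (\<Sum>n. f n)"
    using sf by (intro suminf_ennreal2) (auto simp: f_def)
  finally show ?thesis by (rule le_less_trans) (simp add: ennreal_add_eq_top less_top)
qed

section \<open>The pCN kernel: reversibility and drift\<close>

locale pcn =
  fixes \<gamma> :: "'a::{real_inner, polish_space} measure" and \<Phi> :: "'a \<Rightarrow> real" and \<delta> :: real
  assumes gauss: "centred_gaussian \<gamma>"
    and delta: "0 < \<delta>" "\<delta> \<le> 1/2"
    and potential_measurable [measurable]: "\<Phi> \<in> borel_measurable borel"
    and potential_integrable: "integrable \<gamma> (\<lambda>x. exp (- \<Phi> x))"
begin

lemma sets_gaussian [measurable_cong, simp]: "sets \<gamma> = sets borel"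
  using gauss by (simp add: centred_gaussian_def)

lemma space_gaussian [simp]: "space \<gamma> = UNIV"
  using sets_eq_imp_space_eq[OF sets_gaussian] by simp

sublocale prob_space \<gamma>
  using gauss by (simp add: centred_gaussian_def)

lemma emeasure_gaussian_UNIV [simp]: "emeasure \<gamma> UNIV = 1"
  using emeasure_space_1 by simp

lemma prob_gaussian_UNIV [simp]: "prob UNIV = 1"
  using prob_space by simp

definition proposal :: "'a \<Rightarrow> 'a \<Rightarrow> 'a" where
  "proposal x \<xi> = sqrt (1 - 2 * \<delta>) *\<^sub>R x + sqrt (2 * \<delta>) *\<^sub>R \<xi>"

abbreviation "K \<equiv> pcn_kernel \<delta> \<Phi> \<gamma>"
abbreviation "\<mu> \<equiv> target_measure \<Phi> \<gamma>"

lemma proposal_measurable [measurable]: "(\<lambda>(x, \<xi>). proposal x \<xi>) \<in> borel_measurable (borel \<Otimes>\<^sub>M borel)"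
  unfolding proposal_def by measurable

lemma acceptance_measurable [measurable]:
  "(\<lambda>(x, y). acceptance \<Phi> x y) \<in> borel_measurable (borel \<Otimes>\<^sub>M borel)"
  unfolding acceptance_def by measurable

lemma acceptance_bounds: "0 \<le> acceptance \<Phi> x y" "acceptance \<Phi> x y \<le> 1"
  by (auto simp: acceptance_def)

lemma prob_space_unit_uniform: "prob_space (uniform_measure lborel {0..1::real})"
  by (rule prob_space_uniform_measure) auto

lemma pcn_step_measurable:
  "(\<lambda>(x, \<xi>, u). let p = proposal x \<xi> in if u \<le> acceptance \<Phi> x p then p else x)
    \<in> borel_measurable (borel \<Otimes>\<^sub>M (\<gamma> \<Otimes>\<^sub>M uniform_measure lborel {0..1::real}))"
  unfolding Let_def by measurable

lemma pcn_kernel_eq: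
  "K x = distr (\<gamma> \<Otimes>\<^sub>M uniform_measure lborel {0..1::real}) borel
    (\<lambda>(\<xi>, u). let p = proposal x \<xi> in if u \<le> acceptance \<Phi> x p then p else x)"
  by (simp add: pcn_kernel_def proposal_def)

lemma kernel_measurable [measurable]: "K \<in> borel \<rightarrow>\<^sub>M subprob_algebra borel"
proof -
  have pg: "prob_space \<gamma>" by (rule prob_space_axioms)
  have "(\<lambda>x. distr (\<gamma> \<Otimes>\<^sub>M uniform_measure lborel {0..1::real}) borel
      (\<lambda>(\<xi>, u). let p = proposal x \<xi> in if u \<le> acceptance \<Phi> x p then p else x)) \<in> borel \<rightarrow>\<^sub>M subprob_algebra borel"
  proof (rule measurable_distr2)
    show "(\<lambda>x. \<gamma> \<Otimes>\<^sub>M uniform_measure lborel {0..1::real}) \<in> borel \<rightarrow>\<^sub>M subprob_algebra (\<gamma> \<Otimes>\<^sub>M uniform_measure lborel {0..1::real})"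
      by (rule measurable_const)
        (simp add: space_subprob_algebra prob_space_imp_subprob_space[OF prob_space_pair[OF pg prob_space_unit_uniform]])
    show "case_prod (\<lambda>x (\<xi>, u). let p = proposal x \<xi> in if u \<le> acceptance \<Phi> x p then p else x)
      \<in> borel \<Otimes>\<^sub>M (\<gamma> \<Otimes>\<^sub>M uniform_measure lborel {0..1::real}) \<rightarrow>\<^sub>M borel"
      using pcn_step_measurable by simp
  qed
  then show ?thesis by (simp add: pcn_kernel_eq[abs_def] cong: measurable_cong)
qed

lemma prob_space_kernel: "prob_space (K x)"
proof -
  interpret U: prob_space "uniform_measure lborel {0..1::real}" by (rule prob_space_unit_uniform)
  interpret P: pair_prob_space \<gamma> "uniform_measure lborel {0..1::real}" ..
  show ?thesis unfolding pcn_kernel_eq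
    by (rule P.prob_space_distr) (use measurable_Pair2[OF pcn_step_measurable, of x] in simp)
qed

lemma sets_kernel_eq [simp]: "sets (K x) = sets borel"
  by (simp add: pcn_kernel_def)

text \<open>Integrating out the uniform variable: the accept/reject step turns into a convex combination.\<close>

lemma nn_integral_kernel:
  assumes f[measurable]: "f \<in> borel_measurable borel"
  shows "(\<integral>\<^sup>+y. f y \<partial>K x) = (\<integral>\<^sup>+\<xi>. ennreal (acceptance \<Phi> x (proposal x \<xi>)) * f (proposal x \<xi>)
      + ennreal (1 - acceptance \<Phi> x (proposal x \<xi>)) * f x \<partial>\<gamma>)"
proof -
  let ?U = "uniform_measure lborel {0..1::real}"
  interpret U: prob_space ?U by (rule prob_space_unit_uniform)
  let ?s = "\<lambda>(\<xi>, u). let p = proposal x \<xi> in if u \<le> acceptance \<Phi> x p then p else x"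
  have sm[measurable]: "?s \<in> borel_measurable (\<gamma> \<Otimes>\<^sub>M ?U)"
    using measurable_Pair2[OF pcn_step_measurable, of x] by simp
  have "(\<integral>\<^sup>+y. f y \<partial>K x) = (\<integral>\<^sup>+z. f (?s z) \<partial>(\<gamma> \<Otimes>\<^sub>M ?U))"
    unfolding pcn_kernel_eq by (rule nn_integral_distr) measurable
  also have "\<dots> = (\<integral>\<^sup>+\<xi>. \<integral>\<^sup>+u. f (?s (\<xi>, u)) \<partial>?U \<partial>\<gamma>)"
    by (rule U.nn_integral_fst[symmetric]) measurable
  also have "\<dots> = (\<integral>\<^sup>+\<xi>. ennreal (acceptance \<Phi> x (proposal x \<xi>)) * f (proposal x \<xi>)
      + ennreal (1 - acceptance \<Phi> x (proposal x \<xi>)) * f x \<partial>\<gamma>)"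
  proof (rule nn_integral_cong)
    fix \<xi>
    define p where "p = proposal x \<xi>"
    define a where "a = acceptance \<Phi> x p"
    have a: "0 \<le> a" "a \<le> 1" unfolding a_def by (rule acceptance_bounds)+
    have "(\<integral>\<^sup>+u. f (?s (\<xi>, u)) \<partial>?U) = (\<integral>\<^sup>+u. f p * indicator {..a} u + f x * indicator {a<..} u \<partial>?U)"
      by (intro nn_integral_cong) (auto simp: Let_def p_def[symmetric] a_def indicator_def)
    also have "\<dots> = f p * emeasure ?U {..a} + f x * emeasure ?U {a<..}"
      by (subst nn_integral_add) (auto simp: nn_integral_cmult_indicator)
    also have "emeasure ?U {..a} = ennreal a"
    proof -
      have "{0..1} \<inter> {..a} = {0..a}" using a by auto
      then show ?thesis using a by (simp add: divide_ennreal_def)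
    qed
    also have "emeasure ?U {a<..} = ennreal (1 - a)"
    proof -
      have "{0..1} \<inter> {a<..} = {a<..1}" using a by auto
      then show ?thesis using a by (simp add: divide_ennreal_def)
    qed
    finally show "(\<integral>\<^sup>+u. f (?s (\<xi>, u)) \<partial>?U) = ennreal (acceptance \<Phi> x (proposal x \<xi>)) * f (proposal x \<xi>)
      + ennreal (1 - acceptance \<Phi> x (proposal x \<xi>)) * f x"
      by (simp add: a_def p_def mult.commute)
  qed
  finally show ?thesis .
qed

definition Z :: real where "Z = (\<integral>x. exp (- \<Phi> x) \<partial>\<gamma>)"

lemma Z_pos: "0 < Z"
proof -
  have "Z \<noteq> 0"
    unfolding Z_def using integral_nonneg_eq_0_iff_AE[OF potential_integrable] by auto
  moreover have "0 \<le> Z" unfolding Z_def by simp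
  ultimately show ?thesis by simp
qed

lemma target_measure_eq: "\<mu> = density \<gamma> (\<lambda>x. ennreal (exp (- \<Phi> x) / Z))"
  by (simp add: target_measure_def Z_def)

lemma sets_target [simp, measurable_cong]: "sets \<mu> = sets borel"
  by (simp add: target_measure_eq)

lemma prob_space_target: "prob_space \<mu>"
proof (rule prob_spaceI)
  have "emeasure \<mu> (space \<mu>) = (\<integral>\<^sup>+x. ennreal (exp (- \<Phi> x) / Z) \<partial>\<gamma>)"
    unfolding target_measure_eq by (subst emeasure_density) (auto intro!: nn_integral_cong)
  also have "\<dots> = ennreal (\<integral>x. exp (- \<Phi> x) / Z \<partial>\<gamma>)"
    using Z_pos potential_integrable by (intro nn_integral_eq_integral) auto
  also have "\<dots> = 1" using Z_pos by (simp add: Z_def)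
  finally show "emeasure \<mu> (space \<mu>) = 1" .
qed

text \<open>Reversibility of the proposal under \<open>\<gamma>\<close>. The reflection sends \<open>(x, \<xi>)\<close> to a pair whose first entry is
the proposal from \<open>x\<close>; the proposal map, which is the first entry of the same reflection, then returns
\<open>x\<close>, because a reflection is its own inverse.\<close>

lemma gaussian_proposal_exchangeable:
  assumes F[measurable]: "(\<lambda>(x, y). F x y) \<in> borel_measurable (borel \<Otimes>\<^sub>M borel)"
  shows "(\<integral>\<^sup>+x. \<integral>\<^sup>+\<xi>. F x (proposal x \<xi>) \<partial>\<gamma> \<partial>\<gamma>) = (\<integral>\<^sup>+x. \<integral>\<^sup>+\<xi>. F (proposal x \<xi>) x \<partial>\<gamma> \<partial>\<gamma>)"
proof -
  interpret P: pair_prob_space \<gamma> \<gamma> ..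
  let ?c = "sqrt (1 - 2 * \<delta>)" and ?s = "sqrt (2 * \<delta>)"
  have cs: "?c\<^sup>2 + ?s\<^sup>2 = 1" using delta by simp
  let ?T = "\<lambda>(x::'a, y). (?c *\<^sub>R x + ?s *\<^sub>R y, ?s *\<^sub>R x - ?c *\<^sub>R y)"
  have Tm: "?T \<in> (\<gamma> \<Otimes>\<^sub>M \<gamma>) \<rightarrow>\<^sub>M (\<gamma> \<Otimes>\<^sub>M \<gamma>)" by measurable
  let ?G = "\<lambda>(x, \<xi>). F x (proposal x \<xi>)"
  have Gm: "?G \<in> borel_measurable (\<gamma> \<Otimes>\<^sub>M \<gamma>)" by measurable
  have "(\<integral>\<^sup>+x. \<integral>\<^sup>+\<xi>. F x (proposal x \<xi>) \<partial>\<gamma> \<partial>\<gamma>) = (\<integral>\<^sup>+z. ?G z \<partial>(\<gamma> \<Otimes>\<^sub>M \<gamma>))"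
    using nn_integral_fst[OF Gm] by simp
  also have "\<dots> = (\<integral>\<^sup>+z. ?G z \<partial>distr (\<gamma> \<Otimes>\<^sub>M \<gamma>) (\<gamma> \<Otimes>\<^sub>M \<gamma>) ?T)"
    unfolding gaussian_pair_reflection_invariant[OF gauss cs] ..
  also have "\<dots> = (\<integral>\<^sup>+z. ?G (?T z) \<partial>(\<gamma> \<Otimes>\<^sub>M \<gamma>))"
    by (rule nn_integral_distr[OF Tm]) (use Gm in simp)
  also have "\<dots> = (\<integral>\<^sup>+z. (\<lambda>(x, \<xi>). F (proposal x \<xi>) x) z \<partial>(\<gamma> \<Otimes>\<^sub>M \<gamma>))"
  proof (rule nn_integral_cong)
    fix z :: "'a \<times> 'a"
    obtain x \<xi> where z: "z = (x, \<xi>)" by (cases z)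
    have "?c *\<^sub>R (?c *\<^sub>R x + ?s *\<^sub>R \<xi>) + ?s *\<^sub>R (?s *\<^sub>R x - ?c *\<^sub>R \<xi>) = (?c\<^sup>2 + ?s\<^sup>2) *\<^sub>R x"
      by (simp only: power2_eq_square scaleR_add_left scaleR_add_right scaleR_diff_right scaleR_scaleR)
        (simp add: mult.commute)
    then have "?c *\<^sub>R (?c *\<^sub>R x + ?s *\<^sub>R \<xi>) + ?s *\<^sub>R (?s *\<^sub>R x - ?c *\<^sub>R \<xi>) = x"
      by (simp only: cs scaleR_one)
    then show "?G (?T z) = (\<lambda>(x, \<xi>). F (proposal x \<xi>) x) z"
      by (simp only: z proposal_def split)
  qed
  also have "\<dots> = (\<integral>\<^sup>+x. \<integral>\<^sup>+\<xi>. F (proposal x \<xi>) x \<partial>\<gamma> \<partial>\<gamma>)"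
    by (subst nn_integral_fst[symmetric]) auto
  finally show ?thesis .
qed

text \<open>Detailed balance: the density of \<open>\<mu>\<close> times the acceptance probability is the symmetric function
\<open>min (exp (- \<Phi> x)) (exp (- \<Phi> y)) / Z\<close>, so the accepted mass arriving at a point equals the accepted mass
leaving it.\<close>

lemma nn_integral_kernel_target:
  assumes f[measurable]: "f \<in> borel_measurable borel"
  shows "(\<integral>\<^sup>+x. \<integral>\<^sup>+y. f y \<partial>K x \<partial>\<mu>) = (\<integral>\<^sup>+x. f x \<partial>\<mu>)"
proof -
  define m where "m = (\<lambda>x y. min (exp (- \<Phi> x)) (exp (- \<Phi> y)) / Z)"
  have mm[measurable]: "(\<lambda>(x, y). m x y) \<in> borel_measurable (borel \<Otimes>\<^sub>M borel)"
    unfolding m_def by measurable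
  have m0: "0 \<le> m x y" "m x y \<le> exp (- \<Phi> x) / Z" for x y
    using Z_pos by (auto simp: m_def divide_right_mono)
  have acc: "exp (- \<Phi> x) / Z * acceptance \<Phi> x y = m x y" for x y
  proof -
    have "exp (- \<Phi> x) * min 1 (exp (\<Phi> x - \<Phi> y)) = min (exp (- \<Phi> x)) (exp (- \<Phi> y))"
      by (subst min_mult_distrib_left) (auto simp: exp_add[symmetric])
    then show ?thesis by (simp add: acceptance_def m_def)
  qed
  let ?e = "\<lambda>x. exp (- \<Phi> x) / Z"
  have [measurable]: "K \<in> \<mu> \<rightarrow>\<^sub>M subprob_algebra borel" by (simp cong: measurable_cong_sets)
  have "(\<integral>\<^sup>+x. \<integral>\<^sup>+y. f y \<partial>K x \<partial>\<mu>) = (\<integral>\<^sup>+x. ennreal (?e x) * (\<integral>\<^sup>+y. f y \<partial>K x) \<partial>\<gamma>)"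
    unfolding target_measure_eq
    by (rule nn_integral_density) (auto intro!: measurable_compose[OF kernel_measurable nn_integral_measurable_subprob_algebra])
  also have "\<dots> = (\<integral>\<^sup>+x. \<integral>\<^sup>+\<xi>. ennreal (m x (proposal x \<xi>)) * f (proposal x \<xi>)
      + ennreal (?e x - m x (proposal x \<xi>)) * f x \<partial>\<gamma> \<partial>\<gamma>)"
  proof (intro nn_integral_cong)
    fix x
    have "ennreal (?e x) * (\<integral>\<^sup>+y. f y \<partial>K x) = (\<integral>\<^sup>+\<xi>. ennreal (?e x) * (ennreal (acceptance \<Phi> x (proposal x \<xi>)) * f (proposal x \<xi>)
      + ennreal (1 - acceptance \<Phi> x (proposal x \<xi>)) * f x) \<partial>\<gamma>)"
      unfolding nn_integral_kernel[OF f] by (rule nn_integral_cmult[symmetric]) measurable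
    also have "\<dots> = (\<integral>\<^sup>+\<xi>. ennreal (m x (proposal x \<xi>)) * f (proposal x \<xi>)
      + ennreal (?e x - m x (proposal x \<xi>)) * f x \<partial>\<gamma>)"
    proof (intro nn_integral_cong)
      fix \<xi>
      let ?p = "proposal x \<xi>"
      have "ennreal (?e x) * ennreal (acceptance \<Phi> x ?p) = ennreal (m x ?p)"
        using Z_pos acceptance_bounds[of x ?p] by (simp add: ennreal_mult[symmetric] acc[symmetric])
      moreover have "ennreal (?e x) * ennreal (1 - acceptance \<Phi> x ?p) = ennreal (?e x - m x ?p)"
      proof -
        have "?e x * (1 - acceptance \<Phi> x ?p) = ?e x - m x ?p"
          by (simp add: acc[symmetric] algebra_simps diff_divide_distrib)
        then show ?thesis
          using Z_pos acceptance_bounds[of x ?p] by (simp add: ennreal_mult[symmetric])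
      qed
      ultimately show "ennreal (?e x) * (ennreal (acceptance \<Phi> x ?p) * f ?p + ennreal (1 - acceptance \<Phi> x ?p) * f x)
        = ennreal (m x ?p) * f ?p + ennreal (?e x - m x ?p) * f x"
        by (simp only: distrib_left mult.assoc[symmetric])
    qed
    finally show "ennreal (?e x) * (\<integral>\<^sup>+y. f y \<partial>K x) = (\<integral>\<^sup>+\<xi>. ennreal (m x (proposal x \<xi>)) * f (proposal x \<xi>)
      + ennreal (?e x - m x (proposal x \<xi>)) * f x \<partial>\<gamma>)" .
  qed
  also have "\<dots> = (\<integral>\<^sup>+x. \<integral>\<^sup>+\<xi>. ennreal (m x (proposal x \<xi>)) * f (proposal x \<xi>) \<partial>\<gamma> \<partial>\<gamma>)
     + (\<integral>\<^sup>+x. \<integral>\<^sup>+\<xi>. ennreal (?e x - m x (proposal x \<xi>)) * f x \<partial>\<gamma> \<partial>\<gamma>)"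
    by (simp add: nn_integral_add)
  also have "(\<integral>\<^sup>+x. \<integral>\<^sup>+\<xi>. ennreal (m x (proposal x \<xi>)) * f (proposal x \<xi>) \<partial>\<gamma> \<partial>\<gamma>)
      = (\<integral>\<^sup>+x. \<integral>\<^sup>+\<xi>. ennreal (m (proposal x \<xi>) x) * f x \<partial>\<gamma> \<partial>\<gamma>)"
    by (rule gaussian_proposal_exchangeable) measurable
  also have "\<dots> + (\<integral>\<^sup>+x. \<integral>\<^sup>+\<xi>. ennreal (?e x - m x (proposal x \<xi>)) * f x \<partial>\<gamma> \<partial>\<gamma>)
      = (\<integral>\<^sup>+x. \<integral>\<^sup>+\<xi>. ennreal (m (proposal x \<xi>) x) * f x + ennreal (?e x - m x (proposal x \<xi>)) * f x \<partial>\<gamma> \<partial>\<gamma>)"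
    by (simp add: nn_integral_add)
  also have "\<dots> = (\<integral>\<^sup>+x. \<integral>\<^sup>+\<xi>. ennreal (?e x) * f x \<partial>\<gamma> \<partial>\<gamma>)"
  proof (intro nn_integral_cong)
    fix x \<xi>
    have "m (proposal x \<xi>) x = m x (proposal x \<xi>)" by (simp add: m_def min.commute)
    then show "ennreal (m (proposal x \<xi>) x) * f x + ennreal (?e x - m x (proposal x \<xi>)) * f x = ennreal (?e x) * f x"
      using m0[of x "proposal x \<xi>"] by (simp add: distrib_right[symmetric] ennreal_plus[symmetric] del: ennreal_plus)
  qed
  also have "\<dots> = (\<integral>\<^sup>+x. f x \<partial>\<mu>)"
    unfolding target_measure_eq by (simp add: nn_integral_density emeasure_space_1)
  finally show ?thesis .
qed

lemma target_invariant: "bind \<mu> K = \<mu>"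
proof (rule measure_eqI)
  have k[measurable]: "K \<in> \<mu> \<rightarrow>\<^sub>M subprob_algebra borel" by (simp cong: measurable_cong_sets)
  have ne: "space \<mu> \<noteq> {}" using prob_space.not_empty[OF prob_space_target] .
  show s: "sets (bind \<mu> K) = sets \<mu>"
    using sets_bind[of \<mu> K borel] ne by simp
  fix A assume "A \<in> sets (bind \<mu> K)"
  then have [measurable]: "A \<in> sets borel" using s by simp
  have "emeasure (bind \<mu> K) A = (\<integral>\<^sup>+x. indicator A x \<partial>(bind \<mu> K))"
    using s by simp
  also have "\<dots> = (\<integral>\<^sup>+x. \<integral>\<^sup>+y. indicator A y \<partial>K x \<partial>\<mu>)"
    by (rule nn_integral_bind[OF _ k]) measurable
  also have "\<dots> = emeasure \<mu> A"
    by (subst nn_integral_kernel_target) auto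
  finally show "emeasure (bind \<mu> K) A = emeasure \<mu> A" .
qed

text \<open>Positivity is inherited from the target measure, which has a density with respect to \<open>\<gamma>\<close>.\<close>

lemma gaussian_ball_pos:
  assumes "measure_support \<mu> = UNIV" "0 < r"
  shows "0 < measure \<gamma> (ball 0 r)"
proof -
  have "0 \<in> measure_support \<mu>" using assms(1) by simp
  then have pos: "0 < emeasure \<mu> (ball 0 r)"
    unfolding measure_support_def mem_Collect_eq using assms(2) by (elim allE[of _ "ball 0 r"] impE) simp_all
  have "emeasure \<gamma> (ball 0 r) \<noteq> 0"
  proof
    assume "emeasure \<gamma> (ball 0 r) = 0"
    then have "ball 0 r \<in> null_sets \<gamma>" by (intro null_setsI) simp_all
    then have "(\<integral>\<^sup>+x\<in>ball 0 r. ennreal (exp (- \<Phi> x) / Z) \<partial>\<gamma>) = 0"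
      by (rule nn_integral_null_set)
    moreover have "emeasure \<mu> (ball 0 r) = (\<integral>\<^sup>+x\<in>ball 0 r. ennreal (exp (- \<Phi> x) / Z) \<partial>\<gamma>)"
      unfolding target_measure_eq by (rule emeasure_density) auto
    ultimately show False using pos by simp
  qed
  then show ?thesis by (simp add: emeasure_eq_measure zero_less_measure_iff)
qed

lemma norm_proposal_le: "norm (proposal x \<xi>) \<le> sqrt (1 - 2 * \<delta>) * norm x + sqrt (2 * \<delta>) * norm \<xi>"
  unfolding proposal_def using norm_triangle_ineq[of "sqrt (1 - 2 * \<delta>) *\<^sub>R x" "sqrt (2 * \<delta>) *\<^sub>R \<xi>"] delta by simp

text \<open>Let \<open>w\<close> be the radial profile of the weight. A proposal can exceed the norm of \<open>x\<close> only if
\<open>sqrt (2 \<delta>) * norm \<xi> > \<rho> * norm x\<close>, and then its norm is at most \<open>sqrt (2 \<delta>) / \<rho> * norm \<xi>\<close>. Hence one step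
increases the weight by at most \<open>g \<xi> = w (sqrt (2 \<delta>) / \<rho> * norm \<xi>)\<close>, which is integrable. If \<open>x\<close> is
outside the ball of radius \<open>R\<close> and the noise is small, the proposal has norm at most
\<open>(1 - \<rho> / 2) * norm x\<close> and is accepted with probability at least \<open>a\<close>, which gives the contraction.\<close>

lemma drift_condition:
  fixes w :: "real \<Rightarrow> real" and R r\<^sub>0 a q \<rho> :: real
  assumes rho: "\<rho> = 1 - sqrt (1 - 2 * \<delta>)"
    and mono: "\<And>s t. 0 \<le> s \<Longrightarrow> s \<le> t \<Longrightarrow> w s \<le> w t" and w0: "\<And>s. 0 \<le> s \<Longrightarrow> 0 \<le> w s"
    and wm[measurable]: "(\<lambda>x::'a. w (norm x)) \<in> borel_measurable borel"
    and mom: "\<And>c. 0 \<le> c \<Longrightarrow> (\<integral>\<^sup>+x. ennreal (w (c * norm x)) \<partial>\<gamma>) < \<infinity>"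
    and momm: "\<And>c. (\<lambda>x::'a. w (c * norm x)) \<in> borel_measurable borel"
    and R: "0 < R" and q: "0 < q" "q \<le> 1"
    and contr: "\<And>s. R \<le> s \<Longrightarrow> w ((1 - \<rho> / 2) * s) \<le> (1 - q) * w s"
    and r0: "0 < r\<^sub>0" "r\<^sub>0 \<le> \<rho> / 2 * R" and ball: "0 < measure \<gamma> (ball 0 (r\<^sub>0 / sqrt (2 * \<delta>)))"
    and a: "0 < a" "a \<le> 1"
    and acc: "\<And>x z. R \<le> norm x \<Longrightarrow> dist ((1 - \<rho>) *\<^sub>R x) z < r\<^sub>0 \<Longrightarrow> a \<le> acceptance \<Phi> x z"
  shows "\<exists>l b. 0 \<le> l \<and> l < 1 \<and> 0 \<le> b \<and>
    (\<forall>x. (\<integral>\<^sup>+y. ennreal (w (norm y)) \<partial>K x) \<le> ennreal (l * w (norm x) + b))"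
proof -
  let ?s = "sqrt (2 * \<delta>)"
  have s: "0 < ?s" using delta by simp
  have rho01: "0 < \<rho>" "\<rho> \<le> 1" using delta unfolding rho by simp_all
  have rho': "sqrt (1 - 2 * \<delta>) = 1 - \<rho>" using rho by simp
  let ?B = "ball (0::'a) (r\<^sub>0 / ?s)"
  define g where "g = (\<lambda>\<xi>::'a. w (?s / \<rho> * norm \<xi>))"
  have gm[measurable]: "g \<in> borel_measurable borel" unfolding g_def by (rule momm)
  have g0: "0 \<le> g \<xi>" for \<xi> unfolding g_def using s rho01 by (intro w0) auto
  have gi: "integrable \<gamma> g"
  proof (rule integrableI_nonneg)
    show "(\<integral>\<^sup>+x. ennreal (g x) \<partial>\<gamma>) < \<infinity>"
      unfolding g_def using s rho01 by (intro mom) auto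
  qed (auto simp: g0)
  define G where "G = (\<integral>\<xi>. g \<xi> \<partial>\<gamma>)"
  have G0: "0 \<le> G" unfolding G_def using g0 by simp
  have prop_le: "norm (proposal x \<xi>) \<le> norm x - \<rho> * norm x + ?s * norm \<xi>" for x \<xi>
    using norm_proposal_le[of x \<xi>] unfolding rho' by (simp add: left_diff_distrib)
  have crude: "w (norm (proposal x \<xi>)) \<le> w (norm x) + g \<xi>" for x \<xi>
  proof (cases "?s * norm \<xi> \<le> \<rho> * norm x")
    case True
    then have "norm (proposal x \<xi>) \<le> norm x"
      using prop_le[of x \<xi>] by linarith
    then show ?thesis using mono[of "norm (proposal x \<xi>)" "norm x"] g0[of \<xi>] by simp
  next
    case False
    then have "norm x \<le> ?s * norm \<xi> / \<rho>" using rho01 by (simp add: field_simps)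
    then have "(1 - \<rho>) * norm x \<le> (1 - \<rho>) * (?s * norm \<xi> / \<rho>)"
      using rho01 by (intro mult_left_mono) auto
    also have "\<dots> = ?s / \<rho> * norm \<xi> - ?s * norm \<xi>" using rho01 by (simp add: field_simps)
    finally have "norm (proposal x \<xi>) \<le> ?s / \<rho> * norm \<xi>"
      using prop_le[of x \<xi>] by (simp add: left_diff_distrib)
    then have "w (norm (proposal x \<xi>)) \<le> g \<xi>" unfolding g_def by (rule mono[OF norm_ge_zero])
    then show ?thesis using w0[of "norm x"] by simp
  qed
  define \<beta> where "\<beta> = measure \<gamma> ?B"
  define l where "l = 1 - a * q * \<beta>"
  define b where "b = w R + G"
  have aq: "a * q * \<beta> \<le> 1" "0 < a * q * \<beta>"
    using a q ball measure_le_1[of ?B] by (auto simp: \<beta>_def intro!: mult_le_one)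
  have step: "(\<integral>\<^sup>+y. ennreal (w (norm y)) \<partial>K x) \<le> ennreal (l * w (norm x) + b)" for x
  proof -
    let ?W = "w (norm x)"
    \<comment> \<open>The set of good noises; it is used only from points outside the ball of radius R.\<close>
    define J where "J = (if R \<le> norm x then ?B else {})"
    have W: "0 \<le> ?W" by (rule w0) simp
    have pt: "acceptance \<Phi> x (proposal x \<xi>) * w (norm (proposal x \<xi>)) + (1 - acceptance \<Phi> x (proposal x \<xi>)) * ?W
       \<le> (1 - a * q * indicator J \<xi>) * ?W + g \<xi>" for \<xi>
    proof -
      define A where "A = acceptance \<Phi> x (proposal x \<xi>)"
      have A: "0 \<le> A" "A \<le> 1" unfolding A_def by (rule acceptance_bounds)+
      show ?thesis unfolding A_def[symmetric]
      proof (cases "\<xi> \<in> J")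
        case True
        then have Rx: "R \<le> norm x" and xi: "?s * norm \<xi> < r\<^sub>0"
          using s by (auto simp: J_def field_simps split: if_splits)
        have "dist ((1 - \<rho>) *\<^sub>R x) (proposal x \<xi>) < r\<^sub>0"
          using xi s by (simp add: proposal_def rho' dist_norm)
        then have aA: "a \<le> A" unfolding A_def by (rule acc[OF Rx])
        have "?s * norm \<xi> \<le> \<rho> / 2 * norm x"
          using xi r0(2) mult_left_mono[OF Rx, of "\<rho> / 2"] rho01(1) by linarith
        then have "norm (proposal x \<xi>) \<le> (1 - \<rho> / 2) * norm x"
          using prop_le[of x \<xi>] unfolding left_diff_distrib by simp
        then have "w (norm (proposal x \<xi>)) \<le> (1 - q) * ?W"
          using contr[OF Rx] mono[OF norm_ge_zero, of "proposal x \<xi>" "(1 - \<rho> / 2) * norm x"] by simp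
        then have "A * w (norm (proposal x \<xi>)) \<le> A * ((1 - q) * ?W)"
          by (rule mult_left_mono[OF _ A(1)])
        moreover have "a * (q * ?W) \<le> A * (q * ?W)"
          using aA q W by (intro mult_right_mono) auto
        ultimately show "A * w (norm (proposal x \<xi>)) + (1 - A) * ?W \<le> (1 - a * q * indicator J \<xi>) * ?W + g \<xi>"
          using True g0[of \<xi>] by (simp add: algebra_simps)
      next
        case False
        have "A * w (norm (proposal x \<xi>)) \<le> A * (?W + g \<xi>)"
          by (rule mult_left_mono[OF crude A(1)])
        moreover have "A * g \<xi> \<le> g \<xi>" using A g0 by (intro mult_left_le_one_le) auto
        ultimately show "A * w (norm (proposal x \<xi>)) + (1 - A) * ?W \<le> (1 - a * q * indicator J \<xi>) * ?W + g \<xi>"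
          using False by (simp add: algebra_simps)
      qed
    qed
    have rhs0: "0 \<le> (1 - a * q * indicator J \<xi>) * ?W + g \<xi>" for \<xi>
    proof -
      have "a * q * indicator J \<xi> \<le> 1" using a q by (auto simp: indicator_def intro!: mult_le_one)
      then show ?thesis using W g0[of \<xi>] by simp
    qed
    have Jm[measurable]: "J \<in> sets \<gamma>" by (auto simp: J_def)
    have Ji: "integrable \<gamma> (indicat_real J)"
      by (rule integrable_const_bound[where B = 1]) (auto simp: indicator_def)
    have int: "integrable \<gamma> (\<lambda>\<xi>. (1 - a * q * indicator J \<xi>) * ?W + g \<xi>)"
      by (intro Bochner_Integration.integrable_add gi Ji integrable_mult_left Bochner_Integration.integrable_diff integrable_mult_right) auto
    have "(\<integral>\<^sup>+y. ennreal (w (norm y)) \<partial>K x) = (\<integral>\<^sup>+\<xi>. ennreal (acceptance \<Phi> x (proposal x \<xi>)) * ennreal (w (norm (proposal x \<xi>)))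
      + ennreal (1 - acceptance \<Phi> x (proposal x \<xi>)) * ennreal ?W \<partial>\<gamma>)"
      by (rule nn_integral_kernel) measurable
    also have "\<dots> \<le> (\<integral>\<^sup>+\<xi>. ennreal ((1 - a * q * indicator J \<xi>) * ?W + g \<xi>) \<partial>\<gamma>)"
    proof (intro nn_integral_mono)
      fix \<xi>
      show "ennreal (acceptance \<Phi> x (proposal x \<xi>)) * ennreal (w (norm (proposal x \<xi>)))
        + ennreal (1 - acceptance \<Phi> x (proposal x \<xi>)) * ennreal ?W \<le> ennreal ((1 - a * q * indicator J \<xi>) * ?W + g \<xi>)"
        using pt[of \<xi>] acceptance_bounds[of x "proposal x \<xi>"] W w0[of "norm (proposal x \<xi>)"]
        by (simp add: ennreal_mult[symmetric] ennreal_plus[symmetric] ennreal_leI del: ennreal_plus)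
    qed
    also have "\<dots> = ennreal (\<integral>\<xi>. (1 - a * q * indicator J \<xi>) * ?W + g \<xi> \<partial>\<gamma>)"
      using int rhs0 by (intro nn_integral_eq_integral) auto
    also have "(\<integral>\<xi>. (1 - a * q * indicator J \<xi>) * ?W + g \<xi> \<partial>\<gamma>) = (1 - a * q * measure \<gamma> J) * ?W + G"
      using gi Ji by (subst Bochner_Integration.integral_add) (auto simp: G_def prob_space emeasure_eq_measure)
    also have "\<dots> \<le> l * ?W + b"
    proof (cases "R \<le> norm x")
      case True
      then show ?thesis using w0[of R] R by (simp add: J_def l_def b_def \<beta>_def)
    next
      case False
      then have "?W \<le> w R" by (intro mono) auto
      moreover have "0 \<le> l * ?W" using aq W by (simp add: l_def)
      ultimately show ?thesis using False by (simp add: J_def b_def)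
    qed
    finally show ?thesis by (simp add: ennreal_leI)
  qed
  show ?thesis
  proof (intro exI conjI allI)
    show "0 \<le> l" "l < 1" using aq by (auto simp: l_def)
    show "0 \<le> b" using G0 w0[of R] R by (simp add: b_def)
    show "(\<integral>\<^sup>+y. ennreal (w (norm y)) \<partial>K x) \<le> ennreal (l * w (norm x) + b)" for x by (rule step)
  qed
qed

end

section \<open>A strong law of large numbers from second moments\<close>

lemma AE_tendsto_zero_if_summable_expectations:
  fixes U :: "nat \<Rightarrow> 'm \<Rightarrow> real"
  assumes m[measurable]: "\<And>k. U k \<in> borel_measurable M" and nn: "\<And>k \<omega>. 0 \<le> U k \<omega>"
    and bd: "\<And>k. (\<integral>\<^sup>+\<omega>. ennreal (U k \<omega>) \<partial>M) \<le> ennreal (c k)" and c: "summable c" "\<And>k. 0 \<le> c k"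
  shows "AE \<omega> in M. (\<lambda>k. U k \<omega>) \<longlonglongrightarrow> 0"
proof -
  have "(\<integral>\<^sup>+\<omega>. (\<Sum>k. ennreal (U k \<omega>)) \<partial>M) = (\<Sum>k. \<integral>\<^sup>+\<omega>. ennreal (U k \<omega>) \<partial>M)"
    by (rule nn_integral_suminf) measurable
  also have "\<dots> \<le> (\<Sum>k. ennreal (c k))"
    by (intro suminf_le summableI bd)
  also have "\<dots> = ennreal (\<Sum>k. c k)" by (rule suminf_ennreal2[OF c(2,1)])
  finally have "(\<integral>\<^sup>+\<omega>. (\<Sum>k. ennreal (U k \<omega>)) \<partial>M) \<noteq> \<infinity>" by (auto simp: top_unique)
  then have "AE \<omega> in M. (\<Sum>k. ennreal (U k \<omega>)) \<noteq> \<infinity>"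
    by (intro nn_integral_noteq_infinite) measurable
  then show ?thesis
  proof (rule eventually_mono)
    fix \<omega> assume "(\<Sum>k. ennreal (U k \<omega>)) \<noteq> \<infinity>"
    then have "summable (\<lambda>k. U k \<omega>)" using nn by (intro summable_suminf_not_top) auto
    then show "(\<lambda>k. U k \<omega>) \<longlonglongrightarrow> 0" by (rule summable_LIMSEQ_zero)
  qed
qed

text \<open>Between \<open>k\<^sup>2\<close> and \<open>(k + 1)\<^sup>2\<close> a partial sum differs from its value at \<open>k\<^sup>2\<close> by at most the sum of the absolute
values over that block.\<close>

lemma average_tendsto_zero_from_squares:
  fixes y :: "nat \<Rightarrow> real"
  assumes A: "(\<lambda>k. ((\<Sum>i=1..(Suc k)\<^sup>2. y i) / real ((Suc k)\<^sup>2))\<^sup>2) \<longlonglongrightarrow> 0"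
    and B: "(\<lambda>k. ((\<Sum>i\<in>{(Suc k)\<^sup>2<..(Suc (Suc k))\<^sup>2}. \<bar>y i\<bar>) / real ((Suc k)\<^sup>2))\<^sup>2) \<longlonglongrightarrow> 0"
  shows "(\<lambda>n. (\<Sum>i=1..n. y i) / real n) \<longlonglongrightarrow> 0"
proof (rule LIMSEQ_I)
  fix e :: real assume e: "0 < e"
  let ?S = "\<lambda>n. \<Sum>i=1..n. y i" and ?T = "\<lambda>k. \<Sum>i\<in>{k\<^sup>2<..(Suc k)\<^sup>2}. \<bar>y i\<bar>"
  have sq: "0 < (e/2)\<^sup>2" using e by simp
  obtain k1 where k1: "\<And>k. k \<ge> k1 \<Longrightarrow> ((?S ((Suc k)\<^sup>2)) / real ((Suc k)\<^sup>2))\<^sup>2 < (e/2)\<^sup>2"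
    using LIMSEQ_D[OF A sq] by auto
  obtain k2 where k2: "\<And>k. k \<ge> k2 \<Longrightarrow> (?T (Suc k) / real ((Suc k)\<^sup>2))\<^sup>2 < (e/2)\<^sup>2"
    using LIMSEQ_D[OF B sq] by auto
  have "norm (?S n / real n - 0) < e" if n: "n \<ge> (Suc (max k1 k2))\<^sup>2" for n
  proof -
    define k where "k = floor_sqrt n"
    have "Suc (max k1 k2) \<le> k" unfolding k_def by (rule le_floor_sqrtI[OF n])
    then obtain j where j: "k = Suc j" "j \<ge> k1" "j \<ge> k2" by (cases k) auto
    have kn: "k\<^sup>2 \<le> n" "n < (Suc k)\<^sup>2" unfolding k_def by (simp, rule Suc_floor_sqrt_power2_gt)
    have k0: "0 < real (k\<^sup>2)" using j by simp
    have n0: "0 < n" using kn j by (metis gr0I k0 le_zero_eq of_nat_0_less_iff)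
    have "{1..n} = {1..k\<^sup>2} \<union> {k\<^sup>2<..n}" using kn by auto
    then have "?S n = sum y ({1..k\<^sup>2} \<union> {k\<^sup>2<..n})" by (rule arg_cong)
    also have "\<dots> = ?S (k\<^sup>2) + (\<Sum>i\<in>{k\<^sup>2<..n}. y i)"
      by (rule sum.union_disjoint) auto
    finally have "?S n = ?S (k\<^sup>2) + (\<Sum>i\<in>{k\<^sup>2<..n}. y i)" .
    then have "\<bar>?S n\<bar> \<le> \<bar>?S (k\<^sup>2)\<bar> + \<bar>\<Sum>i\<in>{k\<^sup>2<..n}. y i\<bar>" by linarith
    also have "\<bar>\<Sum>i\<in>{k\<^sup>2<..n}. y i\<bar> \<le> (\<Sum>i\<in>{k\<^sup>2<..n}. \<bar>y i\<bar>)" by (rule sum_abs)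
    also have "\<dots> \<le> ?T k" using kn by (intro sum_mono2) auto
    finally have 1: "\<bar>?S n\<bar> \<le> \<bar>?S (k\<^sup>2)\<bar> + ?T k" by simp
    have 2: "\<bar>?S (k\<^sup>2)\<bar> / real (k\<^sup>2) < e / 2"
    proof -
      have "\<bar>?S (k\<^sup>2) / real (k\<^sup>2)\<bar>\<^sup>2 < (e / 2)\<^sup>2"
        using k1[OF j(2)] unfolding j(1)[symmetric] power2_abs .
      then have "\<bar>?S (k\<^sup>2) / real (k\<^sup>2)\<bar> < e / 2"
        by (rule power_less_imp_less_base) (use e in simp)
      then show ?thesis by (simp only: abs_divide abs_of_nat)
    qed
    have 3: "?T k / real (k\<^sup>2) < e / 2"
      using k2[OF j(3)] unfolding j(1)[symmetric] by (rule power_less_imp_less_base) (use e in simp)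
    have "norm (?S n / real n - 0) = \<bar>?S n\<bar> / real n" by simp
    also have "\<dots> \<le> \<bar>?S n\<bar> / real (k\<^sup>2)"
      using kn(1) k0 by (intro divide_left_mono) (auto simp: n0)
    also have "\<dots> \<le> (\<bar>?S (k\<^sup>2)\<bar> + ?T k) / real (k\<^sup>2)"
      using 1 by (intro divide_right_mono) auto
    also have "\<dots> < e" unfolding add_divide_distrib using 2 3 by linarith
    finally show ?thesis .
  qed
  then show "\<exists>no. \<forall>n\<ge>no. norm (?S n / real n - 0) < e" by blast
qed

text \<open>At \<open>n = k\<^sup>2\<close> the squared average has expectation at most \<open>D / k\<^sup>2\<close>. The block after \<open>k\<^sup>2\<close> has
\<open>2 k + 1 \<le> 3 k\<close> terms, so by Cauchy-Schwarz its squared sum has expectation at most \<open>9 D k\<^sup>2\<close>, which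
divided by \<open>k\<^sup>4\<close> is again summable.\<close>

lemma strong_law_of_linear_variance:
  fixes Y :: "nat \<Rightarrow> 'm \<Rightarrow> real"
  assumes m[measurable]: "\<And>n. Y n \<in> borel_measurable M"
    and sq: "\<And>n. (\<integral>\<^sup>+\<omega>. ennreal ((Y n \<omega>)\<^sup>2) \<partial>M) \<le> ennreal D"
    and var: "\<And>n. (\<integral>\<^sup>+\<omega>. ennreal ((\<Sum>i=1..n. Y i \<omega>)\<^sup>2) \<partial>M) \<le> ennreal (D * real n)"
    and D: "0 \<le> D"
  shows "AE \<omega> in M. (\<lambda>n. (\<Sum>i=1..n. Y i \<omega>) / real n) \<longlonglongrightarrow> 0"
proof -
  have sc: "summable (\<lambda>k. C / real ((Suc k)\<^sup>2))" for C :: real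
  proof -
    have "summable (\<lambda>k. inverse (real (Suc k) ^ 2))"
      using inverse_power_summable[of 2, where 'a = real] by (subst summable_Suc_iff) simp
    from summable_mult[OF this, of C] show ?thesis by (simp add: field_simps)
  qed
  have 1: "AE \<omega> in M. (\<lambda>k. ((\<Sum>i=1..(Suc k)\<^sup>2. Y i \<omega>) / real ((Suc k)\<^sup>2))\<^sup>2) \<longlonglongrightarrow> 0"
  proof (rule AE_tendsto_zero_if_summable_expectations[OF _ _ _ sc[of D]])
    fix k
    let ?q = "real ((Suc k)\<^sup>2)"
    have "(\<integral>\<^sup>+\<omega>. ennreal (((\<Sum>i=1..(Suc k)\<^sup>2. Y i \<omega>) / ?q)\<^sup>2) \<partial>M)
        = (\<integral>\<^sup>+\<omega>. ennreal (1 / ?q\<^sup>2) * ennreal ((\<Sum>i=1..(Suc k)\<^sup>2. Y i \<omega>)\<^sup>2) \<partial>M)"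
      by (intro nn_integral_cong) (simp add: ennreal_mult[symmetric] power_divide)
    also have "\<dots> = ennreal (1 / ?q\<^sup>2) * (\<integral>\<^sup>+\<omega>. ennreal ((\<Sum>i=1..(Suc k)\<^sup>2. Y i \<omega>)\<^sup>2) \<partial>M)"
      by (rule nn_integral_cmult) measurable
    also have "\<dots> \<le> ennreal (1 / ?q\<^sup>2) * ennreal (D * ?q)"
      by (intro mult_left_mono var) auto
    also have "\<dots> = ennreal (D / ?q)"
      using D by (subst ennreal_mult[symmetric]) (auto simp: power2_eq_square)
    finally show "(\<integral>\<^sup>+\<omega>. ennreal (((\<Sum>i=1..(Suc k)\<^sup>2. Y i \<omega>) / ?q)\<^sup>2) \<partial>M) \<le> ennreal (D / ?q)" .
  qed (use D in auto)
  have 2: "AE \<omega> in M. (\<lambda>k. ((\<Sum>i\<in>{(Suc k)\<^sup>2<..(Suc (Suc k))\<^sup>2}. \<bar>Y i \<omega>\<bar>) / real ((Suc k)\<^sup>2))\<^sup>2) \<longlonglongrightarrow> 0"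
  proof (rule AE_tendsto_zero_if_summable_expectations[OF _ _ _ sc[of "9 * D"]])
    fix k
    let ?q = "real ((Suc k)\<^sup>2)" and ?I = "{(Suc k)\<^sup>2<..(Suc (Suc k))\<^sup>2}"
    define l where "l = 2 * Suc k + 1"
    have cI: "card ?I = l" by (simp add: l_def power2_eq_square)
    have "(\<integral>\<^sup>+\<omega>. ennreal (((\<Sum>i\<in>?I. \<bar>Y i \<omega>\<bar>) / ?q)\<^sup>2) \<partial>M)
        \<le> (\<integral>\<^sup>+\<omega>. ennreal (real l / ?q\<^sup>2) * (\<Sum>i\<in>?I. ennreal ((Y i \<omega>)\<^sup>2)) \<partial>M)"
    proof (intro nn_integral_mono)
      fix \<omega>
      have "((\<Sum>i\<in>?I. \<bar>Y i \<omega>\<bar>) / ?q)\<^sup>2 = (\<Sum>i\<in>?I. \<bar>Y i \<omega>\<bar>)\<^sup>2 / ?q\<^sup>2" by (simp only: power_divide)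
      also have "\<dots> \<le> ((\<Sum>i\<in>?I. (Y i \<omega>)\<^sup>2) * real l) / ?q\<^sup>2"
        using sum_squared_le_sum_of_squares[of "\<lambda>i. \<bar>Y i \<omega>\<bar>" ?I] unfolding cI power2_abs
        by (rule divide_right_mono) simp
      also have "\<dots> = real l / ?q\<^sup>2 * (\<Sum>i\<in>?I. (Y i \<omega>)\<^sup>2)" by simp
      finally show "ennreal (((\<Sum>i\<in>?I. \<bar>Y i \<omega>\<bar>) / ?q)\<^sup>2) \<le> ennreal (real l / ?q\<^sup>2) * (\<Sum>i\<in>?I. ennreal ((Y i \<omega>)\<^sup>2))"
        by (subst sum_ennreal) (auto simp: ennreal_mult[symmetric] sum_nonneg intro!: ennreal_leI)
    qed
    also have "\<dots> = ennreal (real l / ?q\<^sup>2) * (\<Sum>i\<in>?I. \<integral>\<^sup>+\<omega>. ennreal ((Y i \<omega>)\<^sup>2) \<partial>M)"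
      by (subst nn_integral_cmult, measurable) (subst nn_integral_sum, measurable)
    also have "\<dots> \<le> ennreal (real l / ?q\<^sup>2) * (\<Sum>i\<in>?I. ennreal D)"
      by (intro mult_left_mono sum_mono sq) auto
    also have "(\<Sum>i\<in>?I. ennreal D) = ennreal (real l * D)"
      using D unfolding sum_constant cI by (simp add: ennreal_mult ennreal_of_nat_eq_real_of_nat)
    also have "ennreal (real l / ?q\<^sup>2) * ennreal (real l * D) = ennreal (D * ((real l)\<^sup>2 / ?q\<^sup>2))"
      using D by (subst ennreal_mult[symmetric]) (auto simp: power2_eq_square mult_ac)
    also have "\<dots> \<le> ennreal (9 * D / ?q)"
    proof (rule ennreal_leI)
      have cancel: "9 * q / q\<^sup>2 = 9 / q" for q :: real by (simp add: power2_eq_square)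
      have "real l \<le> 3 * real (Suc k)" by (simp add: l_def)
      then have "(real l)\<^sup>2 \<le> (3 * real (Suc k))\<^sup>2" by (intro power_mono) auto
      also have "\<dots> = 9 * ?q" by (simp only: power_mult_distrib of_nat_power) simp
      finally have "(real l)\<^sup>2 / ?q\<^sup>2 \<le> 9 * ?q / ?q\<^sup>2" by (rule divide_right_mono) simp
      also have "\<dots> = 9 / ?q" by (rule cancel)
      finally have "D * ((real l)\<^sup>2 / ?q\<^sup>2) \<le> D * (9 / ?q)" using D by (rule mult_left_mono)
      then show "D * ((real l)\<^sup>2 / ?q\<^sup>2) \<le> 9 * D / ?q" by (simp add: mult.commute)
    qed
    finally show "(\<integral>\<^sup>+\<omega>. ennreal (((\<Sum>i\<in>?I. \<bar>Y i \<omega>\<bar>) / ?q)\<^sup>2) \<partial>M) \<le> ennreal (9 * D / ?q)" .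
  qed (use D in auto)
  show ?thesis
    using 1 2 by eventually_elim (rule average_tendsto_zero_from_squares)
qed

section \<open>Transport distances and iterated kernels\<close>

text \<open>The easy half of Kantorovich duality. The cost may fail to be measurable, in which case constants cannot
be moved across its integral; so \<open>L\<close> is kept on the side of \<open>h\<close>, and the cost is only compared by
monotonicity.\<close>

lemma transport_dist_lipschitz:
  fixes h :: "'a::{second_countable_topology, t2_space} \<Rightarrow> real"
  assumes s1: "sets \<nu>1 = sets borel" and i1: "integrable \<nu>1 h" and i2: "integrable \<nu>2 h"
    and h[measurable]: "h \<in> borel_measurable borel" and L: "0 < L"
    and lip: "\<And>x y. ennreal (\<bar>h x - h y\<bar> / L) \<le> ennreal (c x y)"
  shows "ennreal (\<bar>(\<integral>x. h x \<partial>\<nu>1) - (\<integral>x. h x \<partial>\<nu>2)\<bar> / L) \<le> transport_dist c \<nu>1 \<nu>2"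
  unfolding transport_dist_def
proof (rule INF_greatest)
  fix \<pi> assume "\<pi> \<in> couplings \<nu>1 \<nu>2"
  then have s[measurable_cong]: "sets \<pi> = sets (borel \<Otimes>\<^sub>M borel)"
    and d: "distr \<pi> borel fst = \<nu>1" "distr \<pi> borel snd = \<nu>2"
    by (auto simp: couplings_def)
  have mf: "fst \<in> \<pi> \<rightarrow>\<^sub>M borel" "snd \<in> \<pi> \<rightarrow>\<^sub>M borel" by measurable
  have if1: "integrable \<pi> (\<lambda>z. h (fst z))" "integrable \<pi> (\<lambda>z. h (snd z))"
    using i1 i2 unfolding d[symmetric] by (simp_all add: integrable_distr_eq mf)
  have "(\<integral>x. h x \<partial>\<nu>1) - (\<integral>x. h x \<partial>\<nu>2) = (\<integral>z. h (fst z) \<partial>\<pi>) - (\<integral>z. h (snd z) \<partial>\<pi>)"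
    unfolding d[symmetric] by (simp add: integral_distr mf)
  also have "\<dots> = (\<integral>z. h (fst z) - h (snd z) \<partial>\<pi>)"
    using if1 by simp
  finally have "\<bar>(\<integral>x. h x \<partial>\<nu>1) - (\<integral>x. h x \<partial>\<nu>2)\<bar> \<le> (\<integral>z. \<bar>h (fst z) - h (snd z)\<bar> \<partial>\<pi>)"
    by simp
  then have "\<bar>(\<integral>x. h x \<partial>\<nu>1) - (\<integral>x. h x \<partial>\<nu>2)\<bar> / L \<le> (\<integral>z. \<bar>h (fst z) - h (snd z)\<bar> / L \<partial>\<pi>)"
    using L by (simp add: divide_right_mono)
  then have "ennreal (\<bar>(\<integral>x. h x \<partial>\<nu>1) - (\<integral>x. h x \<partial>\<nu>2)\<bar> / L) \<le> ennreal (\<integral>z. \<bar>h (fst z) - h (snd z)\<bar> / L \<partial>\<pi>)"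
    by (rule ennreal_leI)
  also have "\<dots> = (\<integral>\<^sup>+z. ennreal (\<bar>h (fst z) - h (snd z)\<bar> / L) \<partial>\<pi>)"
    using if1 L by (intro nn_integral_eq_integral[symmetric]) auto
  also have "\<dots> \<le> (\<integral>\<^sup>+(x, y). ennreal (c x y) \<partial>\<pi>)"
    by (intro nn_integral_mono) (auto simp: lip split: prod.split)
  finally show "ennreal (\<bar>(\<integral>x. h x \<partial>\<nu>1) - (\<integral>x. h x \<partial>\<nu>2)\<bar> / L) \<le> (\<integral>\<^sup>+(x, y). ennreal (c x y) \<partial>\<pi>)" .
qed

text \<open>The product measure is a coupling.\<close>

lemma transport_dist_le_product:
  fixes c :: "'a::topological_space \<Rightarrow> 'a \<Rightarrow> real"
  assumes p1: "prob_space \<nu>1" and p2: "prob_space \<nu>2"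
    and s1[measurable_cong]: "sets \<nu>1 = sets borel" and s2[measurable_cong]: "sets \<nu>2 = sets borel"
    and g1[measurable]: "g1 \<in> borel_measurable borel" and g2[measurable]: "g2 \<in> borel_measurable borel"
    and le: "\<And>x y. ennreal (c x y) \<le> g1 x + g2 y"
  shows "transport_dist c \<nu>1 \<nu>2 \<le> (\<integral>\<^sup>+x. g1 x \<partial>\<nu>1) + (\<integral>\<^sup>+x. g2 x \<partial>\<nu>2)"
proof -
  interpret p1: prob_space \<nu>1 by fact
  interpret p2: prob_space \<nu>2 by fact
  interpret P: pair_prob_space \<nu>1 \<nu>2 ..
  have d1: "distr (\<nu>1 \<Otimes>\<^sub>M \<nu>2) borel fst = \<nu>1"
  proof -
    have "distr (\<nu>1 \<Otimes>\<^sub>M \<nu>2) borel fst = distr (\<nu>1 \<Otimes>\<^sub>M \<nu>2) \<nu>1 fst"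
      by (rule distr_cong) (auto simp: s1)
    then show ?thesis by (simp add: p2.distr_pair_fst)
  qed
  have d2: "distr (\<nu>1 \<Otimes>\<^sub>M \<nu>2) borel snd = \<nu>2"
  proof (rule measure_eqI)
    fix A assume "A \<in> sets (distr (\<nu>1 \<Otimes>\<^sub>M \<nu>2) borel snd)"
    then have A[measurable]: "A \<in> sets borel" by simp
    have "emeasure (distr (\<nu>1 \<Otimes>\<^sub>M \<nu>2) borel snd) A = emeasure (\<nu>1 \<Otimes>\<^sub>M \<nu>2) (snd -` A \<inter> space (\<nu>1 \<Otimes>\<^sub>M \<nu>2))"
      by (rule emeasure_distr) measurable
    also have "snd -` A \<inter> space (\<nu>1 \<Otimes>\<^sub>M \<nu>2) = space \<nu>1 \<times> A"
      using sets_eq_imp_space_eq[OF s1] sets_eq_imp_space_eq[OF s2] by (auto simp: space_pair_measure)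
    also have "emeasure (\<nu>1 \<Otimes>\<^sub>M \<nu>2) (space \<nu>1 \<times> A) = emeasure \<nu>2 A"
      by (subst p2.emeasure_pair_measure_Times) (auto simp: p1.emeasure_space_1 s2)
    finally show "emeasure (distr (\<nu>1 \<Otimes>\<^sub>M \<nu>2) borel snd) A = emeasure \<nu>2 A" .
  qed (simp add: s2)
  have "\<nu>1 \<Otimes>\<^sub>M \<nu>2 \<in> couplings \<nu>1 \<nu>2"
    using d1 d2 s1 s2 by (auto simp: couplings_def intro!: sets_pair_measure_cong)
  then have "transport_dist c \<nu>1 \<nu>2 \<le> (\<integral>\<^sup>+(x, y). ennreal (c x y) \<partial>(\<nu>1 \<Otimes>\<^sub>M \<nu>2))"
    unfolding transport_dist_def by (rule INF_lower)
  also have "\<dots> \<le> (\<integral>\<^sup>+(x, y). g1 x + g2 y \<partial>(\<nu>1 \<Otimes>\<^sub>M \<nu>2))"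
    by (intro nn_integral_mono) (auto simp: le split: prod.split)
  also have "\<dots> = (\<integral>\<^sup>+x. \<integral>\<^sup>+y. g1 x + g2 y \<partial>\<nu>2 \<partial>\<nu>1)"
    by (subst p2.nn_integral_fst[symmetric]) auto
  also have "\<dots> = (\<integral>\<^sup>+x. g1 x \<partial>\<nu>1) + (\<integral>\<^sup>+x. g2 x \<partial>\<nu>2)"
    by (simp add: nn_integral_add p1.emeasure_space_1 p2.emeasure_space_1)
  finally show ?thesis .
qed

locale markov_kernel =
  fixes K :: "'a::topological_space \<Rightarrow> 'a measure"
  assumes kernel_borel_measurable [measurable]: "K \<in> borel \<rightarrow>\<^sub>M subprob_algebra borel"
    and kernel_prob: "prob_space (K x)"
begin

text \<open>The action of the kernel on nonnegative functions, dual to its action on measures.\<close>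

definition kernel_op :: "('a \<Rightarrow> ennreal) \<Rightarrow> 'a \<Rightarrow> ennreal" where
  "kernel_op f x = (\<integral>\<^sup>+y. f y \<partial>K x)"

lemma kernel_op_measurable [measurable]:
  "f \<in> borel_measurable borel \<Longrightarrow> kernel_op f \<in> borel_measurable borel"
  unfolding kernel_op_def[abs_def]
  by (rule measurable_compose[OF kernel_borel_measurable nn_integral_measurable_subprob_algebra])

lemma kernel_op_funpow_measurable [measurable]:
  "f \<in> borel_measurable borel \<Longrightarrow> (kernel_op ^^ n) f \<in> borel_measurable borel"
  by (induction n) auto

lemma kernel_iter_0: "kernel_iter K 0 \<nu> = \<nu>"
  by (simp add: kernel_iter_def)

lemma kernel_iter_Suc: "kernel_iter K (Suc n) \<nu> = bind (kernel_iter K n \<nu>) K"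
  by (simp add: kernel_iter_def)

lemma kernel_iter_add: "kernel_iter K (m + n) \<nu> = kernel_iter K m (kernel_iter K n \<nu>)"
  by (simp add: kernel_iter_def funpow_add)

lemma kernel_measurable_sets: "sets \<nu> = sets borel \<Longrightarrow> K \<in> \<nu> \<rightarrow>\<^sub>M subprob_algebra borel"
  using kernel_borel_measurable by (simp cong: measurable_cong_sets)

lemma sets_bind_kernel: "sets \<nu> = sets borel \<Longrightarrow> sets (bind \<nu> K) = sets borel"
  using sets_bind[of \<nu> K borel] sets_kernel[OF kernel_borel_measurable] sets_eq_imp_space_eq[of \<nu> borel] by auto

lemma sets_kernel_iter: "sets \<nu> = sets borel \<Longrightarrow> sets (kernel_iter K n \<nu>) = sets borel"
  by (induction n) (auto simp: kernel_iter_0 kernel_iter_Suc sets_bind_kernel)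

lemma prob_space_kernel_iter:
  assumes "prob_space \<nu>" "sets \<nu> = sets borel"
  shows "prob_space (kernel_iter K n \<nu>)"
proof (induction n)
  case 0 then show ?case using assms by (simp add: kernel_iter_0)
next
  case (Suc n)
  then interpret prob_space "kernel_iter K n \<nu>" .
  show ?case unfolding kernel_iter_Suc
    by (rule prob_space_bind[where S = borel]) (auto simp: kernel_prob kernel_measurable_sets sets_kernel_iter assms)
qed

lemma nn_integral_bind_kernel:
  assumes "sets \<nu> = sets borel" "f \<in> borel_measurable borel"
  shows "(\<integral>\<^sup>+y. f y \<partial>bind \<nu> K) = (\<integral>\<^sup>+x. kernel_op f x \<partial>\<nu>)"
  unfolding kernel_op_def by (rule nn_integral_bind[OF assms(2) kernel_measurable_sets[OF assms(1)]])

lemma nn_integral_kernel_iter: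
  assumes "sets \<nu> = sets borel" "f \<in> borel_measurable borel"
  shows "(\<integral>\<^sup>+y. f y \<partial>kernel_iter K n \<nu>) = (\<integral>\<^sup>+x. (kernel_op ^^ n) f x \<partial>\<nu>)"
  using assms(2)
proof (induction n arbitrary: f)
  case 0 then show ?case by (simp add: kernel_iter_0)
next
  case (Suc n)
  have "(\<integral>\<^sup>+y. f y \<partial>kernel_iter K (Suc n) \<nu>) = (\<integral>\<^sup>+x. kernel_op f x \<partial>kernel_iter K n \<nu>)"
    unfolding kernel_iter_Suc by (rule nn_integral_bind_kernel[OF sets_kernel_iter[OF assms(1)] Suc.prems])
  also have "\<dots> = (\<integral>\<^sup>+x. (kernel_op ^^ n) (kernel_op f) x \<partial>\<nu>)"
    by (rule Suc.IH) (rule kernel_op_measurable[OF Suc.prems])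
  finally show ?case by (simp add: funpow_swap1)
qed

lemma nn_integral_kernel_iter_return:
  assumes "f \<in> borel_measurable borel"
  shows "(\<integral>\<^sup>+y. f y \<partial>kernel_iter K n (return borel x)) = (kernel_op ^^ n) f x"
  using assms by (simp add: nn_integral_kernel_iter nn_integral_return kernel_op_funpow_measurable)

text \<open>The Chapman-Kolmogorov identity for signed integrands, from the nonnegative case applied to the
positive and the negative part. Integrability under every \<open>\<delta>\<^sub>x \<P>\<^sup>n\<close> excludes \<open>\<infinity> - \<infinity>\<close> in the inner
integral.\<close>

lemma integral_kernel_iter:
  fixes f :: "'a \<Rightarrow> real"
  assumes s[measurable_cong]: "sets \<nu> = sets borel" and f[measurable]: "f \<in> borel_measurable borel"
    and i: "integrable (kernel_iter K n \<nu>) f" and ix: "\<And>x. integrable (kernel_iter K n (return borel x)) f"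
  shows "(\<integral>y. f y \<partial>kernel_iter K n \<nu>) = (\<integral>x. (\<integral>y. f y \<partial>kernel_iter K n (return borel x)) \<partial>\<nu>)"
    and "integrable \<nu> (\<lambda>x. \<integral>y. f y \<partial>kernel_iter K n (return borel x))"
proof -
  define P where "P = (\<lambda>x. (kernel_op ^^ n) (\<lambda>y. ennreal (f y)) x)"
  define N where "N = (\<lambda>x. (kernel_op ^^ n) (\<lambda>y. ennreal (- f y)) x)"
  have m[measurable]: "P \<in> borel_measurable borel" "N \<in> borel_measurable borel"
    unfolding P_def N_def by measurable
  have fin: "P x \<noteq> \<infinity>" "N x \<noteq> \<infinity>" for x
    using ix[of x] unfolding real_integrable_def P_def N_def by (auto simp: nn_integral_kernel_iter_return)
  have fin': "(\<integral>\<^sup>+x. P x \<partial>\<nu>) \<noteq> \<infinity>" "(\<integral>\<^sup>+x. N x \<partial>\<nu>) \<noteq> \<infinity>"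
    using i unfolding real_integrable_def P_def N_def by (auto simp: nn_integral_kernel_iter s)
  have e: "ennreal (enn2real (P x)) = P x" "ennreal (enn2real (N x)) = N x" for x
    using fin[of x] by (auto simp: less_top)
  have iP: "integrable \<nu> (\<lambda>x. enn2real (P x))" and iN: "integrable \<nu> (\<lambda>x. enn2real (N x))"
    using fin' by (auto intro!: integrableI_nonneg simp: e less_top)
  have u: "(\<integral>y. f y \<partial>kernel_iter K n (return borel x)) = enn2real (P x) - enn2real (N x)" for x
    unfolding P_def N_def by (simp add: real_lebesgue_integral_def[OF ix] nn_integral_kernel_iter_return)
  show "integrable \<nu> (\<lambda>x. \<integral>y. f y \<partial>kernel_iter K n (return borel x))"
    unfolding u using iP iN by simp
  have "(\<integral>y. f y \<partial>kernel_iter K n \<nu>) = enn2real (\<integral>\<^sup>+x. P x \<partial>\<nu>) - enn2real (\<integral>\<^sup>+x. N x \<partial>\<nu>)"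
    unfolding P_def N_def by (simp add: real_lebesgue_integral_def[OF i] nn_integral_kernel_iter s)
  also have "\<dots> = (\<integral>x. enn2real (P x) \<partial>\<nu>) - (\<integral>x. enn2real (N x) \<partial>\<nu>)"
    by (subst (1 2) integral_eq_nn_integral) (auto simp: e)
  also have "\<dots> = (\<integral>x. (\<integral>y. f y \<partial>kernel_iter K n (return borel x)) \<partial>\<nu>)"
    unfolding u using iP iN by simp
  finally show "(\<integral>y. f y \<partial>kernel_iter K n \<nu>) = (\<integral>x. (\<integral>y. f y \<partial>kernel_iter K n (return borel x)) \<partial>\<nu>)" .
qed

text \<open>The affine map \<open>s \<mapsto> l s + b\<close> sends \<open>{..C}\<close> into itself as soon as \<open>C\<close> is at least its fixed point
\<open>b / (1 - l)\<close>.\<close>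

lemma drift_kernel_iter:
  assumes V[measurable]: "V \<in> borel_measurable borel" and V0: "\<And>x. 0 \<le> V x"
    and l: "0 \<le> l" "l < 1" and b: "0 \<le> b"
    and drift: "\<And>x. (\<integral>\<^sup>+y. ennreal (V y) \<partial>K x) \<le> ennreal (l * V x + b)"
    and s: "sets \<nu> = sets borel" and p: "prob_space \<nu>"
    and C: "(\<integral>\<^sup>+x. ennreal (V x) \<partial>\<nu>) \<le> ennreal C" "b / (1 - l) \<le> C"
  shows "(\<integral>\<^sup>+x. ennreal (V x) \<partial>kernel_iter K n \<nu>) \<le> ennreal C"
proof (induction n)
  case 0 then show ?case using C by (simp add: kernel_iter_0)
next
  case (Suc n)
  have sn[measurable_cong]: "sets (kernel_iter K n \<nu>) = sets borel" by (rule sets_kernel_iter[OF s])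
  interpret prob_space "kernel_iter K n \<nu>" by (rule prob_space_kernel_iter[OF p s])
  have C0: "0 \<le> C" using C(2) b l by (meson diff_ge_0_iff_ge divide_nonneg_nonneg less_imp_le order_trans)
  have "(\<integral>\<^sup>+x. ennreal (V x) \<partial>kernel_iter K (Suc n) \<nu>) = (\<integral>\<^sup>+x. kernel_op (\<lambda>y. ennreal (V y)) x \<partial>kernel_iter K n \<nu>)"
    unfolding kernel_iter_Suc by (rule nn_integral_bind_kernel[OF sn]) measurable
  also have "\<dots> \<le> (\<integral>\<^sup>+x. ennreal l * ennreal (V x) + ennreal b \<partial>kernel_iter K n \<nu>)"
    using drift l b V0 by (intro nn_integral_mono) (simp add: kernel_op_def ennreal_mult)
  also have "\<dots> = ennreal l * (\<integral>\<^sup>+x. ennreal (V x) \<partial>kernel_iter K n \<nu>) + ennreal b"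
    by (simp add: nn_integral_add nn_integral_cmult emeasure_space_1)
  also have "\<dots> \<le> ennreal l * ennreal C + ennreal b"
    by (intro add_right_mono mult_left_mono Suc.IH) simp
  also have "\<dots> = ennreal (l * C + b)" using l b C0 by (simp add: ennreal_mult)
  also have "\<dots> \<le> ennreal C"
    using C(2) l by (intro ennreal_leI) (simp add: pos_divide_le_eq algebra_simps)
  finally show ?case .
qed

text \<open>Integrating the drift inequality against an invariant measure would give \<open>(1 - l) \<nu>(V) \<le> b\<close> if \<open>\<nu>(V)\<close> were
known to be finite. Truncating \<open>V\<close> at level \<open>m\<close> makes all terms finite, so that cancellation is legitimate, and
then \<open>m\<close> tends to infinity.\<close>

lemma invariant_drift_finite:
  assumes V[measurable]: "V \<in> borel_measurable borel" and V0: "\<And>x. 0 \<le> V x"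
    and l: "0 \<le> l" "l < 1" and b: "0 \<le> b"
    and drift: "\<And>x. (\<integral>\<^sup>+y. ennreal (V y) \<partial>K x) \<le> ennreal (l * V x + b)"
    and s[measurable_cong]: "sets \<nu> = sets borel" and p: "prob_space \<nu>" and inv: "bind \<nu> K = \<nu>"
  shows "(\<integral>\<^sup>+x. ennreal (V x) \<partial>\<nu>) < \<infinity>"
proof -
  interpret prob_space \<nu> by fact
  define f where "f = (\<lambda>(m::nat) x. ennreal ((1 - l) * V x) * indicator {x. V x \<le> real m} x)"
  have fm[measurable]: "f m \<in> borel_measurable borel" for m unfolding f_def by measurable
  have bound: "(\<integral>\<^sup>+x. f m x \<partial>\<nu>) \<le> ennreal b" for m
  proof -
    define A where "A = (\<integral>\<^sup>+x. ennreal (min (l * V x + b) (real m)) \<partial>\<nu>)"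
    \<comment> \<open>Finiteness of A is what permits cancelling it below.\<close>
    have "A \<le> (\<integral>\<^sup>+x. ennreal (real m) \<partial>\<nu>)" unfolding A_def by (intro nn_integral_mono ennreal_leI) simp
    then have Afin: "A \<noteq> \<infinity>" by (auto simp: emeasure_space_1 top_unique)
    have "(\<integral>\<^sup>+x. ennreal (min (V x) (real m)) \<partial>\<nu>) = (\<integral>\<^sup>+x. kernel_op (\<lambda>y. ennreal (min (V y) (real m))) x \<partial>\<nu>)"
      by (subst (1) inv[symmetric]) (rule nn_integral_bind_kernel[OF s], measurable)
    also have "\<dots> \<le> A" unfolding A_def
    proof (intro nn_integral_mono)
      fix x
      interpret Kx: prob_space "K x" by (rule kernel_prob)
      have "kernel_op (\<lambda>y. ennreal (min (V y) (real m))) x \<le> ennreal (l * V x + b)"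
        unfolding kernel_op_def by (rule order_trans[OF nn_integral_mono drift]) (simp add: ennreal_leI)
      moreover have "kernel_op (\<lambda>y. ennreal (min (V y) (real m))) x \<le> (\<integral>\<^sup>+y. ennreal (real m) \<partial>K x)"
        unfolding kernel_op_def by (intro nn_integral_mono ennreal_leI) simp
      ultimately show "kernel_op (\<lambda>y. ennreal (min (V y) (real m))) x \<le> ennreal (min (l * V x + b) (real m))"
        using Kx.emeasure_space_1 by (auto simp: min_def)
    qed
    finally have le: "(\<integral>\<^sup>+x. ennreal (min (V x) (real m)) \<partial>\<nu>) \<le> A" .
    have "(\<integral>\<^sup>+x. f m x \<partial>\<nu>) + A = (\<integral>\<^sup>+x. f m x + ennreal (min (l * V x + b) (real m)) \<partial>\<nu>)"
      unfolding A_def by (rule nn_integral_add[symmetric]) measurable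
    also have "\<dots> \<le> (\<integral>\<^sup>+x. ennreal (min (V x) (real m)) + ennreal b \<partial>\<nu>)"
    proof (intro nn_integral_mono)
      fix x
      have lV: "0 \<le> l * V x" using l V0[of x] by simp
      show "f m x + ennreal (min (l * V x + b) (real m)) \<le> ennreal (min (V x) (real m)) + ennreal b"
      proof (cases "V x \<le> real m")
        case True
        have "(1 - l) * V x + min (l * V x + b) (real m) \<le> min (V x) (real m) + b"
          using True by (simp add: algebra_simps min_def)
        then show ?thesis
          using True l b V0[of x] lV by (simp add: f_def ennreal_plus[symmetric] ennreal_leI del: ennreal_plus)
      next
        case False
        then show ?thesis
          using b lV by (simp add: f_def ennreal_plus[symmetric] ennreal_leI del: ennreal_plus)
      qed
    qed
    also have "\<dots> = (\<integral>\<^sup>+x. ennreal (min (V x) (real m)) \<partial>\<nu>) + ennreal b"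
      by (simp add: nn_integral_add emeasure_space_1)
    also have "\<dots> \<le> A + ennreal b" by (rule add_right_mono[OF le])
    finally have "A + (\<integral>\<^sup>+x. f m x \<partial>\<nu>) \<le> A + ennreal b" by (simp add: add.commute)
    then show ?thesis using Afin by (simp add: ennreal_add_left_cancel_le)
  qed
  have "ennreal ((1 - l) * V x) \<le> (SUP m. f m x)" for x
  proof -
    obtain m where "V x \<le> real m" using real_arch_simple by blast
    then have "ennreal ((1 - l) * V x) = f m x" by (simp add: f_def)
    then show ?thesis using SUP_upper[of m UNIV "\<lambda>m. f m x"] by simp
  qed
  then have "(\<integral>\<^sup>+x. ennreal ((1 - l) * V x) \<partial>\<nu>) \<le> (\<integral>\<^sup>+x. (SUP m. f m x) \<partial>\<nu>)"
    by (intro nn_integral_mono) auto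
  also have "\<dots> = (SUP m. \<integral>\<^sup>+x. f m x \<partial>\<nu>)"
  proof (rule nn_integral_monotone_convergence_SUP)
    show "incseq f"
      by (auto simp: incseq_def le_fun_def f_def indicator_def)
  qed measurable
  also have "\<dots> \<le> ennreal b" by (rule SUP_least) (rule bound)
  finally have le: "ennreal (1 - l) * (\<integral>\<^sup>+x. ennreal (V x) \<partial>\<nu>) \<le> ennreal b"
    using l V0 by (simp add: ennreal_mult nn_integral_cmult)
  show ?thesis
  proof (rule ccontr)
    assume "\<not> ?thesis"
    then have "(\<integral>\<^sup>+x. ennreal (V x) \<partial>\<nu>) = \<top>" by (metis infinity_ennreal_def less_top)
    with le l show False by (simp add: ennreal_mult_top top_unique)
  qed
qed

end

section \<open>Markov chains and contraction towards the invariant measure\<close>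

lemma sets_natural_filtration:
  "sets (natural_filtration M X n) = sigma_sets (space M) {X i -` A \<inter> space M | i A. i \<le> n \<and> A \<in> sets borel}"
  unfolding natural_filtration_def by (rule sets_measure_of) auto

lemma space_natural_filtration: "space (natural_filtration M X n) = space M"
  unfolding natural_filtration_def by (rule space_measure_of) auto

lemma natural_filtration_mono: "m \<le> n \<Longrightarrow> sets (natural_filtration M X m) \<subseteq> sets (natural_filtration M X n)"
  unfolding sets_natural_filtration by (rule sigma_sets_mono') (auto intro: order_trans)

lemma natural_filtration_subalgebra:
  assumes "\<And>n. X n \<in> borel_measurable M"
  shows "subalgebra M (natural_filtration M X n)"
  unfolding subalgebra_def space_natural_filtration sets_natural_filtration
  using assms by (auto intro!: sets.sigma_sets_subset measurable_sets)

lemma natural_filtration_measurable: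
  "i \<le> n \<Longrightarrow> X i \<in> natural_filtration M X n \<rightarrow>\<^sub>M borel"
  by (intro measurableI) (auto simp: space_natural_filtration sets_natural_filtration intro!: sigma_sets.Basic)

context markov_kernel
begin

text \<open>The Markov property, restricted to an event \<open>B\<close> of the past instead of conditioned on the past: the
sub-probability law of the chain on \<open>B\<close> is propagated by the kernel. In this form the one-step property
iterates directly.\<close>

lemma markov_chain_law:
  assumes chain: "markov_chain M K x0 X" and B: "B \<in> sets (natural_filtration M X m)"
  shows "distr (density M (\<lambda>\<omega>. ennreal (indicator B \<omega>))) borel (X (m + n))
    = kernel_iter K n (distr (density M (\<lambda>\<omega>. ennreal (indicator B \<omega>))) borel (X m))"
proof (induction n)
  case 0 show ?case by (simp add: kernel_iter_0)
next
  case (Suc n)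
  have pM: "prob_space M" and X[measurable]: "\<And>n. X n \<in> borel_measurable M"
    and ce: "\<And>n A. A \<in> sets borel \<Longrightarrow> AE \<omega> in M. real_cond_exp M (natural_filtration M X n) (\<lambda>\<omega>'. indicator A (X (Suc n) \<omega>')) \<omega>
          = measure (K (X n \<omega>)) A"
    using chain by (auto simp: markov_chain_def)
  interpret prob_space M by fact
  let ?k = "m + n" and ?F = "natural_filtration M X (m + n)"
  interpret finite_measure_subalgebra M ?F
    by unfold_locales (rule natural_filtration_subalgebra[OF X])
  let ?MB = "density M (\<lambda>\<omega>. ennreal (indicator B \<omega>))"
  have BF: "B \<in> sets ?F" using B natural_filtration_mono[of m ?k M X] by auto
  then have BM[measurable]: "B \<in> sets M" using subalg by (auto simp: subalgebra_def)
  have "distr ?MB borel (X (Suc ?k)) = bind (distr ?MB borel (X ?k)) K"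
  proof (rule measure_eqI)
    show "sets (distr ?MB borel (X (Suc ?k))) = sets (bind (distr ?MB borel (X ?k)) K)"
      by (simp add: sets_bind_kernel)
    fix A assume "A \<in> sets (distr ?MB borel (X (Suc ?k)))"
    then have A[measurable]: "A \<in> sets borel" by simp
    have km[measurable]: "(\<lambda>x. measure (K x) A) \<in> borel_measurable borel"
      by (rule measure_measurable_subprob_algebra2[OF _ kernel_borel_measurable]) simp
    have kem[measurable]: "(\<lambda>x. emeasure (K x) A) \<in> borel_measurable borel"
      by (rule emeasure_measurable_subprob_algebra2[OF _ kernel_borel_measurable]) simp
    have ek: "emeasure (K x) A = ennreal (measure (K x) A)" for x
    proof -
      interpret Kx: prob_space "K x" by (rule kernel_prob)
      show ?thesis by (rule Kx.emeasure_eq_measure)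
    qed
    have k1: "measure (K x) A \<le> 1" for x
    proof -
      interpret Kx: prob_space "K x" by (rule kernel_prob)
      show ?thesis by (rule Kx.prob_le_1)
    qed
    have i1: "integrable M (\<lambda>\<omega>. indicator A (X (Suc ?k) \<omega>) :: real)"
      by (rule integrable_const_bound[where B = 1]) (auto simp: indicator_def)
    have i2: "integrable M (\<lambda>\<omega>. indicator B \<omega> * indicator A (X (Suc ?k) \<omega>) :: real)"
      by (rule integrable_const_bound[where B = 1]) (auto simp: indicator_def)
    have i3: "integrable M (\<lambda>\<omega>. indicator B \<omega> * measure (K (X ?k \<omega>)) A)"
      by (rule integrable_const_bound[where B = 1]) (auto simp: indicator_def k1)
    have "emeasure (distr ?MB borel (X (Suc ?k))) A = (\<integral>\<^sup>+x. indicator A x \<partial>distr ?MB borel (X (Suc ?k)))"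
      by simp
    also have "\<dots> = (\<integral>\<^sup>+\<omega>. indicator A (X (Suc ?k) \<omega>) \<partial>?MB)"
      by (rule nn_integral_distr) measurable
    also have "\<dots> = (\<integral>\<^sup>+\<omega>. ennreal (indicator B \<omega>) * indicator A (X (Suc ?k) \<omega>) \<partial>M)"
      by (rule nn_integral_density) measurable
    also have "\<dots> = (\<integral>\<^sup>+\<omega>. ennreal (indicator B \<omega> * indicator A (X (Suc ?k) \<omega>)) \<partial>M)"
      by (intro nn_integral_cong) (auto simp: indicator_def)
    also have "\<dots> = ennreal (\<integral>\<omega>. indicator B \<omega> * indicator A (X (Suc ?k) \<omega>) \<partial>M)"
      by (rule nn_integral_eq_integral[OF i2]) simp
    also have "(\<integral>\<omega>. indicator B \<omega> * indicator A (X (Suc ?k) \<omega>) \<partial>M) = (\<integral>\<omega>. indicator B \<omega> * measure (K (X ?k \<omega>)) A \<partial>M)"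
    proof -
      have "(\<integral>\<omega>. indicator B \<omega> * indicator A (X (Suc ?k) \<omega>) \<partial>M) =
        (\<integral>\<omega>\<in>B. real_cond_exp M ?F (\<lambda>\<omega>'. indicator A (X (Suc ?k) \<omega>')) \<omega> \<partial>M)"
        using real_cond_exp_intA[OF i1 BF] by (simp add: set_lebesgue_integral_def)
      also have "\<dots> = (\<integral>\<omega>. indicator B \<omega> * measure (K (X ?k \<omega>)) A \<partial>M)"
        unfolding set_lebesgue_integral_def using ce[OF A, of ?k]
        by (intro integral_cong_AE) auto
      finally show ?thesis .
    qed
    also have "ennreal (\<integral>\<omega>. indicator B \<omega> * measure (K (X ?k \<omega>)) A \<partial>M) = (\<integral>\<^sup>+\<omega>. ennreal (indicator B \<omega> * measure (K (X ?k \<omega>)) A) \<partial>M)"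
      by (rule nn_integral_eq_integral[OF i3, symmetric]) simp
    also have "\<dots> = (\<integral>\<^sup>+\<omega>. ennreal (indicator B \<omega>) * emeasure (K (X ?k \<omega>)) A \<partial>M)"
      by (simp add: ek ennreal_mult)
    also have "\<dots> = (\<integral>\<^sup>+\<omega>. emeasure (K (X ?k \<omega>)) A \<partial>?MB)"
      by (rule nn_integral_density[symmetric]) measurable
    also have "\<dots> = (\<integral>\<^sup>+x. emeasure (K x) A \<partial>distr ?MB borel (X ?k))"
      by (rule nn_integral_distr[symmetric]) measurable
    also have "\<dots> = emeasure (bind (distr ?MB borel (X ?k)) K) A"
      by (rule emeasure_bind[symmetric, where N = borel]) (auto simp: not_empty kernel_measurable_sets)
    finally show "emeasure (distr ?MB borel (X (Suc ?k))) A = emeasure (bind (distr ?MB borel (X ?k)) K) A" .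
  qed
  then show ?case unfolding kernel_iter_Suc Suc.IH[symmetric] by simp
qed

lemma markov_chain_distr:
  assumes chain: "markov_chain M K x0 X"
  shows "distr M borel (X n) = kernel_iter K n (return borel x0)"
proof -
  have pM: "prob_space M" and X[measurable]: "\<And>n. X n \<in> borel_measurable M" and X0: "AE \<omega> in M. X 0 \<omega> = x0"
    using chain by (auto simp: markov_chain_def)
  interpret prob_space M by fact
  have "density M (\<lambda>\<omega>. ennreal (indicator (space M) \<omega>)) = density M (\<lambda>_. 1)"
    by (rule density_cong) auto
  then have M: "density M (\<lambda>\<omega>. ennreal (indicator (space M) \<omega>)) = M" by (simp add: density_1)
  have "space M \<in> sets (natural_filtration M X 0)"
    using sets.top[of "natural_filtration M X 0"] by (simp add: space_natural_filtration)
  from markov_chain_law[OF chain this, of n] have "distr M borel (X n) = kernel_iter K n (distr M borel (X 0))"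
    by (simp add: M)
  also have "distr M borel (X 0) = distr M borel (\<lambda>_. x0)"
    by (rule distr_cong_AE) (auto simp: X0)
  finally show ?thesis by simp
qed

end

text \<open>The properties of the pCN kernel on which the law of large numbers rests: a Lyapunov function, an invariant
probability measure, and a transport cost that some iterate of the kernel halves.\<close>

locale contracting_kernel = markov_kernel K
  for K :: "'a::{second_countable_topology, t2_space} \<Rightarrow> 'a measure" +
  fixes V :: "'a \<Rightarrow> real" and l b :: real and \<nu> :: "'a measure" and c :: "'a \<Rightarrow> 'a \<Rightarrow> real"
  assumes V_measurable [measurable]: "V \<in> borel_measurable borel" and V_nonneg: "0 \<le> V x"
    and l: "0 \<le> l" "l < 1" and b: "0 \<le> b"
    and drift: "(\<integral>\<^sup>+y. ennreal (V y) \<partial>K x) \<le> ennreal (l * V x + b)"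
    and sets_inv [measurable_cong]: "sets \<nu> = sets borel" and prob_inv: "prob_space \<nu>" and inv: "bind \<nu> K = \<nu>"
    and halving: "eventually_halving c K"
    and cost_le: "c x y \<le> sqrt (1 + V x + V y)"
begin

text \<open>The fixed point of the drift inequality.\<close>

definition "B = b / (1 - l)"

lemma B_nonneg: "0 \<le> B"
  using l b by (simp add: B_def)

lemma kernel_iter_inv: "kernel_iter K n \<nu> = \<nu>"
  by (induction n) (simp_all add: kernel_iter_0 kernel_iter_Suc inv)

lemma V_inv_finite: "(\<integral>\<^sup>+x. ennreal (V x) \<partial>\<nu>) < \<infinity>"
  by (rule invariant_drift_finite[OF V_measurable V_nonneg l b drift sets_inv prob_inv inv])

lemma V_kernel_iter: "(\<integral>\<^sup>+y. ennreal (V y) \<partial>kernel_iter K n (return borel x)) \<le> ennreal (V x + B)"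
  using V_nonneg[of x] l
  by (intro drift_kernel_iter[OF V_measurable V_nonneg l b drift])
    (auto simp: prob_space_return nn_integral_return B_nonneg ennreal_leI B_def[symmetric])

lemma integrable_if_sqrt_growth:
  assumes s[measurable_cong]: "sets \<kappa> = sets borel" and p: "prob_space \<kappa>"
    and fin: "(\<integral>\<^sup>+x. ennreal (V x) \<partial>\<kappa>) < \<infinity>"
    and f[measurable]: "f \<in> borel_measurable borel" and growth: "\<And>x. \<bar>f x\<bar> \<le> A * sqrt (1 + V x)" and A: "0 \<le> A"
  shows "integrable \<kappa> (f :: 'a \<Rightarrow> real)"
proof -
  interpret prob_space \<kappa> by fact
  have iV: "integrable \<kappa> V"
    using fin V_nonneg by (intro integrableI_nonneg) auto
  show ?thesis
  proof (rule Bochner_Integration.integrable_bound)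
    show "integrable \<kappa> (\<lambda>x. A * (1 + V x))" using iV by simp
    have "sqrt (1 + V x) \<le> 1 + V x" for x
      using V_nonneg[of x] by (intro real_le_lsqrt) (auto simp: power2_eq_square algebra_simps)
    then have "\<bar>f x\<bar> \<le> A * (1 + V x)" for x
      using order_trans[OF growth mult_left_mono[OF _ A]] by blast
    then show "AE x in \<kappa>. norm (f x) \<le> norm (A * (1 + V x))"
      using A V_nonneg by (auto simp: abs_mult)
  qed measurable
qed

text \<open>Jensen's inequality for the square root, proved by integrating the tangent line at \<open>1 + C\<close>.\<close>

lemma sqrt_moment:
  assumes s[measurable_cong]: "sets \<kappa> = sets borel" and p: "prob_space \<kappa>"
    and C: "(\<integral>\<^sup>+x. ennreal (V x) \<partial>\<kappa>) \<le> ennreal C" "0 \<le> C"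
  shows "(\<integral>\<^sup>+x. ennreal (sqrt (1 + V x)) \<partial>\<kappa>) \<le> ennreal (sqrt (1 + C))"
proof -
  interpret prob_space \<kappa> by fact
  define q where "q = sqrt (1 + C)"
  have q: "0 < q" "q\<^sup>2 = 1 + C" using C(2) by (simp_all add: q_def)
  have pt: "sqrt (1 + V x) \<le> (q / 2 + 1 / (2 * q)) + 1 / (2 * q) * V x" for x
  proof -
    define r where "r = sqrt (1 + V x)"
    have r: "r\<^sup>2 = 1 + V x" using V_nonneg[of x] by (simp add: r_def)
    have "0 \<le> (r - q)\<^sup>2" by simp
    then have "r * (2 * q) \<le> q\<^sup>2 + r\<^sup>2" by (simp add: power2_diff algebra_simps)
    then have "r \<le> (q\<^sup>2 + r\<^sup>2) / (2 * q)" using q by (simp add: pos_le_divide_eq)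
    also have "\<dots> = (q / 2 + 1 / (2 * q)) + 1 / (2 * q) * V x"
      unfolding r using q by (simp add: field_simps power2_eq_square)
    finally show ?thesis by (simp add: r_def)
  qed
  have "(\<integral>\<^sup>+x. ennreal (sqrt (1 + V x)) \<partial>\<kappa>) \<le> (\<integral>\<^sup>+x. ennreal (q / 2 + 1 / (2 * q)) + ennreal (1 / (2 * q)) * ennreal (V x) \<partial>\<kappa>)"
  proof (intro nn_integral_mono)
    fix x
    have "ennreal (sqrt (1 + V x)) \<le> ennreal ((q / 2 + 1 / (2 * q)) + 1 / (2 * q) * V x)"
      by (rule ennreal_leI[OF pt])
    also have "\<dots> = ennreal (q / 2 + 1 / (2 * q)) + ennreal (1 / (2 * q) * V x)"
      using q V_nonneg[of x] by (intro ennreal_plus) auto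
    also have "ennreal (1 / (2 * q) * V x) = ennreal (1 / (2 * q)) * ennreal (V x)"
      using q V_nonneg[of x] by (intro ennreal_mult) auto
    finally show "ennreal (sqrt (1 + V x)) \<le> ennreal (q / 2 + 1 / (2 * q)) + ennreal (1 / (2 * q)) * ennreal (V x)" .
  qed
  also have "\<dots> = ennreal (q / 2 + 1 / (2 * q)) + ennreal (1 / (2 * q)) * (\<integral>\<^sup>+x. ennreal (V x) \<partial>\<kappa>)"
    by (simp add: nn_integral_add nn_integral_cmult emeasure_space_1)
  also have "\<dots> \<le> ennreal (q / 2 + 1 / (2 * q)) + ennreal (1 / (2 * q)) * ennreal C"
    by (intro add_left_mono mult_left_mono C) simp
  also have "\<dots> = ennreal ((q / 2 + 1 / (2 * q)) + 1 / (2 * q) * C)"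
    using q C by (simp add: ennreal_mult[symmetric] ennreal_plus[symmetric] del: ennreal_plus)
  also have "(q / 2 + 1 / (2 * q)) + 1 / (2 * q) * C = q"
  proof -
    have "(q / 2 + 1 / (2 * q)) + 1 / (2 * q) * C = q / 2 + (1 + C) / (2 * q)" by (simp add: add_divide_distrib)
    also have "\<dots> = q" unfolding q(2)[symmetric] using q(1) by (simp add: power2_eq_square)
    finally show ?thesis .
  qed
  finally show ?thesis by (simp add: q_def)
qed

lemma halving_iterated:
  "\<exists>N. \<forall>k \<nu>1 \<nu>2. prob_space \<nu>1 \<longrightarrow> sets \<nu>1 = sets borel \<longrightarrow> prob_space \<nu>2 \<longrightarrow> sets \<nu>2 = sets borel \<longrightarrow>
    transport_dist c (kernel_iter K (k * N) \<nu>1) (kernel_iter K (k * N) \<nu>2) \<le> ennreal ((1/2) ^ k) * transport_dist c \<nu>1 \<nu>2"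
proof -
  from halving obtain N where N: "\<And>\<nu>1 \<nu>2. prob_space \<nu>1 \<Longrightarrow> sets \<nu>1 = sets borel \<Longrightarrow> prob_space \<nu>2 \<Longrightarrow> sets \<nu>2 = sets borel \<Longrightarrow>
    transport_dist c (kernel_iter K N \<nu>1) (kernel_iter K N \<nu>2) \<le> transport_dist c \<nu>1 \<nu>2 / 2"
    unfolding eventually_halving_def by blast
  have half: "x / 2 = ennreal (1/2) * x" for x :: ennreal
  proof -
    have "ennreal (1/2) = inverse 2"
      using divide_ennreal[of 1 2] by (simp add: divide_ennreal_def)
    then show ?thesis by (simp add: divide_ennreal_def mult.commute)
  qed
  have "transport_dist c (kernel_iter K (k * N) \<nu>1) (kernel_iter K (k * N) \<nu>2) \<le> ennreal ((1/2) ^ k) * transport_dist c \<nu>1 \<nu>2"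
    if a: "prob_space \<nu>1" "sets \<nu>1 = sets borel" "prob_space \<nu>2" "sets \<nu>2 = sets borel" for k \<nu>1 \<nu>2
  proof (induction k)
    case 0 then show ?case by (simp add: kernel_iter_0)
  next
    case (Suc k)
    have "transport_dist c (kernel_iter K (Suc k * N) \<nu>1) (kernel_iter K (Suc k * N) \<nu>2)
      \<le> transport_dist c (kernel_iter K (k * N) \<nu>1) (kernel_iter K (k * N) \<nu>2) / 2"
      using N[OF prob_space_kernel_iter[OF a(1,2)] sets_kernel_iter[OF a(2)] prob_space_kernel_iter[OF a(3,4)] sets_kernel_iter[OF a(4)], of "k * N" "k * N"]
      by (simp add: kernel_iter_add)
    also have "\<dots> \<le> ennreal (1/2) * (ennreal ((1/2) ^ k) * transport_dist c \<nu>1 \<nu>2)"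
      unfolding half by (rule mult_left_mono[OF Suc.IH]) simp
    also have "\<dots> = ennreal ((1/2) ^ Suc k) * transport_dist c \<nu>1 \<nu>2"
    proof -
      have "ennreal ((1/2) ^ Suc k) = ennreal (1/2) * ennreal ((1/2) ^ k)"
        unfolding power_Suc by (rule ennreal_mult) auto
      then show ?thesis by (simp only: mult.assoc)
    qed
    finally show ?case .
  qed
  then show ?thesis by blast
qed

lemma summable_half_power_div: "0 < N \<Longrightarrow> summable (\<lambda>n. (1/2::real) ^ (n div N))"
proof -
  assume N: "0 < N"
  define \<theta> where "\<theta> = root N (1/2)"
  have th: "0 < \<theta>" "\<theta> < 1" "\<theta> ^ N = 1/2" using N by (auto simp: \<theta>_def real_root_lt_1_iff)
  have "(1/2) ^ (n div N) \<le> 2 * \<theta> ^ n" for n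
  proof -
    have "n \<le> N * (n div N) + N"
      using mult_div_mod_eq[of N n] mod_less_divisor[OF N, of n] by linarith
    then have "\<theta> ^ (N * (n div N) + N) \<le> \<theta> ^ n" using th by (intro power_decreasing) auto
    then show ?thesis by (simp add: power_add power_mult th(3))
  qed
  then show ?thesis
    using th by (intro summable_comparison_test'[OF summable_mult[OF summable_geometric[of \<theta>], of 2]]) auto
qed

text \<open>Write \<open>n = k N + j\<close> with \<open>j < N\<close>, where the \<open>N\<close>-th iterate halves the cost. Since \<open>\<nu>\<close> is invariant, the transport
distance of \<open>\<delta>\<^sub>x \<P>\<^sup>n\<close> and \<open>\<nu>\<close> is at most \<open>2 ^ (- k)\<close> times that of \<open>\<delta>\<^sub>x \<P>\<^sup>j\<close> and \<open>\<nu>\<close>, which the product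
coupling bounds by moments of \<open>sqrt (1 + V)\<close>, uniformly in \<open>j\<close>.\<close>

lemma expectation_decay:
  fixes h :: "'a \<Rightarrow> real"
  assumes h[measurable]: "h \<in> borel_measurable borel" and L: "0 < L"
    and lip: "\<And>x y. ennreal (\<bar>h x - h y\<bar> / L) \<le> ennreal (c x y)"
    and growth: "\<And>x. \<bar>h x\<bar> \<le> A * sqrt (1 + V x)" and A: "0 \<le> A"
  shows "\<exists>\<beta>. summable \<beta> \<and> (\<forall>n. 0 \<le> \<beta> n) \<and>
    (\<forall>n x. \<bar>(\<integral>y. h y \<partial>kernel_iter K n (return borel x)) - (\<integral>y. h y \<partial>\<nu>)\<bar> \<le> \<beta> n * sqrt (1 + V x))"
proof -
  from halving_iterated obtain N where N: "\<forall>k \<nu>1 \<nu>2. prob_space \<nu>1 \<longrightarrow> sets \<nu>1 = sets borel \<longrightarrow> prob_space \<nu>2 \<longrightarrow> sets \<nu>2 = sets borel \<longrightarrow>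
    transport_dist c (kernel_iter K (k * N) \<nu>1) (kernel_iter K (k * N) \<nu>2) \<le> ennreal ((1/2) ^ k) * transport_dist c \<nu>1 \<nu>2" ..
  obtain m where m: "0 \<le> m" "(\<integral>\<^sup>+x. ennreal (V x) \<partial>\<nu>) = ennreal m"
    using V_inv_finite by (cases "\<integral>\<^sup>+x. ennreal (V x) \<partial>\<nu>") auto
  define C where "C = L * (sqrt (1 + B) + sqrt (1 + m))"
  have C0: "0 \<le> C" using L B_nonneg m by (simp add: C_def)
  have pr: "prob_space (kernel_iter K n (return borel x))" and sr: "sets (kernel_iter K n (return borel x)) = sets borel" for n x
    by (auto intro!: prob_space_kernel_iter sets_kernel_iter prob_space_return)
  have step: "\<bar>(\<integral>y. h y \<partial>kernel_iter K (k * N + j) (return borel x)) - (\<integral>y. h y \<partial>\<nu>)\<bar> \<le> C * (1/2) ^ k * sqrt (1 + V x)" for k j x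
  proof -
    let ?W = "sqrt (1 + V x)"
    have W: "1 \<le> ?W" using V_nonneg[of x] by simp
    let ?\<kappa> = "kernel_iter K j (return borel x)"
    have ih: "integrable (kernel_iter K (k * N + j) (return borel x)) h"
      by (rule integrable_if_sqrt_growth[OF sr pr _ h growth A]) (rule le_less_trans[OF V_kernel_iter], simp)
    have i\<nu>: "integrable \<nu> h"
      by (rule integrable_if_sqrt_growth[OF sets_inv prob_inv V_inv_finite h growth A])
    have "ennreal (\<bar>(\<integral>y. h y \<partial>kernel_iter K (k * N + j) (return borel x)) - (\<integral>y. h y \<partial>\<nu>)\<bar> / L)
      \<le> transport_dist c (kernel_iter K (k * N + j) (return borel x)) \<nu>"
      by (rule transport_dist_lipschitz[OF sr ih i\<nu> h L lip])
    also have "\<dots> = transport_dist c (kernel_iter K (k * N) ?\<kappa>) (kernel_iter K (k * N) \<nu>)"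
      by (simp add: kernel_iter_add kernel_iter_inv)
    also have "\<dots> \<le> ennreal ((1/2) ^ k) * transport_dist c ?\<kappa> \<nu>"
      by (rule N[rule_format, OF pr sr prob_inv sets_inv])
    also have "transport_dist c ?\<kappa> \<nu> \<le> (\<integral>\<^sup>+y. ennreal (sqrt (1 + V y)) \<partial>?\<kappa>) + (\<integral>\<^sup>+y. ennreal (sqrt (1 + V y)) \<partial>\<nu>)"
    proof (rule transport_dist_le_product[OF pr prob_inv sr sets_inv])
      fix y z
      have "sqrt (1 + V y + V z) \<le> sqrt (1 + V y) + sqrt (V z)"
        using V_nonneg by (intro sqrt_add_le_add_sqrt) (auto simp: add_nonneg_nonneg)
      also have "\<dots> \<le> sqrt (1 + V y) + sqrt (1 + V z)" by simp
      finally have "c y z \<le> sqrt (1 + V y) + sqrt (1 + V z)" using cost_le[of y z] by simp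
      then show "ennreal (c y z) \<le> ennreal (sqrt (1 + V y)) + ennreal (sqrt (1 + V z))"
        using V_nonneg[of y] V_nonneg[of z] by (simp add: ennreal_plus[symmetric] ennreal_leI del: ennreal_plus)
    qed measurable
    also have "\<dots> \<le> ennreal (sqrt (1 + (V x + B))) + ennreal (sqrt (1 + m))"
      using V_nonneg[of x] B_nonneg m
      by (intro add_mono sqrt_moment[OF sr pr] sqrt_moment[OF sets_inv prob_inv] V_kernel_iter) auto
    also have "\<dots> \<le> ennreal ((sqrt (1 + B) + sqrt (1 + m)) * ?W)"
    proof -
      have "1 + (V x + B) \<le> (1 + B) * (1 + V x)" using mult_nonneg_nonneg[OF B_nonneg V_nonneg[of x]] by (simp add: algebra_simps)
      then have "sqrt (1 + (V x + B)) \<le> sqrt (1 + B) * ?W" by (simp add: real_sqrt_mult[symmetric])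
      moreover have "sqrt (1 + m) \<le> sqrt (1 + m) * ?W"
        using mult_left_mono[OF W, of "sqrt (1 + m)"] m by simp
      ultimately have "sqrt (1 + (V x + B)) + sqrt (1 + m) \<le> (sqrt (1 + B) + sqrt (1 + m)) * ?W"
        unfolding distrib_right by (rule add_mono)
      then show ?thesis
        using m V_nonneg[of x] B_nonneg by (simp add: ennreal_plus[symmetric] ennreal_leI del: ennreal_plus)
    qed
    finally have "ennreal (\<bar>(\<integral>y. h y \<partial>kernel_iter K (k * N + j) (return borel x)) - (\<integral>y. h y \<partial>\<nu>)\<bar> / L)
      \<le> ennreal ((1/2) ^ k) * ennreal ((sqrt (1 + B) + sqrt (1 + m)) * ?W)"
      by (simp add: mult_left_mono)
    also have "\<dots> = ennreal ((1/2) ^ k * ((sqrt (1 + B) + sqrt (1 + m)) * ?W))"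
      by (subst ennreal_mult) (use m V_nonneg[of x] B_nonneg in auto)
    finally have "\<bar>(\<integral>y. h y \<partial>kernel_iter K (k * N + j) (return borel x)) - (\<integral>y. h y \<partial>\<nu>)\<bar> / L
      \<le> (1/2) ^ k * ((sqrt (1 + B) + sqrt (1 + m)) * ?W)"
      by (subst (asm) ennreal_le_iff) (use m V_nonneg[of x] B_nonneg in auto)
    then show ?thesis
      using L by (simp add: pos_divide_le_eq C_def mult_ac)
  qed
  show ?thesis
  proof (cases "N = 0")
    \<comment> \<open>If N = 0, the cost of any two measures at finite cost vanishes, so the bound holds for every k
      and the difference is 0.\<close>
    case True
    have "\<bar>(\<integral>y. h y \<partial>kernel_iter K n (return borel x)) - (\<integral>y. h y \<partial>\<nu>)\<bar> \<le> 0" for n x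
    proof (rule LIMSEQ_le_const)
      have "(\<lambda>k. (C * sqrt (1 + V x)) * (1/2) ^ k) \<longlonglongrightarrow> (C * sqrt (1 + V x)) * 0"
        by (intro tendsto_mult tendsto_const LIMSEQ_realpow_zero) auto
      then show "(\<lambda>k. C * (1/2) ^ k * sqrt (1 + V x)) \<longlonglongrightarrow> 0" by (simp add: mult_ac)
      show "\<exists>N. \<forall>k\<ge>N. \<bar>(\<integral>y. h y \<partial>kernel_iter K n (return borel x)) - (\<integral>y. h y \<partial>\<nu>)\<bar> \<le> C * (1/2) ^ k * sqrt (1 + V x)"
        using step[of _ n x] True by simp
    qed
    then show ?thesis by (intro exI[of _ "\<lambda>_. 0"]) auto
  next
    case False
    show ?thesis
    proof (intro exI[of _ "\<lambda>n. C * (1/2) ^ (n div N)"] conjI allI)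
      show "summable (\<lambda>n. C * (1/2) ^ (n div N))"
        using summable_half_power_div[of N] False by (intro summable_mult) auto
      show "0 \<le> C * (1/2) ^ (n div N)" for n using C0 by simp
      show "\<bar>(\<integral>y. h y \<partial>kernel_iter K n (return borel x)) - (\<integral>y. h y \<partial>\<nu>)\<bar> \<le> C * (1/2) ^ (n div N) * sqrt (1 + V x)" for n x
        using step[of "n div N" "n mod N" x] by simp
    qed
  qed
qed

end

section \<open>Covariances and the law of large numbers for a contracting kernel\<close>

text \<open>The index \<open>(i - j) + (j - i)\<close> is the distance of two natural numbers.\<close>

lemma sum_abs_diff_le_suminf:
  fixes \<beta> :: "nat \<Rightarrow> real"
  assumes "summable \<beta>" "\<And>n. 0 \<le> \<beta> n"
  shows "(\<Sum>j=1..n. \<beta> ((i - j) + (j - i))) \<le> 2 * (\<Sum>k. \<beta> k)"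
proof -
  have le: "sum g F \<le> (\<Sum>k. \<beta> k)" if "finite F" "inj_on p F" "\<And>j. j \<in> F \<Longrightarrow> g j = \<beta> (p j)" for p :: "nat \<Rightarrow> nat" and g F
  proof -
    have "sum g F = sum \<beta> (p ` F)" using that by (simp add: sum.reindex)
    also have "\<dots> \<le> (\<Sum>k. \<beta> k)" using that assms by (intro sum_le_suminf) auto
    finally show ?thesis .
  qed
  let ?g = "\<lambda>j. \<beta> ((i - j) + (j - i))"
  have "sum ?g {1..n} = sum ?g ({1..n} \<inter> {..i}) + sum ?g ({1..n} \<inter> {i<..})"
    by (subst sum.union_disjoint[symmetric]) (auto intro!: sum.cong)
  also have "sum ?g ({1..n} \<inter> {..i}) \<le> (\<Sum>k. \<beta> k)"
    by (rule le[where p = "\<lambda>j. i - j"]) (auto simp: inj_on_def)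
  also have "sum ?g ({1..n} \<inter> {i<..}) \<le> (\<Sum>k. \<beta> k)"
    by (rule le[where p = "\<lambda>j. j - i"]) (auto simp: inj_on_def)
  finally show ?thesis by simp
qed

context contracting_kernel
begin

lemma chain_V_moment:
  assumes chain: "markov_chain M K x0 X"
  shows "integrable M (\<lambda>\<omega>. V (X i \<omega>))" and "(\<integral>\<omega>. V (X i \<omega>) \<partial>M) \<le> V x0 + B"
proof -
  have X[measurable]: "\<And>n. X n \<in> borel_measurable M"
    using chain by (auto simp: markov_chain_def)
  have "(\<integral>\<^sup>+\<omega>. ennreal (V (X i \<omega>)) \<partial>M) = (\<integral>\<^sup>+x. ennreal (V x) \<partial>distr M borel (X i))"
    by (rule nn_integral_distr[symmetric]) measurable
  also have "\<dots> \<le> ennreal (V x0 + B)"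
    unfolding markov_chain_distr[OF chain] by (rule V_kernel_iter)
  finally have le: "(\<integral>\<^sup>+\<omega>. ennreal (V (X i \<omega>)) \<partial>M) \<le> ennreal (V x0 + B)" .
  then show i: "integrable M (\<lambda>\<omega>. V (X i \<omega>))"
    using V_nonneg by (intro integrableI_nonneg) (auto intro: le_less_trans)
  have "ennreal (\<integral>\<omega>. V (X i \<omega>) \<partial>M) \<le> ennreal (V x0 + B)"
    using le V_nonneg by (subst nn_integral_eq_integral[OF i, symmetric]) auto
  then show "(\<integral>\<omega>. V (X i \<omega>) \<partial>M) \<le> V x0 + B"
    using V_nonneg[of x0] B_nonneg by (subst (asm) ennreal_le_iff) auto
qed

text \<open>Conditioning on the past up to time \<open>i\<close> replaces \<open>f (X\<^sub>i\<^sub>+\<^sub>n)\<close> by the expectation of \<open>f\<close> after \<open>n\<close> steps from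
\<open>X\<^sub>i\<close>, which is small by assumption.\<close>

lemma chain_covariance:
  fixes f :: "'a \<Rightarrow> real"
  assumes chain: "markov_chain M K x0 X" and f[measurable]: "f \<in> borel_measurable borel"
    and growth: "\<And>x. \<bar>f x\<bar> \<le> A * sqrt (1 + V x)" and A: "0 \<le> A"
    and decay: "\<And>n x. \<bar>\<integral>y. f y \<partial>kernel_iter K n (return borel x)\<bar> \<le> \<beta> n * sqrt (1 + V x)"
    and \<beta>: "\<And>n. 0 \<le> \<beta> n"
  shows "integrable M (\<lambda>\<omega>. f (X i \<omega>) * f (X j \<omega>))"
    and "(\<integral>\<omega>. (f (X i \<omega>))\<^sup>2 \<partial>M) \<le> A\<^sup>2 * (1 + (V x0 + B))"
    and "\<bar>\<integral>\<omega>. f (X i \<omega>) * f (X (i + n) \<omega>) \<partial>M\<bar> \<le> A * \<beta> n * (1 + (V x0 + B))"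
proof -
  have pM: "prob_space M" and X[measurable]: "\<And>n. X n \<in> borel_measurable M"
    using chain by (auto simp: markov_chain_def)
  interpret prob_space M by fact
  note iV = chain_V_moment(1)[OF chain] and mV = chain_V_moment(2)[OF chain]
  have sqW: "sqrt (1 + V x) * sqrt (1 + V x) = 1 + V x" for x
    using V_nonneg[of x] by simp
  have f2: "(f x)\<^sup>2 \<le> A\<^sup>2 * (1 + V x)" for x
  proof -
    have "(f x)\<^sup>2 = \<bar>f x\<bar>\<^sup>2" by simp
    also have "\<dots> \<le> (A * sqrt (1 + V x))\<^sup>2" by (rule power_mono[OF growth]) simp
    also have "\<dots> = A\<^sup>2 * (1 + V x)" using V_nonneg[of x] by (simp add: power_mult_distrib)
    finally show ?thesis .
  qed
  have ib: "integrable M (\<lambda>\<omega>. A\<^sup>2 * (1 + V (X i \<omega>)))" for i using iV[of i] by simp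
  have if2: "integrable M (\<lambda>\<omega>. (f (X i \<omega>))\<^sup>2)" for i
    by (rule Bochner_Integration.integrable_bound[OF ib[of i]]) (auto intro!: order_trans[OF f2])
  show iff: "integrable M (\<lambda>\<omega>. f (X i \<omega>) * f (X j \<omega>))" for i j
  proof (rule Bochner_Integration.integrable_bound)
    show "integrable M (\<lambda>\<omega>. (f (X i \<omega>))\<^sup>2 + (f (X j \<omega>))\<^sup>2)" using if2 by simp
    have "\<bar>u * v\<bar> \<le> u\<^sup>2 + v\<^sup>2" for u v :: real
    proof -
      have "0 \<le> (\<bar>u\<bar> - \<bar>v\<bar>)\<^sup>2" by simp
      then have "2 * \<bar>u * v\<bar> \<le> u\<^sup>2 + v\<^sup>2" by (simp add: power2_diff abs_mult)
      then show ?thesis by simp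
    qed
    then show "AE \<omega> in M. norm (f (X i \<omega>) * f (X j \<omega>)) \<le> norm ((f (X i \<omega>))\<^sup>2 + (f (X j \<omega>))\<^sup>2)" by simp
  qed measurable
  have "(\<integral>\<omega>. (f (X i \<omega>))\<^sup>2 \<partial>M) \<le> (\<integral>\<omega>. A\<^sup>2 * (1 + V (X i \<omega>)) \<partial>M)"
    by (intro integral_mono if2 ib f2)
  also have "\<dots> = A\<^sup>2 * (1 + (\<integral>\<omega>. V (X i \<omega>) \<partial>M))" using iV[of i] by (simp add: prob_space)
  also have "\<dots> \<le> A\<^sup>2 * (1 + (V x0 + B))" using mV[of i] by (intro mult_left_mono add_left_mono) auto
  finally show "(\<integral>\<omega>. (f (X i \<omega>))\<^sup>2 \<partial>M) \<le> A\<^sup>2 * (1 + (V x0 + B))" .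
  let ?F = "natural_filtration M X i"
  interpret F: finite_measure_subalgebra M ?F
    by unfold_locales (rule natural_filtration_subalgebra[OF X])
  define u where "u = (\<lambda>x. \<integral>y. f y \<partial>kernel_iter K n (return borel x))"
  have ix: "integrable (kernel_iter K n (return borel x)) f" for x
    by (rule integrable_if_sqrt_growth[OF sets_kernel_iter prob_space_kernel_iter _ f growth A])
      (auto simp: prob_space_return intro: le_less_trans[OF V_kernel_iter])
  have ifX: "integrable M (\<lambda>\<omega>. f (X k \<omega>))" for k
    by (rule square_integrable_imp_integrable[OF _ if2]) measurable
  have law: "(\<integral>\<omega>\<in>D. f (X (i + n) \<omega>) \<partial>M) = (\<integral>\<omega>\<in>D. u (X i \<omega>) \<partial>M)
      \<and> u \<in> borel_measurable borel \<and> integrable M (\<lambda>\<omega>. indicator D \<omega> * u (X i \<omega>))" if D: "D \<in> sets ?F" for D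
  proof -
    have DM[measurable]: "D \<in> sets M" using D F.subalg by (auto simp: subalgebra_def)
    let ?MD = "density M (\<lambda>\<omega>. ennreal (indicator D \<omega>))"
    let ?\<nu> = "distr ?MD borel (X i)"
    have nu: "distr ?MD borel (X (i + n)) = kernel_iter K n ?\<nu>" by (rule markov_chain_law[OF chain D])
    have "integrable M (\<lambda>\<omega>. indicator D \<omega> *\<^sub>R f (X (i + n) \<omega>))"
      by (rule integrable_mult_indicator[OF DM ifX])
    then have iD: "integrable (kernel_iter K n ?\<nu>) f"
      unfolding nu[symmetric] by (subst integrable_distr_eq) (auto simp: integrable_density)
    note k = integral_kernel_iter[OF _ f iD ix, folded u_def]
    have um[measurable]: "u \<in> borel_measurable borel"
      using k(2) by (auto dest: borel_measurable_integrable)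
    have "(\<integral>\<omega>\<in>D. f (X (i + n) \<omega>) \<partial>M) = (\<integral>\<omega>. f (X (i + n) \<omega>) \<partial>?MD)"
      unfolding set_lebesgue_integral_def by (rule integral_density[symmetric]) auto
    also have "\<dots> = (\<integral>x. f x \<partial>kernel_iter K n ?\<nu>)"
      unfolding nu[symmetric] by (rule integral_distr[symmetric]) auto
    also have "\<dots> = (\<integral>x. u x \<partial>?\<nu>)" by (rule k(1)) simp
    also have "\<dots> = (\<integral>\<omega>. u (X i \<omega>) \<partial>?MD)" by (rule integral_distr) auto
    also have "\<dots> = (\<integral>\<omega>\<in>D. u (X i \<omega>) \<partial>M)"
      unfolding set_lebesgue_integral_def by (rule integral_density) auto
    finally have 1: "(\<integral>\<omega>\<in>D. f (X (i + n) \<omega>) \<partial>M) = (\<integral>\<omega>\<in>D. u (X i \<omega>) \<partial>M)" .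
    have "integrable ?\<nu> u" by (rule k(2)) simp
    then have "integrable ?MD (\<lambda>\<omega>. u (X i \<omega>))" by (subst (asm) integrable_distr_eq) auto
    then have "integrable M (\<lambda>\<omega>. indicator D \<omega> *\<^sub>R u (X i \<omega>))" by (subst (asm) integrable_density) auto
    then show ?thesis using 1 um by simp
  qed
  have top: "space M \<in> sets ?F"
    using sets.top[of ?F] by (simp add: space_natural_filtration)
  have um[measurable]: "u \<in> borel_measurable borel" using law[OF top] by blast
  have "integrable M (\<lambda>\<omega>. indicator (space M) \<omega> * u (X i \<omega>)) \<longleftrightarrow> integrable M (\<lambda>\<omega>. u (X i \<omega>))"
    by (rule Bochner_Integration.integrable_cong) auto
  then have iu: "integrable M (\<lambda>\<omega>. u (X i \<omega>))" using law[OF top] by blast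
  have XF: "X i \<in> ?F \<rightarrow>\<^sub>M borel" by (rule natural_filtration_measurable) simp
  have ce: "AE \<omega> in M. real_cond_exp M ?F (\<lambda>\<omega>. f (X (i + n) \<omega>)) \<omega> = u (X i \<omega>)"
    using law by (intro F.real_cond_exp_charact ifX iu measurable_compose[OF XF um]) auto
  have "(\<integral>\<omega>. f (X i \<omega>) * f (X (i + n) \<omega>) \<partial>M) = (\<integral>\<omega>. f (X i \<omega>) * real_cond_exp M ?F (\<lambda>\<omega>. f (X (i + n) \<omega>)) \<omega> \<partial>M)"
    by (rule F.real_cond_exp_intg(2)[symmetric]) (auto intro: iff measurable_compose[OF XF f])
  also have "\<dots> = (\<integral>\<omega>. f (X i \<omega>) * u (X i \<omega>) \<partial>M)"
    using ce by (intro integral_cong_AE) auto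
  finally have "\<bar>\<integral>\<omega>. f (X i \<omega>) * f (X (i + n) \<omega>) \<partial>M\<bar> \<le> (\<integral>\<omega>. \<bar>f (X i \<omega>) * u (X i \<omega>)\<bar> \<partial>M)"
    by simp
  also have "\<dots> \<le> (\<integral>\<omega>. A * \<beta> n * (1 + V (X i \<omega>)) \<partial>M)"
  proof (rule integral_mono_AE')
    have "\<bar>f x * u x\<bar> \<le> A * \<beta> n * (1 + V x)" for x
    proof -
      have "\<bar>f x * u x\<bar> \<le> (A * sqrt (1 + V x)) * (\<beta> n * sqrt (1 + V x))"
        unfolding abs_mult u_def using A V_nonneg[of x] by (intro mult_mono growth decay) auto
      also have "\<dots> = A * \<beta> n * (sqrt (1 + V x) * sqrt (1 + V x))" by (simp only: mult_ac)
      finally show ?thesis unfolding sqW .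
    qed
    then show "AE \<omega> in M. \<bar>f (X i \<omega>) * u (X i \<omega>)\<bar> \<le> A * \<beta> n * (1 + V (X i \<omega>))" by simp
    show "integrable M (\<lambda>\<omega>. A * \<beta> n * (1 + V (X i \<omega>)))" using iV[of i] by simp
  qed (intro AE_I2 mult_nonneg_nonneg add_nonneg_nonneg A \<beta> V_nonneg zero_le_one)
  also have "\<dots> = A * \<beta> n * (1 + (\<integral>\<omega>. V (X i \<omega>) \<partial>M))" using iV[of i] by (simp add: prob_space)
  also have "\<dots> \<le> A * \<beta> n * (1 + (V x0 + B))" using mV[of i] A \<beta> by (intro mult_left_mono add_left_mono) auto
  finally show "\<bar>\<integral>\<omega>. f (X i \<omega>) * f (X (i + n) \<omega>) \<partial>M\<bar> \<le> A * \<beta> n * (1 + (V x0 + B))" .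
qed

text \<open>Expanding the square of the centred sum into covariances gives \<open>n\<close> rows, each bounded by
\<open>2 * (\<Sum>k. \<beta> k)\<close> up to a constant, hence a second moment of order \<open>n\<close>.\<close>

theorem strong_law_of_large_numbers:
  fixes h :: "'a \<Rightarrow> real"
  assumes chain: "markov_chain M K x0 X"
    and h[measurable]: "h \<in> borel_measurable borel" and L: "0 < L"
    and lip: "\<And>x y. ennreal (\<bar>h x - h y\<bar> / L) \<le> ennreal (c x y)"
    and growth: "\<And>x. \<bar>h x\<bar> \<le> A * sqrt (1 + V x)" and A: "0 \<le> A"
  shows "AE \<omega> in M. (\<lambda>n. (\<Sum>i=1..n. h (X i \<omega>)) / real n) \<longlonglongrightarrow> (\<integral>x. h x \<partial>\<nu>)"
proof -
  have X[measurable]: "\<And>n. X n \<in> borel_measurable M"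
    using chain by (auto simp: markov_chain_def)
  define e where "e = (\<integral>x. h x \<partial>\<nu>)"
  define f where "f = (\<lambda>x. h x - e)"
  \<comment> \<open>Centring h changes the growth constant by at most the absolute value of its mean.\<close>
  define A' where "A' = A + \<bar>e\<bar>"
  have f[measurable]: "f \<in> borel_measurable borel" unfolding f_def by measurable
  have W: "1 \<le> sqrt (1 + V x)" for x using V_nonneg[of x] by simp
  have fg: "\<bar>f x\<bar> \<le> A' * sqrt (1 + V x)" for x
  proof -
    have "\<bar>f x\<bar> \<le> \<bar>h x\<bar> + \<bar>e\<bar>" unfolding f_def by simp
    also have "\<dots> \<le> A * sqrt (1 + V x) + \<bar>e\<bar> * sqrt (1 + V x)"
      using mult_left_mono[OF W[of x], of "\<bar>e\<bar>"] by (intro add_mono growth) auto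
    finally show ?thesis by (simp add: A'_def distrib_right)
  qed
  have A': "0 \<le> A'" using A by (simp add: A'_def)
  obtain \<beta> where sb: "summable \<beta>" and b0: "\<And>n. 0 \<le> \<beta> n" and
    bd: "\<And>n x. \<bar>(\<integral>y. h y \<partial>kernel_iter K n (return borel x)) - e\<bar> \<le> \<beta> n * sqrt (1 + V x)"
    using expectation_decay[OF h L lip growth A] unfolding e_def by blast
  have dec: "\<bar>\<integral>y. f y \<partial>kernel_iter K n (return borel x)\<bar> \<le> \<beta> n * sqrt (1 + V x)" for n x
  proof -
    interpret P: prob_space "kernel_iter K n (return borel x)"
      by (rule prob_space_kernel_iter) (auto simp: prob_space_return)
    have "integrable (kernel_iter K n (return borel x)) h"
      by (rule integrable_if_sqrt_growth[OF sets_kernel_iter P.prob_space_axioms _ h growth A])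
        (auto intro: le_less_trans[OF V_kernel_iter])
    then have "(\<integral>y. f y \<partial>kernel_iter K n (return borel x)) = (\<integral>y. h y \<partial>kernel_iter K n (return borel x)) - e"
      unfolding f_def by (simp add: P.prob_space)
    then show ?thesis using bd by simp
  qed
  note cov = chain_covariance[OF chain f fg A' dec b0]
  define C where "C = 1 + (V x0 + B)"
  have C0: "0 \<le> C" using V_nonneg[of x0] B_nonneg by (simp add: C_def)
  define s where "s = (\<Sum>k. \<beta> k)"
  have s0: "0 \<le> s" unfolding s_def using sb b0 by (simp add: suminf_nonneg)
  define D where "D = A'\<^sup>2 * C + 2 * A' * C * s"
  have "AE \<omega> in M. (\<lambda>n. (\<Sum>i=1..n. f (X i \<omega>)) / real n) \<longlonglongrightarrow> 0"
  proof (rule strong_law_of_linear_variance)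
    show D0: "0 \<le> D" using A' C0 s0 by (simp add: D_def)
    show "(\<lambda>\<omega>. f (X n \<omega>)) \<in> borel_measurable M" for n by measurable
    fix n
    have "(\<integral>\<^sup>+\<omega>. ennreal ((f (X n \<omega>))\<^sup>2) \<partial>M) = ennreal (\<integral>\<omega>. (f (X n \<omega>))\<^sup>2 \<partial>M)"
      using cov(1)[of n n] by (intro nn_integral_eq_integral) (auto simp: power2_eq_square)
    also have "\<dots> \<le> ennreal D"
      using cov(2)[of n] A' C0 s0 by (intro ennreal_leI) (auto simp: D_def C_def intro: add_increasing2)
    finally show "(\<integral>\<^sup>+\<omega>. ennreal ((f (X n \<omega>))\<^sup>2) \<partial>M) \<le> ennreal D" .
    have sq: "(\<Sum>i=1..n. f (X i \<omega>))\<^sup>2 = (\<Sum>i=1..n. \<Sum>j=1..n. f (X i \<omega>) * f (X j \<omega>))" for \<omega>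
      by (simp add: power2_eq_square sum_product)
    have isq: "integrable M (\<lambda>\<omega>. (\<Sum>i=1..n. f (X i \<omega>))\<^sup>2)"
      unfolding sq by (intro Bochner_Integration.integrable_sum cov(1))
    have "(\<integral>\<omega>. (\<Sum>i=1..n. f (X i \<omega>))\<^sup>2 \<partial>M) = (\<Sum>i=1..n. \<Sum>j=1..n. \<integral>\<omega>. f (X i \<omega>) * f (X j \<omega>) \<partial>M)"
      unfolding sq by (simp add: Bochner_Integration.integral_sum Bochner_Integration.integrable_sum cov(1))
    also have "\<dots> \<le> (\<Sum>i=1..n. \<Sum>j=1..n. A' * C * \<beta> ((i - j) + (j - i)))"
    proof (intro sum_mono)
      fix i j
      show "(\<integral>\<omega>. f (X i \<omega>) * f (X j \<omega>) \<partial>M) \<le> A' * C * \<beta> ((i - j) + (j - i))"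
      proof (cases "i \<le> j")
        case True
        then show ?thesis using cov(3)[of i "j - i"] by (simp add: C_def mult_ac)
      next
        case False
        then show ?thesis using cov(3)[of j "i - j"] by (simp add: C_def mult_ac)
      qed
    qed
    also have "\<dots> = (\<Sum>i=1..n. A' * C * (\<Sum>j=1..n. \<beta> ((i - j) + (j - i))))"
      by (simp only: sum_distrib_left)
    also have "\<dots> \<le> (\<Sum>i=1..n. A' * C * (2 * s))"
      using A' C0 unfolding s_def by (intro sum_mono mult_left_mono sum_abs_diff_le_suminf sb b0) auto
    also have "\<dots> = 2 * A' * C * s * real n" by simp
    also have "\<dots> \<le> D * real n" using C0 by (intro mult_right_mono) (auto simp: D_def)
    finally have le: "(\<integral>\<omega>. (\<Sum>i=1..n. f (X i \<omega>))\<^sup>2 \<partial>M) \<le> D * real n" .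
    have "(\<integral>\<^sup>+\<omega>. ennreal ((\<Sum>i=1..n. f (X i \<omega>))\<^sup>2) \<partial>M) = ennreal (\<integral>\<omega>. (\<Sum>i=1..n. f (X i \<omega>))\<^sup>2 \<partial>M)"
      using isq by (intro nn_integral_eq_integral) auto
    with le show "(\<integral>\<^sup>+\<omega>. ennreal ((\<Sum>i=1..n. f (X i \<omega>))\<^sup>2) \<partial>M) \<le> ennreal (D * real n)"
      by (simp add: ennreal_leI)
  qed
  then show ?thesis
  proof (rule eventually_mono)
    fix \<omega> assume lim: "(\<lambda>n. (\<Sum>i=1..n. f (X i \<omega>)) / real n) \<longlonglongrightarrow> 0"
    have "eventually (\<lambda>n. (\<Sum>i=1..n. f (X i \<omega>)) / real n + e = (\<Sum>i=1..n. h (X i \<omega>)) / real n) sequentially"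
      using eventually_gt_at_top[of 0]
      by eventually_elim (simp add: f_def sum_subtractf diff_divide_distrib)
    moreover have "(\<lambda>n. (\<Sum>i=1..n. f (X i \<omega>)) / real n + e) \<longlonglongrightarrow> 0 + e"
      by (intro tendsto_add lim tendsto_const)
    ultimately show "(\<lambda>n. (\<Sum>i=1..n. h (X i \<omega>)) / real n) \<longlonglongrightarrow> (\<integral>x. h x \<partial>\<nu>)"
      unfolding e_def[symmetric] by (simp add: filterlim_cong)
  qed
qed

end

section \<open>The weights and distances of the two settings\<close>

text \<open>The properties of a radial profile that the drift condition asks for. The contraction constant is
\<open>q = 1 - \<theta> ^ i\<close>, which is positive for \<open>i > 0\<close>.\<close>

lemma polynomial_weight_properties:
  fixes \<gamma> :: "'a::{real_inner, polish_space} measure"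
  assumes g: "centred_gaussian \<gamma>" and i: "0 < i"
  defines "w \<equiv> \<lambda>s::real. s ^ i"
  shows "\<And>s t. 0 \<le> s \<Longrightarrow> s \<le> t \<Longrightarrow> w s \<le> w t" and "\<And>s. 0 \<le> s \<Longrightarrow> 0 \<le> w s"
    and "continuous_on UNIV w"
    and "\<And>c. 0 \<le> c \<Longrightarrow> (\<integral>\<^sup>+x. ennreal (w (c * norm x)) \<partial>\<gamma>) < \<infinity>"
    and "\<And>\<theta> R. 0 \<le> \<theta> \<Longrightarrow> \<theta> < 1 \<Longrightarrow> 0 < R \<Longrightarrow> \<exists>q. 0 < q \<and> q \<le> 1 \<and> (\<forall>s\<ge>R. w (\<theta> * s) \<le> (1 - q) * w s)"
proof -
  show "\<And>s t. 0 \<le> s \<Longrightarrow> s \<le> t \<Longrightarrow> w s \<le> w t" "\<And>s. 0 \<le> s \<Longrightarrow> 0 \<le> w s" "continuous_on UNIV w"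
    unfolding w_def by (auto intro!: power_mono continuous_intros)
  show "(\<integral>\<^sup>+x. ennreal (w (c * norm x)) \<partial>\<gamma>) < \<infinity>" if c: "0 \<le> c" for c
  proof (rule le_less_trans[OF nn_integral_mono gaussian_norm_exp_moment[OF g, of "real i * c"]])
    fix x :: 'a
    have "c * norm x \<le> exp (c * norm x)" using exp_ge_add_one_self[of "c * norm x"] by linarith
    then have "(c * norm x) ^ i \<le> exp (c * norm x) ^ i" using c by (intro power_mono) auto
    then show "ennreal (w (c * norm x)) \<le> ennreal (exp (real i * c * norm x))"
      unfolding w_def by (intro ennreal_leI) (simp add: exp_of_nat_mult mult.assoc)
  qed (use c in simp)
  show "\<exists>q. 0 < q \<and> q \<le> 1 \<and> (\<forall>s\<ge>R. w (\<theta> * s) \<le> (1 - q) * w s)" if "0 \<le> \<theta>" "\<theta> < 1" "0 < R" for \<theta> R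
    using that i by (intro exI[of _ "1 - \<theta> ^ i"]) (auto simp: w_def power_mult_distrib power_less_one_iff)
qed

text \<open>Here the contraction constant depends on \<open>R\<close>: the profile satisfies
\<open>w (\<theta> s) = exp (- v (1 - \<theta>) s) * w s\<close>.\<close>

lemma exponential_weight_properties:
  fixes \<gamma> :: "'a::{real_inner, polish_space} measure"
  assumes g: "centred_gaussian \<gamma>" and v: "0 < v"
  defines "w \<equiv> \<lambda>s::real. exp (v * s)"
  shows "\<And>s t. 0 \<le> s \<Longrightarrow> s \<le> t \<Longrightarrow> w s \<le> w t" and "\<And>s. 0 \<le> s \<Longrightarrow> 0 \<le> w s"
    and "continuous_on UNIV w"
    and "\<And>c. 0 \<le> c \<Longrightarrow> (\<integral>\<^sup>+x. ennreal (w (c * norm x)) \<partial>\<gamma>) < \<infinity>"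
    and "\<And>\<theta> R. 0 \<le> \<theta> \<Longrightarrow> \<theta> < 1 \<Longrightarrow> 0 < R \<Longrightarrow> \<exists>q. 0 < q \<and> q \<le> 1 \<and> (\<forall>s\<ge>R. w (\<theta> * s) \<le> (1 - q) * w s)"
proof -
  show "\<And>s t. 0 \<le> s \<Longrightarrow> s \<le> t \<Longrightarrow> w s \<le> w t" "\<And>s. 0 \<le> s \<Longrightarrow> 0 \<le> w s" "continuous_on UNIV w"
    unfolding w_def using v by (auto intro!: continuous_intros)
  show "(\<integral>\<^sup>+x. ennreal (w (c * norm x)) \<partial>\<gamma>) < \<infinity>" if c: "0 \<le> c" for c
    using gaussian_norm_exp_moment[OF g, of "v * c"] v c by (simp add: w_def mult.assoc)
  show "\<exists>q. 0 < q \<and> q \<le> 1 \<and> (\<forall>s\<ge>R. w (\<theta> * s) \<le> (1 - q) * w s)" if th: "0 \<le> \<theta>" "\<theta> < 1" "0 < R" for \<theta> R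
  proof (intro exI[of _ "1 - exp (- (v * (1 - \<theta>) * R))"] conjI allI impI)
    show "0 < 1 - exp (- (v * (1 - \<theta>) * R))" "1 - exp (- (v * (1 - \<theta>) * R)) \<le> 1" using v th by auto
    fix s assume "R \<le> s"
    then have "v * (1 - \<theta>) * R \<le> v * (1 - \<theta>) * s" using v th by (intro mult_left_mono) auto
    then have "v * (\<theta> * s) \<le> - (v * (1 - \<theta>) * R) + v * s" by (simp add: algebra_simps)
    then show "w (\<theta> * s) \<le> (1 - (1 - exp (- (v * (1 - \<theta>) * R)))) * w s"
      unfolding w_def by (simp add: exp_add[symmetric])
  qed
qed

lemma exp_growth_locally_lipschitz_continuous:
  fixes \<Phi> :: "'a::real_normed_vector \<Rightarrow> real"
  assumes "exp_growth_locally_lipschitz \<Phi>"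
  shows "continuous_on UNIV \<Phi>"
proof -
  from assms[unfolded exp_growth_locally_lipschitz_def, rule_format, OF zero_less_one]
  obtain M where M: "\<forall>s>0. \<forall>x\<in>ball 0 s. \<forall>y\<in>ball 0 s. x \<noteq> y \<longrightarrow>
     \<bar>\<Phi> x - \<Phi> y\<bar> / norm (x - y) \<le> M * exp (1 * s)" ..
  have "isCont \<Phi> z" for z
  proof -
    define s where "s = norm z + 1"
    have s: "0 < s" "z \<in> ball 0 s" by (auto simp: s_def add_nonneg_pos)
    have "(\<bar>M\<bar> * exp s)-lipschitz_on (ball 0 s) \<Phi>"
    proof (rule lipschitz_onI)
      fix x y assume xy: "x \<in> ball (0::'a) s" "y \<in> ball (0::'a) s"
      show "dist (\<Phi> x) (\<Phi> y) \<le> \<bar>M\<bar> * exp s * dist x y"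
      proof (cases "x = y")
        case False
        then have "\<bar>\<Phi> x - \<Phi> y\<bar> \<le> M * exp s * norm (x - y)"
          using M[rule_format, OF s(1) xy False] False by (simp add: pos_divide_le_eq)
        also have "\<dots> \<le> \<bar>M\<bar> * exp s * norm (x - y)" by (intro mult_right_mono) auto
        finally show ?thesis by (simp add: dist_norm)
      qed simp
    qed simp
    then have "continuous_on (ball 0 s) \<Phi>" by (rule lipschitz_on_continuous_on)
    then show ?thesis using s(2) by (simp add: continuous_on_eq_continuous_at)
  qed
  then show ?thesis by (simp add: continuous_on_eq_continuous_at)
qed

text \<open>The upper bound comes from the straight segment. For \<open>x = y\<close> the lower bound can fail: in the zero space there is
no unit speed path at all, and the infimum over the empty set has no particular value.\<close>

lemma path_dist_bounds:
  fixes x y :: "'a::real_normed_vector"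
  assumes xy: "x \<noteq> y" and e: "0 < \<epsilon>" "0 \<le> \<eta>"
  shows "0 \<le> path_dist \<epsilon> \<eta> x y"
    and "path_dist \<epsilon> \<eta> x y \<le> 1 / \<epsilon> * exp (\<eta> * (norm x + norm (x - y))) * norm (x - y)"
proof -
  let ?S = "{(T, \<psi>). 0 \<le> T \<and> \<psi> \<in> unit_speed_paths T x y}"
  let ?f = "\<lambda>(T, \<psi>). 1 / \<epsilon> * integral {0..T} (\<lambda>t. exp (\<eta> * norm (\<psi> t)))"
  define T where "T = norm (x - y)"
  define \<psi> where "\<psi> = (\<lambda>t. x + (t / T) *\<^sub>R (y - x))"
  have T: "0 < T" using xy by (simp add: T_def)
  have Tyx: "norm (y - x) = T" by (simp add: T_def norm_minus_commute)
  have "\<psi> \<in> unit_speed_paths T x y"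
    unfolding unit_speed_paths_def
  proof (intro CollectI conjI exI[of _ "\<lambda>_. (1 / T) *\<^sub>R (y - x)"] ballI)
    show "\<psi> 0 = x" "\<psi> T = y" using T by (auto simp: \<psi>_def)
    show "norm ((1 / T) *\<^sub>R (y - x)) = 1" using T Tyx by simp
    show "(\<psi> has_vector_derivative (1 / T) *\<^sub>R (y - x)) (at t within {0..T})" for t
      unfolding \<psi>_def using T by (auto intro!: derivative_eq_intros simp: has_vector_derivative_def scaleR_scaleR)
  qed simp
  then have mem: "(T, \<psi>) \<in> ?S" using T by auto
  have nn: "0 \<le> ?f p" for p
  proof -
    have "0 \<le> integral {0..fst p} (\<lambda>t. exp (\<eta> * norm (snd p t)))"
      by (cases "(\<lambda>t. exp (\<eta> * norm (snd p t))) integrable_on {0..fst p}")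
        (auto intro!: integral_nonneg simp: not_integrable_integral)
    then show ?thesis using e by (simp add: split_beta)
  qed
  have "0 \<le> (INF p\<in>?S. ?f p)" using mem nn by (intro cINF_greatest) auto
  then show "0 \<le> path_dist \<epsilon> \<eta> x y" by (simp add: path_dist_def)
  have bdd: "bdd_below (?f ` ?S)" using nn by (intro bdd_belowI2[of _ 0]) auto
  have "path_dist \<epsilon> \<eta> x y \<le> (INF p\<in>?S. ?f p)" unfolding path_dist_def by simp
  also have "\<dots> \<le> ?f (T, \<psi>)" by (rule cINF_lower[OF bdd mem])
  also have "\<dots> \<le> 1 / \<epsilon> * (exp (\<eta> * (norm x + norm (x - y))) * norm (x - y))"
  proof -
    have "integral {0..T} (\<lambda>t. exp (\<eta> * norm (\<psi> t))) \<le> integral {0..T} (\<lambda>_. exp (\<eta> * (norm x + T)))"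
    proof (rule integral_le)
      show "(\<lambda>t. exp (\<eta> * norm (\<psi> t))) integrable_on {0..T}"
        unfolding \<psi>_def using T by (intro integrable_continuous_interval continuous_intros) auto
      show "(\<lambda>_. exp (\<eta> * (norm x + T))) integrable_on {0..T}"
        by (rule integrable_continuous_interval) (intro continuous_intros)
      fix t assume t: "t \<in> {0..T}"
      have "norm (\<psi> t) \<le> norm x + norm ((t / T) *\<^sub>R (y - x))"
        unfolding \<psi>_def by (rule norm_triangle_ineq)
      also have "norm ((t / T) *\<^sub>R (y - x)) = t" using t T Tyx by simp
      also have "norm x + t \<le> norm x + T" using t by simp
      finally show "exp (\<eta> * norm (\<psi> t)) \<le> exp (\<eta> * (norm x + T))" using e by (simp add: mult_left_mono)
    qed
    also have "\<dots> = T * exp (\<eta> * (norm x + T))" using T by simp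
    finally show ?thesis using e unfolding T_def[symmetric] by (simp add: mult_left_mono mult.commute divide_right_mono)
  qed
  finally show "path_dist \<epsilon> \<eta> x y \<le> 1 / \<epsilon> * exp (\<eta> * (norm x + norm (x - y))) * norm (x - y)"
    by (simp add: mult.assoc)
qed

text \<open>Since \<open>d\<close> tends to 0 at the diagonal, a function that is Lipschitz for the weighted distance is continuous, and
therefore measurable.\<close>

lemma continuous_if_weighted_lipschitz:
  fixes h V :: "'a::real_normed_vector \<Rightarrow> real"
  assumes V: "continuous_on UNIV V"
    and lip: "\<And>x y. x \<noteq> y \<Longrightarrow> \<bar>h x - h y\<bar> \<le> L * weighted_dist d V x y" and L: "0 < L"
    and V0: "\<And>x. 0 \<le> V x"
    and d: "\<And>x y. x \<noteq> y \<Longrightarrow> norm (x - y) < 1 \<Longrightarrow> d x y \<le> C x * norm (x - y)"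
  shows "continuous_on UNIV h"
proof -
  have "isCont h x" for x
  proof -
    have Vx: "isCont V x" using V by (simp add: continuous_on_eq_continuous_at)
    let ?g = "\<lambda>y. L * sqrt (C x * norm (x - y) * (1 + V x + V y))"
    have "eventually (\<lambda>y. norm (h y - h x) \<le> ?g y) (at x)"
      unfolding eventually_at
    proof (intro exI[of _ 1] conjI ballI impI)
      fix y assume y: "y \<noteq> x \<and> dist y x < 1"
      then have n: "norm (x - y) < 1" by (simp add: dist_norm norm_minus_commute)
      have "norm (h y - h x) = \<bar>h x - h y\<bar>" by (simp add: abs_minus_commute)
      also have "\<dots> \<le> L * weighted_dist d V x y" using y by (intro lip) auto
      also have "\<dots> \<le> ?g y" unfolding weighted_dist_def
        using y n L V0[of x] V0[of y] by (intro mult_left_mono real_sqrt_le_mono mult_right_mono d) auto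
      finally show "norm (h y - h x) \<le> ?g y" .
    qed simp
    moreover have "(?g \<longlongrightarrow> L * sqrt (C x * norm (x - x) * (1 + V x + V x))) (at x)"
      using Vx[unfolded isCont_def] by (intro tendsto_intros)
    then have "(?g \<longlongrightarrow> 0) (at x)" by simp
    ultimately have "((\<lambda>y. h y - h x) \<longlongrightarrow> 0) (at x)" by (rule Lim_null_comparison)
    then show ?thesis unfolding isCont_def by (rule LIM_zero_cancel)
  qed
  then show ?thesis by (simp add: continuous_on_eq_continuous_at)
qed

section \<open>The law of large numbers for the pCN chain\<close>

theorem theorem4p3:
  fixes \<gamma> :: "'a::{real_inner, polish_space} measure"
    and \<Phi> h V :: "'a \<Rightarrow> real"
    and d :: "'a \<Rightarrow> 'a \<Rightarrow> real"
    and \<delta> \<rho> R \<alpha>\<^sub>l \<epsilon> \<eta> :: real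
    and r :: "real \<Rightarrow> real"
    and \<Omega> :: "'m measure"
    and X :: "nat \<Rightarrow> 'm \<Rightarrow> 'a"
    and x0 :: 'a
  assumes gauss: "centred_gaussian \<gamma>"
    and delta: "0 < \<delta>" "\<delta> \<le> 1/2"
    and rho: "\<rho> = 1 - sqrt (1 - 2 * \<delta>)"
    and integrable: "integrable \<gamma> (\<lambda>x. exp (- \<Phi> x))"
    and R: "0 < R"
    and r_pos: "\<And>s. 0 < s \<Longrightarrow> 0 < r s"
    and r_le: "\<And>s. R \<le> s \<Longrightarrow> r s \<le> \<rho> / 2 * s"
    and acceptance_bound: "\<And>x. x \<notin> ball 0 R \<Longrightarrow>
      (INF z\<in>ball ((1 - \<rho>) *\<^sub>R x) (r (norm x)). exp (- \<Phi> z + \<Phi> x)) > exp \<alpha>\<^sub>l"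
    and setting: "setting_a \<Phi> r V d \<epsilon> \<or> setting_b \<Phi> r V d \<epsilon> \<eta>"
    and sufficiently_small: "eventually_halving (weighted_dist d V) (pcn_kernel \<delta> \<Phi> \<gamma>)"
    and support: "measure_support (target_measure \<Phi> \<gamma>) = UNIV"
    and lipschitz: "\<exists>L. \<forall>x y. \<bar>h x - h y\<bar> \<le> L * weighted_dist d V x y"
    and chain: "markov_chain \<Omega> (pcn_kernel \<delta> \<Phi> \<gamma>) x0 X"
  shows "AE \<omega> in \<Omega>.
    (\<lambda>n. \<bar>(\<Sum>i=1..n. h (X i \<omega>)) / real n - (\<integral>x. h x \<partial>target_measure \<Phi> \<gamma>)\<bar>) \<longlonglongrightarrow> 0"
proof -
  have settings: "(\<exists>L. L-lipschitz_on UNIV \<Phi>) \<or> exp_growth_locally_lipschitz \<Phi>"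
    "power_radius r \<or> constant_radius r" "polynomial_weight V \<or> exponential_weight V"
    using setting by (auto simp: setting_a_def setting_b_def)
  have \<Phi>: "continuous_on UNIV \<Phi>"
    using settings(1)
  proof
    assume "\<exists>L. L-lipschitz_on UNIV \<Phi>"
    then show ?thesis by (elim exE) (rule lipschitz_on_continuous_on)
  qed (rule exp_growth_locally_lipschitz_continuous)
  have d1: "d x y \<le> 1" for x y
    using setting by (auto simp: setting_a_def setting_b_def trunc_dist_def path_dist_def)
  have d0: "0 \<le> d x y" if "x \<noteq> y" for x y
    using setting path_dist_bounds(1)[OF that, of \<epsilon> \<eta>] by (auto simp: setting_a_def setting_b_def trunc_dist_def)
  \<comment> \<open>Both distances have slope at most C x near x; the factor norm x + 1 bounds the norm along a
    segment from x to a point at distance less than 1.\<close>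
  define C where "C = (\<lambda>x::'a. 1 / \<epsilon> * exp (\<bar>\<eta>\<bar> * (norm x + 1)))"
  have dC: "d x y \<le> C x * norm (x - y)" if xy: "x \<noteq> y" "norm (x - y) < 1" for x y
    using setting
  proof
    assume "setting_a \<Phi> r V d \<epsilon>"
    then have e: "0 < \<epsilon>" and d: "d = trunc_dist \<epsilon>" by (auto simp: setting_a_def)
    have "d x y \<le> 1 / \<epsilon> * 1 * norm (x - y)" unfolding d trunc_dist_def by simp
    also have "\<dots> \<le> C x * norm (x - y)" unfolding C_def using e by (intro mult_right_mono mult_left_mono) auto
    finally show ?thesis .
  next
    assume "setting_b \<Phi> r V d \<epsilon> \<eta>"
    then have e: "0 < \<epsilon>" "0 < \<eta>" and d: "d = path_dist \<epsilon> \<eta>" by (auto simp: setting_b_def)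
    have "d x y \<le> 1 / \<epsilon> * exp (\<eta> * (norm x + norm (x - y))) * norm (x - y)"
      unfolding d using xy e by (intro path_dist_bounds) auto
    also have "\<dots> \<le> C x * norm (x - y)"
      unfolding C_def using e xy by (intro mult_right_mono mult_left_mono) auto
    finally show ?thesis .
  qed
  interpret P: pcn \<gamma> \<Phi> \<delta>
    by unfold_locales (fact gauss delta integrable borel_measurable_continuous_onI[OF \<Phi>])+
  interpret K: markov_kernel "pcn_kernel \<delta> \<Phi> \<gamma>"
    by (rule markov_kernel.intro) (rule P.kernel_measurable P.prob_space_kernel)+
  have drift_w: "\<exists>l b. 0 \<le> l \<and> l < 1 \<and> 0 \<le> b \<and>
      (\<forall>x. (\<integral>\<^sup>+y. ennreal (w (norm y)) \<partial>pcn_kernel \<delta> \<Phi> \<gamma> x) \<le> ennreal (l * w (norm x) + b))"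
    if mono: "\<And>s t. 0 \<le> s \<Longrightarrow> s \<le> t \<Longrightarrow> w s \<le> w t" and w0: "\<And>s. 0 \<le> s \<Longrightarrow> 0 \<le> w s"
      and cont: "continuous_on UNIV w"
      and mom: "\<And>c. 0 \<le> c \<Longrightarrow> (\<integral>\<^sup>+x. ennreal (w (c * norm x)) \<partial>\<gamma>) < \<infinity>"
      and contr: "\<And>\<theta> R. 0 \<le> \<theta> \<Longrightarrow> \<theta> < 1 \<Longrightarrow> 0 < R \<Longrightarrow> \<exists>q. 0 < q \<and> q \<le> 1 \<and> (\<forall>s\<ge>R. w (\<theta> * s) \<le> (1 - q) * w s)"
    for w :: "real \<Rightarrow> real"
  proof -
    have rho01: "0 < \<rho>" "\<rho> \<le> 1" using delta unfolding rho by simp_all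
    obtain q where q: "0 < q" "q \<le> 1" "\<And>s. R \<le> s \<Longrightarrow> w ((1 - \<rho> / 2) * s) \<le> (1 - q) * w s"
      using contr[of "1 - \<rho> / 2" R] rho01 R by auto
    have rmono: "r R \<le> r s" if "R \<le> s" for s
      using settings(2)
    proof
      assume "power_radius r"
      then obtain c a where "0 < c" "1/2 < a" "\<And>s. 0 < s \<Longrightarrow> r s = c * s powr a"
        unfolding power_radius_def by blast
      then show ?thesis using R that by (auto intro!: mult_left_mono powr_mono2)
    next
      assume "constant_radius r"
      then show ?thesis using R that by (auto simp: constant_radius_def)
    qed
    have cm: "(\<lambda>x::'a. w (c * norm x)) \<in> borel_measurable borel" for c
      by (intro borel_measurable_continuous_onI continuous_on_compose2[OF cont] continuous_intros) auto
    \<comment> \<open>The radius function is nondecreasing on [R, \<infinity>), so its value at R serves for all larger norms.\<close>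
    show ?thesis
    proof (rule P.drift_condition[where R = R and q = q and r\<^sub>0 = "r R" and a = "min 1 (exp \<alpha>\<^sub>l)"])
      show "\<rho> = 1 - sqrt (1 - 2 * \<delta>)" by (rule rho)
      show "(\<lambda>x::'a. w (norm x)) \<in> borel_measurable borel" using cm[of 1] by simp
      show "0 < r R" "r R \<le> \<rho> / 2 * R" using r_pos[OF R] r_le[of R] by auto
      then show "0 < measure \<gamma> (ball 0 (r R / sqrt (2 * \<delta>)))"
        using delta by (intro P.gaussian_ball_pos support) auto
      fix x z :: 'a assume x: "R \<le> norm x" and z: "dist ((1 - \<rho>) *\<^sub>R x) z < r R"
      have "x \<notin> ball 0 R" using x by simp
      then have "exp \<alpha>\<^sub>l < (INF z\<in>ball ((1 - \<rho>) *\<^sub>R x) (r (norm x)). exp (- \<Phi> z + \<Phi> x))"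
        by (rule acceptance_bound)
      also have "\<dots> \<le> exp (- \<Phi> z + \<Phi> x)"
        using z rmono[OF x] by (intro cINF_lower bdd_belowI2[of _ 0]) auto
      finally have "exp \<alpha>\<^sub>l < exp (- \<Phi> z + \<Phi> x)" .
      then have "min 1 (exp \<alpha>\<^sub>l) \<le> min 1 (exp (- \<Phi> z + \<Phi> x))"
        by (rule min.mono[OF order_refl less_imp_le])
      then show "min 1 (exp \<alpha>\<^sub>l) \<le> acceptance \<Phi> x z" by (simp add: acceptance_def)
    qed (use mono w0 mom cm R q in auto)
  qed
  have "continuous_on UNIV V \<and> (\<forall>x. 0 \<le> V x) \<and> (\<exists>l b. 0 \<le> l \<and> l < 1 \<and> 0 \<le> b \<and>
      (\<forall>x. (\<integral>\<^sup>+y. ennreal (V y) \<partial>pcn_kernel \<delta> \<Phi> \<gamma> x) \<le> ennreal (l * V x + b)))"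
    using settings(3)
  proof
    assume "polynomial_weight V"
    then obtain i where V: "V = (\<lambda>x. norm x ^ i)" by (auto simp: polynomial_weight_def)
    have "continuous_on UNIV V" unfolding V by (intro continuous_intros)
    moreover have "\<exists>l b. 0 \<le> l \<and> l < 1 \<and> 0 \<le> b \<and>
      (\<forall>x. (\<integral>\<^sup>+y. ennreal (V y) \<partial>pcn_kernel \<delta> \<Phi> \<gamma> x) \<le> ennreal (l * V x + b))"
    proof (cases "i = 0")
      case True
      \<comment> \<open>The weight is constant 1, and so is its integral under a probability measure.\<close>
      have "emeasure (pcn_kernel \<delta> \<Phi> \<gamma> x) (space (pcn_kernel \<delta> \<Phi> \<gamma> x)) = 1" for x
        using prob_space.emeasure_space_1[OF P.prob_space_kernel] .
      then show ?thesis unfolding V True by (intro exI[of _ 0] exI[of _ 1]) simp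
    next
      case False
      then show ?thesis unfolding V
        using drift_w[OF polynomial_weight_properties[OF gauss, of i]] by simp
    qed
    ultimately show ?thesis by (simp add: V)
  next
    assume "exponential_weight V"
    then obtain v where v: "0 < v" and V: "V = (\<lambda>x. exp (v * norm x))" by (auto simp: exponential_weight_def)
    have "continuous_on UNIV V" unfolding V by (intro continuous_intros)
    then show ?thesis unfolding V
      using drift_w[OF exponential_weight_properties[OF gauss v]] by simp
  qed
  then obtain l b where Vc: "continuous_on UNIV V" and V0: "\<And>x. 0 \<le> V x" and lb: "0 \<le> l" "l < 1" "0 \<le> b"
    and drift: "\<And>x. (\<integral>\<^sup>+y. ennreal (V y) \<partial>pcn_kernel \<delta> \<Phi> \<gamma> x) \<le> ennreal (l * V x + b)" by blast
  have cost: "weighted_dist d V x y \<le> sqrt (1 + V x + V y)" for x y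
    unfolding weighted_dist_def using mult_right_mono[OF d1[of x y], of "1 + V x + V y"] V0[of x] V0[of y] by simp
  interpret C: contracting_kernel "pcn_kernel \<delta> \<Phi> \<gamma>" V l b "target_measure \<Phi> \<gamma>" "weighted_dist d V"
    by (intro contracting_kernel.intro contracting_kernel_axioms.intro)
      (fact K.markov_kernel_axioms V0 lb drift P.sets_target P.prob_space_target P.target_invariant sufficiently_small cost
        borel_measurable_continuous_onI[OF Vc])+
  obtain L0 where L0: "\<And>x y. \<bar>h x - h y\<bar> \<le> L0 * weighted_dist d V x y" using lipschitz by blast
  define L where "L = max L0 1"
  have L: "0 < L" by (simp add: L_def)
  have lip: "\<bar>h x - h y\<bar> \<le> L * weighted_dist d V x y" if "x \<noteq> y" for x y
  proof -
    have "0 \<le> weighted_dist d V x y"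
      unfolding weighted_dist_def using d0[OF that] V0[of x] V0[of y] by simp
    then have "L0 * weighted_dist d V x y \<le> L * weighted_dist d V x y"
      by (intro mult_right_mono) (auto simp: L_def)
    then show ?thesis using L0[of x y] by simp
  qed
  have hc: "continuous_on UNIV h"
    by (rule continuous_if_weighted_lipschitz[OF Vc lip L V0 dC])
  have hm: "h \<in> borel_measurable borel" by (rule borel_measurable_continuous_onI[OF hc])
  have lip': "ennreal (\<bar>h x - h y\<bar> / L) \<le> ennreal (weighted_dist d V x y)" for x y
  proof (cases "x = y")
    case False
    then show ?thesis using lip[OF False] L by (intro ennreal_leI) (simp add: pos_divide_le_eq mult.commute)
  qed simp
  define A where "A = \<bar>h 0\<bar> + L * sqrt (1 + V 0)"
  have growth: "\<bar>h x\<bar> \<le> A * sqrt (1 + V x)" for x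
  proof -
    have "\<bar>h x - h 0\<bar> \<le> L * sqrt (1 + V x + V 0)"
    proof (cases "x = 0")
      case False
      then show ?thesis using order_trans[OF lip[OF False] mult_left_mono[OF cost, of L]] L by simp
    qed (use L V0[of 0] in simp)
    also have "\<dots> \<le> L * (sqrt (1 + V 0) * sqrt (1 + V x))"
      unfolding real_sqrt_mult[symmetric]
      using L V0[of x] V0[of 0] by (intro mult_left_mono real_sqrt_le_mono) (auto simp: algebra_simps)
    finally have "\<bar>h x\<bar> \<le> \<bar>h 0\<bar> * 1 + L * sqrt (1 + V 0) * sqrt (1 + V x)" by simp
    also have "\<dots> \<le> \<bar>h 0\<bar> * sqrt (1 + V x) + L * sqrt (1 + V 0) * sqrt (1 + V x)"
      using V0[of x] by (intro add_right_mono mult_left_mono) auto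
    finally show ?thesis by (simp add: A_def distrib_right)
  qed
  have A: "0 \<le> A" using L V0[of 0] by (simp add: A_def)
  have "AE \<omega> in \<Omega>. (\<lambda>n. (\<Sum>i=1..n. h (X i \<omega>)) / real n) \<longlonglongrightarrow> (\<integral>x. h x \<partial>target_measure \<Phi> \<gamma>)"
    by (rule C.strong_law_of_large_numbers[OF chain hm L lip' growth A])
  then show ?thesis
    by (rule eventually_mono) (intro tendsto_rabs_zero LIM_zero)
qed

end
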